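(* Let $(V,\omega)$ be a $2n$-dimensional real symplectic vector space, $L_0,L_1,L_2\in\Lambda(V,\omega)$, and $\psi:[0,T]\to\mathrm{Sp}(V,\omega)$ continuous with $\psi(0)=\mathrm{Id}$. For $t\in[0,T]$ set $\ell_1(t)=\psi(t)L_1$, $\ell_2(t)=\psi(t)L_2$, $\mu_0(t)=\psi(t)^{-1}L_0$. Let $\epsilon_a=L_1\cap L_2+L_2\cap L_0$, $\epsilon_b=L_1\cap L_2+L_2\cap\mu_0(T)$ and $k=\min\{\dim\epsilon_a,\dim\epsilon_b\}$. Then $$\Big|\iota^{\mathrm{CLM}}\big(L_0,\ell_1(t);t\in[0,T]\big)-\iota^{\mathrm{CLM}}\big(L_0,\ell_2(t);t\in[0,T]\big)\Big|\le n-k.$$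
   Context: $\mathrm{Sp}(V,\omega)$ is the group of linear automorphisms of $V$ preserving $\omega$. Let $(V,\omega)$ be a real symplectic vector space of dimension $2n$ and $\Lambda(V,\omega)$ its Lagrangian Grassmannian (the $n$-dimensional subspaces $L$ with $\omega|_{L\times L}=0$). For $L_0\in\Lambda(V,\omega)$ and a continuous path $\ell:[a,b]\to\Lambda(V,\omega)$, $\iota^{\mathrm{CLM}}(L_0,\ell(t);t\in[a,b])\in\mathbb Z$ denotes the Cappell–Lee–Miller Maslov index: the intersection index of $\ell$ with the Maslov cycle $\Sigma(L_0)=\{L\in\Lambda(V,\omega): L\cap L_0\neq\{0\}\}$; it is invariant under homotopies of $\ell$ with fixed endpoints, additive under concatenation of paths, and for $\mathscr C^1$ paths all of whose crossings are regular it is given by $\iota^{\mathrm{CLM}}(L_0,\ell(t);t\in[a,b])=n_+\big(\Gamma(\ell,L_0,a)\big)+\sum_{a<t<b}\operatorname{sgn}\Gamma(\ell,L_0,t)-n_-\big(\Gamma(\ell,L_0,b)\big)$. Here a crossing is an instant $t_0$ with $\ell(t_0)\cap L_0\neq\{0\}$; the crossing form $\Gamma(\ell,L_0,t_0)$ is the quadratic form on $\ell(t_0)\cap L_0$ defined by choosing $W\in\Lambda(V,\omega)$ transversal to $\ell(t_0)$, letting, for $v\in\ell(t_0)$ and $t$ near $t_0$, $w(t)\in W$ be the unique vector with $v+w(t)\in\ell(t)$, and setting $\Gamma(\ell,L_0,t_0)[v]=\frac{d}{dt}\big|_{t=t_0}\omega(v,w(t))$; a crossing is regular if this form is nondegenerate;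 $n_+,n_-$ denote positive and negative inertia indices and $\operatorname{sgn}=n_+-n_-$. *)

theory Defs
  imports "HOL-Analysis.Analysis"
begin

text \<open>A real symplectic vector space is modelled as a finite-dimensional real vector
  space (type class euclidean_space; the inner product is only used to give the
  Lagrangian Grassmannian its canonical topology) with a symplectic form.\<close>

definition symplectic_form :: "('a::euclidean_space \<Rightarrow> 'a \<Rightarrow> real) \<Rightarrow> bool" where
  "symplectic_form \<omega> \<longleftrightarrow> bilinear \<omega> \<and> (\<forall>u v. \<omega> u v = - \<omega> v u)
     \<and> (\<forall>u. (\<forall>v. \<omega> u v = 0) \<longrightarrow> u = 0)"

definition Sp :: "('a::euclidean_space \<Rightarrow> 'a \<Rightarrow> real) \<Rightarrow> ('a \<Rightarrow> 'a) set" where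
  "Sp \<omega> = {A. linear A \<and> bij A \<and> (\<forall>u v. \<omega> (A u) (A v) = \<omega> u v)}"

definition lagrangian :: "('a::euclidean_space \<Rightarrow> 'a \<Rightarrow> real) \<Rightarrow> 'a set \<Rightarrow> bool" where
  "lagrangian \<omega> L \<longleftrightarrow> subspace L \<and> 2 * dim L = DIM('a) \<and> (\<forall>u\<in>L. \<forall>v\<in>L. \<omega> u v = 0)"

text \<open>Orthogonal projection onto a subspace; a family of subspaces is continuous
  (resp. C^1) iff the family of orthogonal projections is (gap topology).\<close>
definition proj :: "'a::euclidean_space set \<Rightarrow> 'a \<Rightarrow> 'a" where
  "proj L x = closest_point L x"

definition lag_path :: "('a::euclidean_space \<Rightarrow> 'a \<Rightarrow> real) \<Rightarrow> (real \<Rightarrow> 'a set) \<Rightarrow> real \<Rightarrow> real \<Rightarrow> bool" where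
  "lag_path \<omega> l a b \<longleftrightarrow> (\<forall>t\<in>{a..b}. lagrangian \<omega> (l t))
     \<and> (\<forall>x. continuous_on {a..b} (\<lambda>t. proj (l t) x))"

definition C1_lag_path :: "('a::euclidean_space \<Rightarrow> 'a \<Rightarrow> real) \<Rightarrow> (real \<Rightarrow> 'a set) \<Rightarrow> real \<Rightarrow> real \<Rightarrow> bool" where
  "C1_lag_path \<omega> l a b \<longleftrightarrow> lag_path \<omega> l a b \<and>
     (\<forall>x. \<exists>D. continuous_on {a..b} D \<and>
        (\<forall>t\<in>{a..b}. ((\<lambda>s. proj (l s) x) has_vector_derivative D t) (at t within {a..b})))"

definition lag_homotopic :: "('a::euclidean_space \<Rightarrow> 'a \<Rightarrow> real) \<Rightarrow> real \<Rightarrow> real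
     \<Rightarrow> (real \<Rightarrow> 'a set) \<Rightarrow> (real \<Rightarrow> 'a set) \<Rightarrow> bool" where
  "lag_homotopic \<omega> a b l l' \<longleftrightarrow> (\<exists>H :: real \<Rightarrow> real \<Rightarrow> 'a set.
      (\<forall>s\<in>{0..1}. \<forall>t\<in>{a..b}. lagrangian \<omega> (H s t))
    \<and> (\<forall>x. continuous_on ({0..1} \<times> {a..b}) (\<lambda>(s,t). proj (H s t) x))
    \<and> (\<forall>t\<in>{a..b}. H 0 t = l t \<and> H 1 t = l' t)
    \<and> (\<forall>s\<in>{0..1}. H s a = l a \<and> H s b = l b))"

definition polar :: "('a::real_vector \<Rightarrow> real) \<Rightarrow> 'a \<Rightarrow> 'a \<Rightarrow> real" where
  "polar Q u v = (Q (u + v) - Q u - Q v) / 2"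

definition nondegenerate_on :: "('a::real_vector \<Rightarrow> real) \<Rightarrow> 'a set \<Rightarrow> bool" where
  "nondegenerate_on Q E \<longleftrightarrow> (\<forall>u\<in>E. (\<forall>v\<in>E. polar Q u v = 0) \<longrightarrow> u = 0)"

definition n_plus :: "('a::euclidean_space \<Rightarrow> real) \<Rightarrow> 'a set \<Rightarrow> nat" where
  "n_plus Q E = Max {dim F | F. subspace F \<and> F \<subseteq> E \<and> (\<forall>v\<in>F. v \<noteq> 0 \<longrightarrow> Q v > 0)}"

definition n_minus :: "('a::euclidean_space \<Rightarrow> real) \<Rightarrow> 'a set \<Rightarrow> nat" where
  "n_minus Q E = Max {dim F | F. subspace F \<and> F \<subseteq> E \<and> (\<forall>v\<in>F. v \<noteq> 0 \<longrightarrow> Q v < 0)}"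

definition signature :: "('a::euclidean_space \<Rightarrow> real) \<Rightarrow> 'a set \<Rightarrow> int" where
  "signature Q E = int (n_plus Q E) - int (n_minus Q E)"

text \<open>Crossing form of the path at t0 (as a quadratic form on ell(t0); it is used
  restricted to ell(t0) \<inter> L0). W is a Lagrangian transversal to ell(t0), w(t) the unique
  vector of W with v + w(t) in ell(t); derivative taken within [a,b] (one-sided at ends).\<close>
definition crossing_form :: "('a::euclidean_space \<Rightarrow> 'a \<Rightarrow> real) \<Rightarrow> (real \<Rightarrow> 'a set)
     \<Rightarrow> real \<Rightarrow> real \<Rightarrow> real \<Rightarrow> 'a \<Rightarrow> real" where
  "crossing_form \<omega> l a b t0 v =
     (let W = (SOME W. lagrangian \<omega> W \<and> W \<inter> l t0 = {0});
          w = (\<lambda>t. THE w. w \<in> W \<and> v + w \<in> l t)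
      in SOME d. ((\<lambda>t. \<omega> v (w t)) has_real_derivative d) (at t0 within {a..b}))"

definition crossing :: "(real \<Rightarrow> 'a::euclidean_space set) \<Rightarrow> 'a set \<Rightarrow> real \<Rightarrow> bool" where
  "crossing l L0 t \<longleftrightarrow> l t \<inter> L0 \<noteq> {0}"

definition regular_path :: "('a::euclidean_space \<Rightarrow> 'a \<Rightarrow> real) \<Rightarrow> 'a set \<Rightarrow> (real \<Rightarrow> 'a set)
     \<Rightarrow> real \<Rightarrow> real \<Rightarrow> bool" where
  "regular_path \<omega> L0 l a b \<longleftrightarrow> C1_lag_path \<omega> l a b \<and>
     (\<forall>t\<in>{a..b}. crossing l L0 t \<longrightarrow> nondegenerate_on (crossing_form \<omega> l a b t) (l t \<inter> L0))"

definition crossing_sum :: "('a::euclidean_space \<Rightarrow> 'a \<Rightarrow> real) \<Rightarrow> 'a set \<Rightarrow> (real \<Rightarrow> 'a set)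
     \<Rightarrow> real \<Rightarrow> real \<Rightarrow> int" where
  "crossing_sum \<omega> L0 l a b =
     int (n_plus (crossing_form \<omega> l a b a) (l a \<inter> L0))
     + (\<Sum>t\<in>{t. a < t \<and> t < b \<and> crossing l L0 t}. signature (crossing_form \<omega> l a b t) (l t \<inter> L0))
     - int (n_minus (crossing_form \<omega> l a b b) (l b \<inter> L0))"

text \<open>CLM Maslov index of a continuous Lagrangian path: the crossing-form count of any
  C^1 path with only regular crossings that is homotopic to it with fixed endpoints
  (well defined by homotopy invariance).\<close>
definition iota_CLM :: "('a::euclidean_space \<Rightarrow> 'a \<Rightarrow> real) \<Rightarrow> 'a set \<Rightarrow> (real \<Rightarrow> 'a set)
     \<Rightarrow> real \<Rightarrow> real \<Rightarrow> int" where
  "iota_CLM \<omega> L0 l a b = (THE m. \<exists>l'. regular_path \<omega> L0 l' a b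
       \<and> lag_homotopic \<omega> a b l l' \<and> m = crossing_sum \<omega> L0 l' a b)"

definition subspace_sum :: "'a::real_vector set \<Rightarrow> 'a set \<Rightarrow> 'a set" where
  "subspace_sum A B = {x + y | x y. x \<in> A \<and> y \<in> B}"

end

theory Submission
  imports Defs
begin

text \<open>If \<open>W\<close> is a Lagrangian transversal to \<open>L0\<close>, the Lagrangians \<open>L\<close> transversal to \<open>W\<close> are the
  graphs of symmetric maps \<open>L0 \<rightarrow> W\<close>, that is, of quadratic forms on \<open>L0\<close> with kernel \<open>L \<inter> L0\<close>.
  Along a path in this chart the crossing count is the increment of the positive inertia index of
  the form, and the indices in two charts differ by a locally constant function. Hence on every
  simply connected family of Lagrangians there is an index function, unique up to a constant, that
  differs from the positive inertia index in each chart by a locally constant function; the Maslov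
  index of a path is the increment of its index function.

  Join \<open>L1\<close> to \<open>L2\<close> by a path \<open>\<lambda>(s)\<close> that is a ray of positive semidefinite forms in a suitable
  chart. An index function on the rectangle \<open>\<psi>(t) \<lambda>(s)\<close> shows that the difference of the two Maslov
  indices is the difference of the indices of the monotone paths \<open>\<lambda>\<close> and \<open>\<psi>(T) \<lambda>\<close>. The index of a
  monotone path is non-negative, and is bounded by counting its intersections with \<open>L0\<close>.\<close>

section \<open>Inertia indices\<close>

text \<open>The shape of the crossing count is explained by the positive inertia index of a form
  depending on \<open>t\<close>: compared with its value at a regular crossing, it is larger by
  \<open>n_plus\<close> of the crossing form just after and by \<open>n_minus\<close> just before.
  As \<open>iota_CLM\<close> is a definite description over all regular representatives of a
  homotopy class, such a representative must also be built; it is pieced together from explicit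
  polynomial paths in charts.

  The deduction \<open>k\<close> comes from the far end of the monotone path. Along it the index can
  jump only just after an intersection with \<open>L0\<close>, by at most the excess of the
  dimension of that intersection over the part common to the whole path. The excesses at finitely
  many parameters, the end included, sum to at most n - dim (L1 \<inter> L2), but the end itself
  produces no jump. Subtracting its excess leaves n - dim (L1 \<inter> L2 + L2 \<inter> L0), and
  likewise with \<open>epsb\<close> for the path moved by \<psi>(T). Both increments are
  non-negative, so their difference is bounded by the larger of the two bounds.\<close>

lemma subspace_subspace_sum:
  "subspace A \<Longrightarrow> subspace B \<Longrightarrow> subspace (subspace_sum A B)"
  unfolding subspace_sum_def by (rule subspace_sums)

lemma dim_subspace_sum_Int:
  fixes A B :: "'a::euclidean_space set"
  shows "subspace A \<Longrightarrow> subspace B \<Longrightarrow> dim (subspace_sum A B) + dim (A \<inter> B) = dim A + dim B"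
  unfolding subspace_sum_def by (rule dim_sums_Int)

lemma dim_subspace_sum_disjoint:
  fixes A B :: "'a::euclidean_space set"
  assumes "subspace A" "subspace B" "\<And>x. x \<in> A \<Longrightarrow> x \<in> B \<Longrightarrow> x = 0"
  shows "dim (subspace_sum A B) = dim A + dim B"
proof -
  have "A \<inter> B = {0}"
    using assms subspace_0 by blast
  then show ?thesis
    using dim_subspace_sum_Int[OF assms(1,2)] by simp
qed

lemma subspace_sum_subset:
  "subspace E \<Longrightarrow> A \<subseteq> E \<Longrightarrow> B \<subseteq> E \<Longrightarrow> subspace_sum A B \<subseteq> E"
  unfolding subspace_sum_def by (auto intro: subspace_add)

lemma bilinear_forms:
  assumes "bilinear (B :: 'a::real_vector \<Rightarrow> 'a \<Rightarrow> real)"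
  shows "B (x + y) z = B x z + B y z" "B x (y + z) = B x y + B x z"
    "B (x - y) z = B x z - B y z" "B x (y - z) = B x y - B x z"
    "B (c *\<^sub>R x) y = c * B x y" "B x (c *\<^sub>R y) = c * B x y"
    "B (- x) y = - B x y" "B x (- y) = - B x y" "B 0 y = 0" "B x 0 = 0"
  using assms
  by (simp_all add: bilinear_ladd bilinear_radd bilinear_lsub bilinear_rsub bilinear_lmul
      bilinear_rmul bilinear_lneg bilinear_rneg bilinear_lzero bilinear_rzero)

lemma bilinearI_real:
  fixes B :: "'a::real_vector \<Rightarrow> 'b::real_vector \<Rightarrow> real"
  assumes "\<And>x y z. B (x + y) z = B x z + B y z" "\<And>x y z. B x (y + z) = B x y + B x z"
    "\<And>c x y. B (c *\<^sub>R x) y = c * B x y" "\<And>c x y. B x (c *\<^sub>R y) = c * B x y"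
  shows "bilinear B"
  unfolding bilinear_def using assms by (auto intro!: linearI)

lemma n_plus_set_finite: "finite {dim F | F :: 'a::euclidean_space set. P F}"
  by (rule finite_subset[of _ "{..DIM('a)}"]) (auto simp: dim_subset_UNIV)

lemma n_plus_ge:
  assumes "subspace F" "F \<subseteq> E" "\<And>v. v \<in> F \<Longrightarrow> v \<noteq> 0 \<Longrightarrow> Q v > 0"
  shows "dim F \<le> n_plus Q E"
  unfolding n_plus_def
  by (rule Max_ge[OF n_plus_set_finite]) (use assms in auto)

lemma n_plus_attained:
  assumes "0 \<in> E"
  obtains F where "subspace F" "F \<subseteq> E" "\<And>v. v \<in> F \<Longrightarrow> v \<noteq> 0 \<Longrightarrow> Q v > 0" "dim F = n_plus Q E"
proof -
  let ?S = "{dim F | F. subspace F \<and> F \<subseteq> E \<and> (\<forall>v\<in>F. v \<noteq> 0 \<longrightarrow> Q v > 0)}"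
  have "dim {0::'a} \<in> ?S"
    using assms by (intro CollectI exI[of _ "{0}"]) auto
  then have "Max ?S \<in> ?S"
    by (intro Max_in n_plus_set_finite) auto
  then show thesis
    using that unfolding n_plus_def by auto
qed

lemma n_minus_eq_n_plus: "n_minus Q E = n_plus (\<lambda>v. - Q v) E"
  unfolding n_minus_def n_plus_def by simp

lemma n_plus_cong:
  assumes "\<And>v. v \<in> E \<Longrightarrow> Q v = Q' v"
  shows "n_plus Q E = n_plus Q' E"
proof -
  have "(subspace F \<and> F \<subseteq> E \<and> (\<forall>v\<in>F. v \<noteq> 0 \<longrightarrow> Q v > 0)) =
      (subspace F \<and> F \<subseteq> E \<and> (\<forall>v\<in>F. v \<noteq> 0 \<longrightarrow> Q' v > 0))" for F
    using assms by (metis (no_types) subset_iff)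
  then show ?thesis
    unfolding n_plus_def by simp
qed

lemma n_plus_trivial: "n_plus Q {0} = 0"
proof -
  obtain F :: "'a set" where "F \<subseteq> {0}" "dim F = n_plus Q {0}"
    by (rule n_plus_attained[of "{0}" Q]) auto
  then show ?thesis
    using dim_subset[of F "{0}"] by simp
qed

lemma n_plus_mono:
  assumes "0 \<in> E" "\<And>v. v \<in> E \<Longrightarrow> Q v \<le> Q' v"
  shows "n_plus Q E \<le> n_plus Q' E"
proof -
  obtain F where F: "subspace F" "F \<subseteq> E" "\<And>v. v \<in> F \<Longrightarrow> v \<noteq> 0 \<Longrightarrow> Q v > 0"
      "dim F = n_plus Q E"
    using n_plus_attained[OF assms(1)] by blast
  show ?thesis
    unfolding F(4)[symmetric]
    by (rule n_plus_ge) (use F assms(2) in \<open>force+\<close>)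
qed

definition form_radical :: "('a::real_vector \<Rightarrow> 'a \<Rightarrow> real) \<Rightarrow> 'a set \<Rightarrow> 'a set" where
  "form_radical B E = {v\<in>E. \<forall>u\<in>E. B u v = 0}"

lemma subspace_form_radical:
  assumes "bilinear B" "subspace E"
  shows "subspace (form_radical B E)"
  using assms(2)
  by (auto simp: form_radical_def subspace_def bilinear_forms[OF assms(1)])

text \<open>The functionals \<open>B f\<close> with \<open>f\<close> in \<open>F\<close> are inner
  products with the vectors \<open>S f\<close>, which form a space of dimension at most
  \<open>dim F\<close>. It can be smaller because \<open>B\<close> may be degenerate, hence an
  inequality.\<close>

lemma dim_orthogonal_ge:
  fixes B :: "'a::euclidean_space \<Rightarrow> 'a \<Rightarrow> real"
  assumes B: "bilinear B" and E: "subspace E" and F: "subspace F"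
  shows "dim E \<le> dim {v\<in>E. \<forall>f\<in>F. B f v = 0} + dim F"
proof -
  define S where "S f = (\<Sum>b\<in>Basis. B f b *\<^sub>R b)" for f
  have linS: "linear S"
    unfolding S_def
    by (rule linearI)
      (simp_all add: bilinear_forms[OF B] scaleR_add_left sum.distrib scaleR_sum_right)
  have S: "S f \<bullet> v = B f v" for f v
  proof -
    have lin: "linear (B f)"
      using B by (simp add: bilinear_def)
    have "B f v = B f (\<Sum>b\<in>Basis. (v \<bullet> b) *\<^sub>R b)"
      by (simp add: euclidean_representation)
    also have "\<dots> = (\<Sum>b\<in>Basis. (v \<bullet> b) * B f b)"
      by (simp add: linear_sum[OF lin] linear_cmul[OF lin])
    also have "\<dots> = S f \<bullet> v"
      unfolding S_def inner_sum_left by (simp add: inner_commute mult.commute)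
    finally show ?thesis by simp
  qed
  have subS: "subspace (S ` F)"
    using F linS by (simp add: linear_subspace_image)
  let ?O = "{v. \<forall>f\<in>F. B f v = 0}"
  have "?O = {y \<in> UNIV. \<forall>x\<in>S ` F. orthogonal x y}"
    by (auto simp: orthogonal_def S)
  then have "dim ?O + dim (S ` F) = DIM('a)"
    using dim_subspace_orthogonal_to_vectors[OF subS subspace_UNIV] by simp
  moreover have "dim (S ` F) \<le> dim F"
    by (rule dim_image_le[OF linS])
  moreover have subO: "subspace ?O"
    by (auto simp: subspace_def bilinear_forms[OF B])
  moreover have "dim (subspace_sum E ?O) + dim (E \<inter> ?O) = dim E + dim ?O"
    by (rule dim_subspace_sum_Int[OF E subO])
  moreover have "dim (subspace_sum E ?O) \<le> DIM('a)"
    by (rule dim_subset_UNIV)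
  moreover have "E \<inter> ?O = {v\<in>E. \<forall>f\<in>F. B f v = 0}"
    by auto
  ultimately show ?thesis by simp
qed

text \<open>Because \<open>B v v\<close> vanishes, the value at \<open>u + t v\<close> is affine in
  \<open>t\<close> with slope \<open>2 * B u v\<close>, and an affine function bounded below has
  slope zero. The \<open>t\<close> chosen in the proof gives the value -1.\<close>

lemma semidefinite_null_vector:
  fixes B :: "'a::real_vector \<Rightarrow> 'a \<Rightarrow> real"
  assumes B: "bilinear B" and sym: "B u v = B v u"
    and nonneg: "\<And>t. B (u + t *\<^sub>R v) (u + t *\<^sub>R v) \<ge> 0" and null: "B v v = 0"
  shows "B u v = 0"
proof (rule ccontr)
  assume *: "B u v \<noteq> 0"
  define t where "t = - (B u u + 1) / (2 * B u v)"
  have "B (u + t *\<^sub>R v) (u + t *\<^sub>R v) = B u u + 2 * t * B u v"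
    using sym null by (simp add: bilinear_forms[OF B] algebra_simps)
  also have "\<dots> = -1"
    using * by (simp add: t_def field_simps)
  finally show False
    using nonneg[of t] by simp
qed

text \<open>A subspace on which \<open>Q\<close> is non-negative meets one on which it is negative
  definite only in zero.\<close>

lemma dim_nonneg_le:
  fixes Q :: "'a::euclidean_space \<Rightarrow> real"
  assumes "subspace E" "subspace Z" "Z \<subseteq> E" "\<And>z. z \<in> Z \<Longrightarrow> Q z \<ge> 0"
  shows "dim Z + n_plus (\<lambda>v. - Q v) E \<le> dim E"
proof -
  obtain F where F: "subspace F" "F \<subseteq> E" "\<And>v. v \<in> F \<Longrightarrow> v \<noteq> 0 \<Longrightarrow> - Q v > 0"
      "dim F = n_plus (\<lambda>v. - Q v) E"
    using n_plus_attained[of E "\<lambda>v. - Q v"] subspace_0[OF assms(1)] by blast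
  have "dim (subspace_sum Z F) = dim Z + dim F"
    by (rule dim_subspace_sum_disjoint) (use assms F in force)+
  moreover have "dim (subspace_sum Z F) \<le> dim E"
    by (intro dim_subset subspace_sum_subset) (use assms F in auto)
  ultimately show ?thesis
    using F(4) by simp
qed

text \<open>The indices are maxima, so each inequality needs a witness. A maximal positive
  \<open>F\<close> together with the radical is non-negative, which bounds the negative index from
  above. On the complement of \<open>F\<close> maximality leaves a negative semidefinite form,
  definite off the radical, which bounds it from below.\<close>

theorem sylvester_inertia:
  fixes B :: "'a::euclidean_space \<Rightarrow> 'a \<Rightarrow> real"
  assumes B: "bilinear B" and E: "subspace E"
    and sym: "\<And>u v. u \<in> E \<Longrightarrow> v \<in> E \<Longrightarrow> B u v = B v u"
  shows "n_plus (\<lambda>v. B v v) E + n_plus (\<lambda>v. - B v v) E + dim (form_radical B E) = dim E"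
proof -
  have E0: "0 \<in> E"
    by (rule subspace_0[OF E])
  obtain F where F: "subspace F" "F \<subseteq> E" "\<And>v. v \<in> F \<Longrightarrow> v \<noteq> 0 \<Longrightarrow> B v v > 0"
      "dim F = n_plus (\<lambda>v. B v v) E"
    using n_plus_attained[OF E0, of "\<lambda>v. B v v"] by blast
  let ?R = "form_radical B E"
  have R: "subspace ?R" "?R \<subseteq> E"
    by (rule subspace_form_radical[OF B E]) (auto simp: form_radical_def)
  have Rorth: "B r u = 0" "B u r = 0" if "r \<in> ?R" "u \<in> E" for r u
    using that sym[of u r] by (auto simp: form_radical_def)
  have "dim (subspace_sum F ?R) + n_plus (\<lambda>v. - B v v) E \<le> dim E"
  proof (rule dim_nonneg_le[OF E subspace_subspace_sum[OF F(1) R(1)] subspace_sum_subset[OF E F(2) R(2)]])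
    fix z assume "z \<in> subspace_sum F ?R"
    then obtain f r where "f \<in> F" "r \<in> ?R" "z = f + r"
      by (auto simp: subspace_sum_def)
    then have "B z z = B f f"
      using F(2) R(2) Rorth[of r f] Rorth[of r r] by (simp add: bilinear_forms[OF B] subset_iff)
    then show "0 \<le> B z z"
      using F(3)[OF \<open>f \<in> F\<close>] by (cases "f = 0") (auto simp: bilinear_forms[OF B])
  qed
  moreover have "dim (subspace_sum F ?R) = dim F + dim ?R"
    by (rule dim_subspace_sum_disjoint[OF F(1) R(1)])
      (use F(2,3) Rorth in fastforce)
  moreover have "dim E \<le> dim F + n_plus (\<lambda>v. - B v v) E + dim ?R"
  proof -
    define G where "G = {v\<in>E. \<forall>f\<in>F. B f v = 0}"
    have G: "subspace G" "G \<subseteq> E"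
      using E by (auto simp: G_def subspace_def bilinear_forms[OF B])
    have dG: "dim E \<le> dim G + dim F"
      unfolding G_def by (rule dim_orthogonal_ge[OF B E F(1)])
    have GF: "B f g = 0" "B g f = 0" if "g \<in> G" "f \<in> F" for f g
      using that sym[of f g] F(2) by (auto simp: G_def)
    have disj: "x = 0" if "x \<in> F" "x \<in> G" for x
      using that F(3) GF by fastforce
    \<comment> \<open>Adjoining to \<open>F\<close> a vector of positive square orthogonal to it
      would contradict maximality.\<close>
    have neg: "B g g \<le> 0" if g: "g \<in> G" for g
    proof (rule ccontr)
      assume pos: "\<not> B g g \<le> 0"
      have gF: "g \<notin> F"
        using disj[of g] g pos by (auto simp: bilinear_forms[OF B])
      have "dim (span (insert g F)) \<le> n_plus (\<lambda>v. B v v) E"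
      proof (rule n_plus_ge)
        show "span (insert g F) \<subseteq> E"
          using g G F(2) by (intro span_minimal) (auto simp: E)
        fix v assume "v \<in> span (insert g F)" "v \<noteq> 0"
        then obtain k f where kf: "f \<in> F" "v = f + k *\<^sub>R g"
          using F(1) by (metis add.commute diff_add_cancel span_breakdown_eq span_eq_iff)
        have v: "B v v = B f f + k * k * B g g"
          using GF[OF g kf(1)] by (simp add: kf(2) bilinear_forms[OF B])
        show "0 < B v v"
        proof (cases "f = 0")
          case True
          then have "k \<noteq> 0"
            using kf \<open>v \<noteq> 0\<close> by auto
          then show ?thesis
            using v True pos by (auto simp: bilinear_forms[OF B] zero_less_mult_iff linorder_neq_iff)
        next
          case False
          moreover have "0 \<le> k * k * B g g"
            using pos by simp
          ultimately show ?thesis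
            using v F(3)[OF kf(1)] by linarith
        qed
      qed simp
      moreover have "dim (span (insert g F)) = dim F + 1"
        using gF F(1) by (simp add: dim_insert span_eq_iff[THEN iffD2])
      ultimately show False
        using F(4) by simp
    qed
    have RG: "?R \<subseteq> G"
      using R(2) Rorth F(2) by (auto simp: G_def)
    \<comment> \<open>A Euclidean complement of the radical in \<open>G\<close>. The form is
      strictly negative on it: a null vector of the semidefinite form on \<open>G\<close> is
      orthogonal to \<open>G\<close>, and to \<open>F\<close> by construction, hence to all of
      \<open>E\<close>.\<close>
    define N where "N = {y\<in>G. \<forall>x\<in>?R. orthogonal x y}"
    have dN: "dim N + dim ?R = dim G"
      unfolding N_def by (rule dim_subspace_orthogonal_to_vectors[OF R(1) G(1) RG])
    have Nsub: "subspace N"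
      using G(1) by (auto simp: N_def subspace_def orthogonal_def inner_add_right)
    have sumE: "subspace_sum F G = E"
      using dim_subspace_sum_disjoint[OF F(1) G(1) disj] dG
      by (intro subspace_dim_equal subspace_subspace_sum subspace_sum_subset F G E) auto
    have "dim N \<le> n_plus (\<lambda>v. - B v v) E"
    proof (rule n_plus_ge[OF Nsub])
      show "N \<subseteq> E"
        using G by (auto simp: N_def)
      fix v assume v: "v \<in> N" "v \<noteq> 0"
      then have vG: "v \<in> G"
        by (simp add: N_def)
      show "0 < - B v v"
      proof (rule ccontr)
        assume "\<not> 0 < - B v v"
        then have null: "B v v = 0"
          using neg[OF vG] by simp
        have "B u v = 0" if "u \<in> E" for u
        proof -
          obtain f g where fg: "f \<in> F" "g \<in> G" "u = f + g"
            using \<open>u \<in> E\<close> unfolding sumE[symmetric] subspace_sum_def by blast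
          have "- B g v = 0"
          proof (rule semidefinite_null_vector[where B = "\<lambda>x y. - B x y"])
            show "bilinear (\<lambda>x y. - B x y)"
              by (rule bilinearI_real) (simp_all add: bilinear_forms[OF B])
            show "- B g v = - B v g"
              using sym fg(2) vG G(2) by auto
            show "- B v v = 0"
              using null by simp
            show "0 \<le> - B (g + t *\<^sub>R v) (g + t *\<^sub>R v)" for t
              using neg[of "g + t *\<^sub>R v"] G(1) fg(2) vG by (simp add: subspace_add subspace_scale)
          qed
          then show ?thesis
            using GF(1)[OF vG fg(1)] by (simp add: fg(3) bilinear_forms[OF B])
        qed
        then have "v \<in> ?R"
          using vG G(2) by (auto simp: form_radical_def)
        then have "orthogonal v v"
          using v(1) by (auto simp: N_def)
        then show False
          using v(2) by (simp add: orthogonal_def)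
      qed
    qed
    then show ?thesis
      using dG dN by simp
  qed
  ultimately show ?thesis
    using F(4) by simp
qed

section \<open>Stability and first-order perturbation of the positive index\<close>

lemma bilinear_expand:
  fixes B :: "'a::euclidean_space \<Rightarrow> 'a \<Rightarrow> real"
  assumes "bilinear B"
  shows "B u v = (\<Sum>i\<in>Basis. \<Sum>j\<in>Basis. (u \<bullet> i) * (v \<bullet> j) * B i j)"
proof -
  have "B u v = B (\<Sum>i\<in>Basis. (u \<bullet> i) *\<^sub>R i) (\<Sum>j\<in>Basis. (v \<bullet> j) *\<^sub>R j)"
    by (simp add: euclidean_representation)
  also have "\<dots> = (\<Sum>(i,j)\<in>Basis \<times> Basis. B ((u \<bullet> i) *\<^sub>R i) ((v \<bullet> j) *\<^sub>R j))"
    by (rule bilinear_sum[OF assms])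
  also have "\<dots> = (\<Sum>i\<in>Basis. \<Sum>j\<in>Basis. (u \<bullet> i) * (v \<bullet> j) * B i j)"
    by (simp add: bilinear_forms[OF assms] sum.cartesian_product mult.assoc mult.left_commute)
  finally show ?thesis .
qed

lemma bilinear_bound_Basis:
  fixes B :: "'a::euclidean_space \<Rightarrow> 'a \<Rightarrow> real"
  assumes "bilinear B"
  shows "\<bar>B u v\<bar> \<le> (\<Sum>i\<in>Basis. \<Sum>j\<in>Basis. \<bar>B i j\<bar>) * (norm u * norm v)"
proof -
  have "\<bar>B u v\<bar> \<le> (\<Sum>i\<in>Basis. \<bar>\<Sum>j\<in>Basis. (u \<bullet> i) * (v \<bullet> j) * B i j\<bar>)"
    unfolding bilinear_expand[OF assms, of u v] by (rule sum_abs)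
  also have "\<dots> \<le> (\<Sum>i\<in>Basis. \<Sum>j\<in>Basis. \<bar>(u \<bullet> i) * (v \<bullet> j) * B i j\<bar>)"
    by (intro sum_mono sum_abs)
  also have "\<dots> \<le> (\<Sum>i\<in>Basis. \<Sum>j\<in>Basis. \<bar>B i j\<bar> * (norm u * norm v))"
  proof (intro sum_mono)
    fix i j :: 'a assume "i \<in> Basis" "j \<in> Basis"
    then have "\<bar>u \<bullet> i\<bar> * \<bar>v \<bullet> j\<bar> \<le> norm u * norm v"
      by (intro mult_mono) (auto simp: Basis_le_norm)
    then show "\<bar>(u \<bullet> i) * (v \<bullet> j) * B i j\<bar> \<le> \<bar>B i j\<bar> * (norm u * norm v)"
      by (simp add: abs_mult mult.commute mult_left_mono)
  qed
  finally show ?thesis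
    by (simp add: sum_distrib_right)
qed

lemma positive_definite_lower_bound:
  fixes B :: "'a::euclidean_space \<Rightarrow> 'a \<Rightarrow> real"
  assumes B: "bilinear B" and F: "subspace F"
    and pos: "\<And>v. v \<in> F \<Longrightarrow> v \<noteq> 0 \<Longrightarrow> B v v > 0"
  obtains m where "m > 0" "\<And>v. v \<in> F \<Longrightarrow> B v v \<ge> m * (norm v)\<^sup>2"
proof (cases "F \<subseteq> {0}")
  case True
  then show thesis
    using that[of 1] bilinear_forms(9)[OF B] by fastforce
next
  case False
  then obtain x where x: "x \<in> F" "x \<noteq> 0" by auto
  let ?S = "sphere 0 1 \<inter> F"
  have "x /\<^sub>R norm x \<in> ?S"
    using x F by (auto intro: subspace_scale)
  then have ne: "?S \<noteq> {}" by blast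
  have "compact ?S"
    using closed_subspace[OF F] by (intro compact_Int_closed compact_sphere)
  moreover have "continuous_on ?S (\<lambda>v. B v v)"
    by (rule bounded_bilinear.continuous_on
        [OF B[unfolded bilinear_conv_bounded_bilinear] continuous_on_id continuous_on_id])
  ultimately obtain y where y: "y \<in> ?S" "\<And>v. v \<in> ?S \<Longrightarrow> B y y \<le> B v v"
    using continuous_attains_inf[OF _ ne] by blast
  show thesis
  proof (rule that)
    show "B y y > 0"
      using y(1) by (intro pos) auto
    fix v assume v: "v \<in> F"
    show "B v v \<ge> B y y * (norm v)\<^sup>2"
    proof (cases "v = 0")
      case False
      have "B y y \<le> B (v /\<^sub>R norm v) (v /\<^sub>R norm v)"
        using False v F by (intro y(2)) (auto intro: subspace_scale)
      also have "\<dots> = B v v / (norm v)\<^sup>2"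
        by (simp add: bilinear_forms[OF B] power2_eq_square divide_simps)
      finally show ?thesis
        using False by (simp add: field_simps)
    qed (simp add: bilinear_forms[OF B])
  qed
qed

text \<open>Only the finitely many matrix entries on \<open>Basis\<close> have to converge. The
  filter is left general so that the result serves for one-sided limits in \<open>t\<close> as well
  as for limits in a rectangle.\<close>

lemma bilinear_tendsto_uniform:
  fixes B :: "'q \<Rightarrow> 'a::euclidean_space \<Rightarrow> 'a \<Rightarrow> real"
  assumes bil: "\<forall>\<^sub>F q in Fl. bilinear (B q)" and B0: "bilinear B0"
    and lim: "\<And>u v. ((\<lambda>q. B q u v) \<longlongrightarrow> B0 u v) Fl" and "e > 0"
  shows "\<forall>\<^sub>F q in Fl. \<forall>u v. \<bar>B q u v - B0 u v\<bar> \<le> e * (norm u * norm v)"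
proof -
  have "((\<lambda>q. \<Sum>i\<in>Basis. \<Sum>j\<in>Basis. \<bar>B q i j - B0 i j\<bar>) \<longlongrightarrow> (\<Sum>i\<in>Basis. \<Sum>j\<in>Basis. \<bar>B0 i j - B0 i j\<bar>)) Fl"
    by (intro tendsto_intros lim)
  then have "\<forall>\<^sub>F q in Fl. (\<Sum>i\<in>Basis. \<Sum>j\<in>Basis. \<bar>B q i j - B0 i j\<bar>) < e"
    using \<open>e > 0\<close> by (intro order_tendstoD) auto
  with bil show ?thesis
  proof eventually_elim
    case (elim q)
    show ?case
    proof (intro allI)
      fix u v
      have "bilinear (\<lambda>u v. B q u v - B0 u v)"
        by (rule bilinearI_real)
          (simp_all add: bilinear_forms[OF elim(1)] bilinear_forms[OF B0] algebra_simps)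
      then have "\<bar>B q u v - B0 u v\<bar> \<le> (\<Sum>i\<in>Basis. \<Sum>j\<in>Basis. \<bar>B q i j - B0 i j\<bar>) * (norm u * norm v)"
        by (rule bilinear_bound_Basis)
      also have "\<dots> \<le> e * (norm u * norm v)"
        using elim(2) by (intro mult_right_mono) auto
      finally show "\<bar>B q u v - B0 u v\<bar> \<le> e * (norm u * norm v)" .
    qed
  qed
qed

lemma positive_definite_eventually:
  fixes B :: "'q \<Rightarrow> 'a::euclidean_space \<Rightarrow> 'a \<Rightarrow> real"
  assumes bil: "\<forall>\<^sub>F q in Fl. bilinear (B q)" and B0: "bilinear B0"
    and lim: "\<And>u v. ((\<lambda>q. B q u v) \<longlongrightarrow> B0 u v) Fl" and F: "subspace F"
    and pos: "\<And>v. v \<in> F \<Longrightarrow> v \<noteq> 0 \<Longrightarrow> B0 v v > 0"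
  obtains m where "m > 0" "\<forall>\<^sub>F q in Fl. \<forall>v\<in>F. B q v v \<ge> m * (norm v)\<^sup>2"
proof -
  obtain m where m: "m > 0" "\<And>v. v \<in> F \<Longrightarrow> B0 v v \<ge> m * (norm v)\<^sup>2"
    using positive_definite_lower_bound[OF B0 F pos] by blast
  have "\<forall>\<^sub>F q in Fl. \<forall>u v. \<bar>B q u v - B0 u v\<bar> \<le> (m/2) * (norm u * norm v)"
    using m by (intro bilinear_tendsto_uniform bil B0 lim) auto
  then have "\<forall>\<^sub>F q in Fl. \<forall>v\<in>F. B q v v \<ge> (m/2) * (norm v)\<^sup>2"
  proof eventually_elim
    case (elim q)
    show ?case
    proof
      fix v assume "v \<in> F"
      have "\<bar>B q v v - B0 v v\<bar> \<le> (m/2) * (norm v)\<^sup>2"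
        using elim by (simp add: power2_eq_square)
      then show "B q v v \<ge> (m/2) * (norm v)\<^sup>2"
        using m(2)[OF \<open>v \<in> F\<close>] by linarith
    qed
  qed
  then show thesis
    using that[of "m/2"] m(1) by simp
qed

text \<open>Positive definiteness on one fixed subspace that attains the index of \<open>B0\<close>
  survives small perturbations.\<close>

lemma n_plus_lower_semicontinuous:
  fixes B :: "'q \<Rightarrow> 'a::euclidean_space \<Rightarrow> 'a \<Rightarrow> real"
  assumes bil: "\<forall>\<^sub>F q in Fl. bilinear (B q)" and B0: "bilinear B0"
    and lim: "\<And>u v. ((\<lambda>q. B q u v) \<longlongrightarrow> B0 u v) Fl" and E: "subspace E"
  shows "\<forall>\<^sub>F q in Fl. n_plus (\<lambda>v. B0 v v) E \<le> n_plus (\<lambda>v. B q v v) E"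
proof -
  obtain F where F: "subspace F" "F \<subseteq> E" "\<And>v. v \<in> F \<Longrightarrow> v \<noteq> 0 \<Longrightarrow> B0 v v > 0"
      "dim F = n_plus (\<lambda>v. B0 v v) E"
    using n_plus_attained[of E "\<lambda>v. B0 v v"] subspace_0[OF E] by blast
  obtain m where m: "m > 0" "\<forall>\<^sub>F q in Fl. \<forall>v\<in>F. B q v v \<ge> m * (norm v)\<^sup>2"
    using positive_definite_eventually[OF bil B0 lim F(1,3)] by blast
  from m(2) show ?thesis
  proof eventually_elim
    case (elim q)
    show ?case
      unfolding F(4)[symmetric]
    proof (rule n_plus_ge[OF F(1,2)])
      fix v assume "v \<in> F" "v \<noteq> 0"
      moreover from this have "0 < m * (norm v)\<^sup>2"
        using m(1) by simp
      ultimately show "0 < B q v v"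
        using elim by fastforce
    qed
  qed
qed

text \<open>Two sources of positivity add up: \<open>F\<close>, where \<open>B0\<close> is positive,
  and \<open>P\<close> in the radical of \<open>B0\<close>, where only \<open>h q * C q\<close>
  acts. On \<open>f + p\<close> the form \<open>B0\<close> does not see \<open>p\<close>, and the
  mixed term is of order \<open>h q\<close>, while the definite parts are of order 1 in
  \<open>f\<close> and \<open>h q\<close> in \<open>p\<close>.\<close>

lemma n_plus_perturb:
  fixes C :: "'q \<Rightarrow> 'a::euclidean_space \<Rightarrow> 'a \<Rightarrow> real" and h :: "'q \<Rightarrow> real"
  assumes bil: "\<forall>\<^sub>F q in Fl. bilinear (C q)" and B0: "bilinear B0" and C0: "bilinear C0"
    and lim: "\<And>u v. ((\<lambda>q. C q u v) \<longlongrightarrow> C0 u v) Fl"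
    and hpos: "\<forall>\<^sub>F q in Fl. h q > 0" and hlim: "(h \<longlongrightarrow> 0) Fl"
    and E: "subspace E"
    and sym0: "\<And>u v. u \<in> E \<Longrightarrow> v \<in> E \<Longrightarrow> B0 u v = B0 v u"
    and sym: "\<forall>\<^sub>F q in Fl. \<forall>u\<in>E. \<forall>v\<in>E. C q u v = C q v u"
  shows "\<forall>\<^sub>F q in Fl. n_plus (\<lambda>v. B0 v v) E + n_plus (\<lambda>v. C0 v v) (form_radical B0 E)
            \<le> n_plus (\<lambda>v. B0 v v + h q * C q v v) E"
proof -
  let ?R = "form_radical B0 E"
  have R: "subspace ?R" "?R \<subseteq> E"
    by (rule subspace_form_radical[OF B0 E]) (auto simp: form_radical_def)
  have Rorth: "B0 r u = 0" "B0 u r = 0" if "r \<in> ?R" "u \<in> E" for r u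
    using that sym0[of u r] by (auto simp: form_radical_def)
  obtain F where F: "subspace F" "F \<subseteq> E" "\<And>v. v \<in> F \<Longrightarrow> v \<noteq> 0 \<Longrightarrow> B0 v v > 0"
      "dim F = n_plus (\<lambda>v. B0 v v) E"
    using n_plus_attained[of E "\<lambda>v. B0 v v"] subspace_0[OF E] by blast
  obtain P where P: "subspace P" "P \<subseteq> ?R" "\<And>v. v \<in> P \<Longrightarrow> v \<noteq> 0 \<Longrightarrow> C0 v v > 0"
      "dim P = n_plus (\<lambda>v. C0 v v) ?R"
    using n_plus_attained[of ?R "\<lambda>v. C0 v v"] subspace_0[OF R(1)] by blast
  have limB: "((\<lambda>q. B0 u v + h q * C q u v) \<longlongrightarrow> B0 u v) Fl" for u v
    using tendsto_add[OF tendsto_const tendsto_mult[OF hlim lim[of u v]], of "B0 u v"] by simp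
  have bilB: "\<forall>\<^sub>F q in Fl. bilinear (\<lambda>u v. B0 u v + h q * C q u v)"
    using bil
  proof eventually_elim
    case (elim q)
    then show ?case
      by (intro bilinearI_real)
        (simp_all add: bilinear_forms[OF elim] bilinear_forms[OF B0] algebra_simps)
  qed
  obtain m1 where m1: "m1 > 0"
      "\<forall>\<^sub>F q in Fl. \<forall>v\<in>F. B0 v v + h q * C q v v \<ge> m1 * (norm v)\<^sup>2"
    using positive_definite_eventually[OF bilB B0 limB F(1,3)] by blast
  obtain m2 where m2: "m2 > 0" "\<forall>\<^sub>F q in Fl. \<forall>v\<in>P. C q v v \<ge> m2 * (norm v)\<^sup>2"
    using positive_definite_eventually[OF bil C0 lim P(1,3)] by blast
  define M where "M = (\<Sum>i\<in>Basis. \<Sum>j\<in>Basis. \<bar>C0 i j\<bar>) + 1"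
  have "M \<ge> 1"
    unfolding M_def by (simp add: sum_nonneg)
  have bnd: "\<forall>\<^sub>F q in Fl. \<forall>u v. \<bar>C q u v\<bar> \<le> M * (norm u * norm v)"
    using bilinear_tendsto_uniform[OF bil C0 lim zero_less_one]
  proof eventually_elim
    case (elim q)
    show ?case
    proof (intro allI)
      fix u v
      have "\<bar>C q u v - C0 u v\<bar> \<le> 1 * (norm u * norm v)"
        using elim by blast
      then show "\<bar>C q u v\<bar> \<le> M * (norm u * norm v)"
        using bilinear_bound_Basis[OF C0, of u v] unfolding M_def by (simp add: ring_distribs)
    qed
  qed
  \<comment> \<open>The discriminant condition for the quadratic
    \<open>m1 x^2 - 2 h M x y + h m2 y^2\<close> in the norms of \<open>f\<close> and
    \<open>p\<close>; the square is completed below after multiplication by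
    \<open>m1\<close>.\<close>
  have "\<forall>\<^sub>F q in Fl. h q < m1 * m2 / M\<^sup>2"
    using m1(1) m2(1) \<open>M \<ge> 1\<close> by (intro order_tendstoD(2)[OF hlim]) auto
  with m1(2) m2(2) bnd hpos bil sym show ?thesis
  proof eventually_elim
    case (elim q)
    note Cq = bilinear_forms[OF elim(5)]
    let ?B = "\<lambda>v. B0 v v + h q * C q v v"
    have "dim (subspace_sum F P) \<le> n_plus ?B E"
    proof (rule n_plus_ge)
      show "subspace (subspace_sum F P)"
        by (rule subspace_subspace_sum[OF F(1) P(1)])
      show "subspace_sum F P \<subseteq> E"
        using P(2) R(2) F(2) by (intro subspace_sum_subset[OF E]) auto
      fix z assume "z \<in> subspace_sum F P" "z \<noteq> 0"
      then obtain f p where fp: "f \<in> F" "p \<in> P" "z = f + p"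
        by (auto simp: subspace_sum_def)
      then have E': "f \<in> E" "p \<in> E" "p \<in> ?R"
        using P(2) R(2) F(2) by auto
      have eq: "?B z = ?B f + 2 * h q * C q f p + h q * C q p p"
        using elim(6) E' Rorth[OF E'(3) E'(1)] Rorth[OF E'(3) E'(2)]
        by (simp add: fp(3) Cq bilinear_forms[OF B0] algebra_simps)
      have 1: "?B f \<ge> m1 * (norm f)\<^sup>2"
        using elim(1) fp by blast
      have 2: "h q * C q p p \<ge> h q * (m2 * (norm p)\<^sup>2)"
        using elim(2,4) fp by (intro mult_left_mono) auto
      have "\<bar>h q * C q f p\<bar> \<le> h q * (M * (norm f * norm p))"
        using elim(3,4) by (simp add: abs_mult)
      then have 3: "2 * h q * C q f p \<ge> - 2 * h q * (M * (norm f * norm p))"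
        by (simp add: abs_le_iff algebra_simps)
      have 4: "m1 * (?B z) \<ge> (m1 * norm f - h q * M * norm p)\<^sup>2 + h q * (norm p)\<^sup>2 * (m1 * m2 - h q * M\<^sup>2)"
      proof -
        have "?B z \<ge> m1 * (norm f)\<^sup>2 - 2 * h q * (M * (norm f * norm p)) + h q * (m2 * (norm p)\<^sup>2)"
          using eq 1 2 3 by linarith
        then have "m1 * ?B z \<ge> m1 * (m1 * (norm f)\<^sup>2 - 2 * h q * (M * (norm f * norm p)) + h q * (m2 * (norm p)\<^sup>2))"
          using m1(1) by (intro mult_left_mono) auto
        then show ?thesis
          by (simp add: power2_eq_square algebra_simps)
      qed
      have 5: "m1 * m2 - h q * M\<^sup>2 > 0"
        using elim(7) \<open>M \<ge> 1\<close> by (simp add: field_simps)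
      have "0 < (m1 * norm f - h q * M * norm p)\<^sup>2 + h q * (norm p)\<^sup>2 * (m1 * m2 - h q * M\<^sup>2)"
      proof (cases "p = 0")
        case True
        then have "f \<noteq> 0"
          using fp \<open>z \<noteq> 0\<close> by auto
        then show ?thesis
          using True m1(1) by simp
      next
        case False
        then have "0 < h q * (norm p)\<^sup>2 * (m1 * m2 - h q * M\<^sup>2)"
          using 5 elim(4) by simp
        then show ?thesis
          by (simp add: add_nonneg_pos)
      qed
      then have "0 < m1 * ?B z"
        using 4 by linarith
      then show "0 < ?B z"
        using m1(1) by (simp add: zero_less_mult_iff)
    qed
    moreover have "dim (subspace_sum F P) = dim F + dim P"
    proof (rule dim_subspace_sum_disjoint[OF F(1) P(1)])
      fix x assume "x \<in> F" "x \<in> P"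
      then have "B0 x x = 0"
        using P(2) R(2) Rorth by blast
      then show "x = 0"
        using F(3)[OF \<open>x \<in> F\<close>] by fastforce
    qed
    ultimately show ?case
      using F(4) P(4) by simp
  qed
qed

text \<open>The perturbation bound applies to the form and to its negative. By Sylvester for
  \<open>B0\<close> and for \<open>C0\<close> on the radical, the two lower bounds already sum to
  \<open>dim E\<close>, so both are equalities and no radical is left.\<close>

lemma n_plus_perturb_nondegenerate:
  fixes C :: "'q \<Rightarrow> 'a::euclidean_space \<Rightarrow> 'a \<Rightarrow> real" and h :: "'q \<Rightarrow> real"
  assumes bil: "\<forall>\<^sub>F q in Fl. bilinear (C q)" and B0: "bilinear B0" and C0: "bilinear C0"
    and lim: "\<And>u v. ((\<lambda>q. C q u v) \<longlongrightarrow> C0 u v) Fl"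
    and hpos: "\<forall>\<^sub>F q in Fl. h q > 0" and hlim: "(h \<longlongrightarrow> 0) Fl"
    and E: "subspace E"
    and sym0: "\<And>u v. u \<in> E \<Longrightarrow> v \<in> E \<Longrightarrow> B0 u v = B0 v u"
    and sym: "\<forall>\<^sub>F q in Fl. \<forall>u\<in>E. \<forall>v\<in>E. C q u v = C q v u"
    and symC: "\<And>u v. u \<in> form_radical B0 E \<Longrightarrow> v \<in> form_radical B0 E \<Longrightarrow> C0 u v = C0 v u"
    and nondeg: "form_radical C0 (form_radical B0 E) = {0}"
  shows "\<forall>\<^sub>F q in Fl. n_plus (\<lambda>v. B0 v v + h q * C q v v) E
            = n_plus (\<lambda>v. B0 v v) E + n_plus (\<lambda>v. C0 v v) (form_radical B0 E)
          \<and> form_radical (\<lambda>u v. B0 u v + h q * C q u v) E = {0}"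
proof -
  let ?R = "form_radical B0 E"
  have R: "subspace ?R"
    by (rule subspace_form_radical[OF B0 E])
  have neg: "bilinear (\<lambda>u v. - B u v)" if "bilinear B" for B :: "'a \<Rightarrow> 'a \<Rightarrow> real"
    by (rule bilinearI_real) (simp_all add: bilinear_forms[OF that])
  have Rneg: "form_radical (\<lambda>u v. - B0 u v) E = ?R"
    by (simp add: form_radical_def)
  have "\<forall>\<^sub>F q in Fl. n_plus (\<lambda>v. - B0 v v) E + n_plus (\<lambda>v. - C0 v v) ?R
            \<le> n_plus (\<lambda>v. - B0 v v + h q * - C q v v) E"
    using n_plus_perturb[of "\<lambda>q u v. - C q u v" Fl "\<lambda>u v. - B0 u v" "\<lambda>u v. - C0 u v" h E]
      bil neg B0 C0 lim hpos hlim E sym0 sym Rneg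
    by (simp add: tendsto_minus_cancel_left[symmetric] eventually_mono)
  moreover have "\<forall>\<^sub>F q in Fl. n_plus (\<lambda>v. B0 v v) E + n_plus (\<lambda>v. C0 v v) ?R
            \<le> n_plus (\<lambda>v. B0 v v + h q * C q v v) E"
    by (rule n_plus_perturb[OF bil B0 C0 lim hpos hlim E sym0 sym])
  ultimately show ?thesis
    using bil sym
  proof eventually_elim
    case (elim q)
    let ?B = "\<lambda>u v. B0 u v + h q * C q u v"
    have bilB: "bilinear ?B"
      by (intro bilinearI_real)
        (simp_all add: bilinear_forms[OF elim(3)] bilinear_forms[OF B0] algebra_simps)
    have "n_plus (\<lambda>v. ?B v v) E + n_plus (\<lambda>v. - ?B v v) E + dim (form_radical ?B E) = dim E"
      by (rule sylvester_inertia[OF bilB E]) (use sym0 elim(4) in auto)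
    moreover have "n_plus (\<lambda>v. B0 v v) E + n_plus (\<lambda>v. - B0 v v) E + dim ?R = dim E"
      by (rule sylvester_inertia[OF B0 E sym0])
    moreover have "n_plus (\<lambda>v. C0 v v) ?R + n_plus (\<lambda>v. - C0 v v) ?R + dim (form_radical C0 ?R) = dim ?R"
      by (rule sylvester_inertia[OF C0 R symC])
    moreover have "n_plus (\<lambda>v. - B0 v v + h q * - C q v v) E = n_plus (\<lambda>v. - ?B v v) E"
      by (rule n_plus_cong) simp
    moreover have "dim (form_radical C0 ?R) = 0"
      unfolding nondeg by simp
    ultimately have *: "n_plus (\<lambda>v. ?B v v) E = n_plus (\<lambda>v. B0 v v) E + n_plus (\<lambda>v. C0 v v) ?R"
        "dim (form_radical ?B E) = 0"
      using elim(1,2) by linarith+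
    have "form_radical ?B E \<subseteq> {0}"
      using * by simp
    then show ?case
      using * subspace_0[OF subspace_form_radical[OF bilB E]] by auto
  qed
qed

section \<open>Operators near the identity and orthogonal projections\<close>

lemma near_identity_uniform:
  fixes T :: "'q \<Rightarrow> 'a::euclidean_space \<Rightarrow> 'a"
  assumes lin: "\<forall>\<^sub>F q in Fl. linear (T q)" and lim: "\<And>x. ((\<lambda>q. T q x) \<longlongrightarrow> x) Fl" and "e > 0"
  shows "\<forall>\<^sub>F q in Fl. \<forall>x. norm (T q x - x) \<le> e * norm x"
proof -
  have "((\<lambda>q. \<Sum>b\<in>Basis. norm (T q b - b)) \<longlongrightarrow> (\<Sum>b\<in>Basis. norm (b - b :: 'a))) Fl"
    by (intro tendsto_intros lim)
  then have "\<forall>\<^sub>F q in Fl. (\<Sum>b\<in>Basis. norm (T q b - b)) < e"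
    using \<open>e > 0\<close> by (intro order_tendstoD) auto
  with lin show ?thesis
  proof eventually_elim
    case (elim q)
    show ?case
    proof
      fix x
      have "T q x - x = T q (\<Sum>b\<in>Basis. (x \<bullet> b) *\<^sub>R b) - (\<Sum>b\<in>Basis. (x \<bullet> b) *\<^sub>R b)"
        by (simp add: euclidean_representation)
      also have "\<dots> = (\<Sum>b\<in>Basis. (x \<bullet> b) *\<^sub>R (T q b - b))"
        by (simp add: linear_sum[OF elim(1)] linear_cmul[OF elim(1)] sum_subtractf
            scaleR_diff_right)
      finally have "norm (T q x - x) \<le> (\<Sum>b\<in>Basis. norm ((x \<bullet> b) *\<^sub>R (T q b - b)))"
        by (simp only: norm_sum)
      also have "\<dots> \<le> (\<Sum>b\<in>Basis. norm x * norm (T q b - b))"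
        by (intro sum_mono) (simp add: Basis_le_norm mult_right_mono)
      also have "\<dots> \<le> norm x * e"
        using elim(2) by (simp add: sum_distrib_left[symmetric] mult_left_mono)
      finally show "norm (T q x - x) \<le> e * norm x"
        by (simp add: mult.commute)
    qed
  qed
qed

lemma near_identity_bij:
  fixes T :: "'q \<Rightarrow> 'a::euclidean_space \<Rightarrow> 'a"
  assumes lin: "\<forall>\<^sub>F q in Fl. linear (T q)" and lim: "\<And>x. ((\<lambda>q. T q x) \<longlongrightarrow> x) Fl"
  shows "\<forall>\<^sub>F q in Fl. bij (T q)"
  using lin near_identity_uniform[OF lin lim half_gt_zero[OF zero_less_one]]
proof eventually_elim
  case (elim q)
  have "inj (T q)"
  proof (subst linear_injective_0[OF elim(1)], intro allI impI)
    fix x assume "T q x = 0"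
    then have "norm x \<le> norm x / 2"
      using elim(2)[rule_format, of x] by simp
    then show "x = 0" by simp
  qed
  then show ?case
    using elim(1) by (simp add: bij_def linear_injective_imp_surjective)
qed

text \<open>Avoids inverting \<open>T q\<close>: a solution differs from \<open>u q\<close> by at
  most half its own norm, so it is bounded by twice the norm of \<open>u q\<close>, and a smaller
  relative error then makes the difference tend to zero.\<close>

lemma near_identity_solution_tendsto:
  fixes T :: "'q \<Rightarrow> 'a::euclidean_space \<Rightarrow> 'a"
  assumes lin: "\<forall>\<^sub>F q in Fl. linear (T q)" and lim: "\<And>x. ((\<lambda>q. T q x) \<longlongrightarrow> x) Fl"
    and sol: "\<forall>\<^sub>F q in Fl. T q (y q) = u q" and u: "(u \<longlongrightarrow> u0) Fl"
  shows "(y \<longlongrightarrow> u0) Fl"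
proof -
  have "((\<lambda>q. y q - u q) \<longlongrightarrow> 0) Fl"
  proof (rule tendstoI)
    fix e :: real assume "e > 0"
    define N where "N = norm u0 + 1"
    \<comment> \<open>The norm of \<open>y q\<close> will be at most \<open>2 * N\<close>, so this
      relative error costs at most \<open>e / 2\<close>.\<close>
    define d where "d = e / (4 * N)"
    have pos: "N > 0"
      by (simp add: N_def add_nonneg_pos)
    have d: "d > 0"
      using \<open>e > 0\<close> pos by (simp add: d_def)
    have "\<forall>\<^sub>F q in Fl. norm (u q) < N"
      by (rule order_tendstoD(2)[OF tendsto_norm[OF u]]) (simp add: N_def)
    with sol near_identity_uniform[OF lin lim d] near_identity_uniform[OF lin lim half_gt_zero[OF zero_less_one]]
    show "\<forall>\<^sub>F q in Fl. dist (y q - u q) 0 < e"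
    proof eventually_elim
      case (elim q)
      have 1: "norm (u q - y q) \<le> d * norm (y q)" "norm (u q - y q) \<le> norm (y q) / 2"
        using elim(1) elim(2)[rule_format, of "y q"] elim(3)[rule_format, of "y q"] by simp_all
      have "norm (y q) \<le> norm (u q) + norm (u q - y q)"
        by (metis add_diff_cancel_left' diff_add_cancel norm_minus_commute norm_triangle_sub)
      then have "norm (y q) \<le> 2 * norm (u q)"
        using 1(2) by (simp add: field_simps)
      then have "norm (y q) \<le> 2 * N"
        using elim(4) by simp
      then have "d * norm (y q) \<le> d * (2 * N)"
        using d by (intro mult_left_mono) auto
      also have "\<dots> < e"
        using \<open>e > 0\<close> pos by (simp add: d_def field_simps)
      finally show ?case
        using 1(1) by (simp add: norm_minus_commute)
    qed
  qed
  from tendsto_add[OF this u] show ?thesis by simp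
qed

text \<open>Turns differentiability into convergence of a quotient along the same filter, so that
  the convergence lemmas for solutions and operators apply to difference quotients.\<close>

lemma has_vector_derivative_iff_quotient:
  fixes f :: "real \<Rightarrow> 'a::real_normed_vector"
  shows "(f has_vector_derivative D) (at x within S)
    \<longleftrightarrow> ((\<lambda>t. (f t - f x) /\<^sub>R (t - x)) \<longlongrightarrow> D) (at x within S)"
proof -
  have "(f has_vector_derivative D) (at x within S)
    \<longleftrightarrow> ((\<lambda>t. (1 / norm (t - x)) *\<^sub>R (f t - (f x + (t - x) *\<^sub>R D))) \<longlongrightarrow> 0) (at x within S)"
    unfolding has_vector_derivative_def has_derivative_within
    by (simp add: bounded_linear_scaleR_left)
  also have "\<dots> \<longleftrightarrow> ((\<lambda>t. norm ((1 / norm (t - x)) *\<^sub>R (f t - (f x + (t - x) *\<^sub>R D)))) \<longlongrightarrow> 0) (at x within S)"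
    by (rule tendsto_norm_zero_iff[symmetric])
  also have "\<dots> \<longleftrightarrow> ((\<lambda>t. norm ((f t - f x) /\<^sub>R (t - x) - D)) \<longlongrightarrow> 0) (at x within S)"
  proof (rule tendsto_cong)
    have "\<forall>\<^sub>F t in at x within S. t \<noteq> x"
      by (simp add: eventually_at_filter)
    then show "\<forall>\<^sub>F t in at x within S. norm ((1 / norm (t - x)) *\<^sub>R (f t - (f x + (t - x) *\<^sub>R D)))
        = norm ((f t - f x) /\<^sub>R (t - x) - D)"
    proof eventually_elim
      case (elim t)
      have "(f t - f x) /\<^sub>R (t - x) - D = (f t - (f x + (t - x) *\<^sub>R D)) /\<^sub>R (t - x)"
        using elim by (simp add: diff_diff_eq[symmetric] scaleR_diff_right)
      then show ?case
        by (simp add: divide_inverse)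
    qed
  qed
  also have "\<dots> \<longleftrightarrow> ((\<lambda>t. (f t - f x) /\<^sub>R (t - x)) \<longlongrightarrow> D) (at x within S)"
    by (simp add: tendsto_norm_zero_iff LIM_zero_iff)
  finally show ?thesis .
qed

text \<open>By linearity the difference quotient of \<open>y\<close> itself solves a near-identity
  equation, whose right side is minus the difference quotient of \<open>T t v\<close>.\<close>

lemma near_identity_solution_derivative:
  fixes T :: "real \<Rightarrow> 'a::euclidean_space \<Rightarrow> 'a"
  assumes lin: "\<forall>\<^sub>F t in at t0 within S. linear (T t)"
    and lim: "\<And>x. ((\<lambda>t. T t x) \<longlongrightarrow> x) (at t0 within S)"
    and T0: "T t0 v = v"
    and der: "((\<lambda>t. T t v) has_vector_derivative d) (at t0 within S)"
    and sol: "\<forall>\<^sub>F t in at t0 within S. T t (y t) = v" and y0: "y t0 = v"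
  shows "(y has_vector_derivative - d) (at t0 within S)"
proof -
  have "((\<lambda>t. - ((T t v - v) /\<^sub>R (t - t0))) \<longlongrightarrow> - d) (at t0 within S)"
    using der unfolding has_vector_derivative_iff_quotient T0 by (rule tendsto_minus)
  moreover have "\<forall>\<^sub>F t in at t0 within S. T t ((y t - v) /\<^sub>R (t - t0)) = - ((T t v - v) /\<^sub>R (t - t0))"
    using lin sol
  proof eventually_elim
    case (elim t)
    then show ?case
      by (simp add: linear_cmul[OF elim(1)] linear_diff[OF elim(1)] algebra_simps)
  qed
  ultimately have "((\<lambda>t. (y t - v) /\<^sub>R (t - t0)) \<longlongrightarrow> - d) (at t0 within S)"
    by (rule near_identity_solution_tendsto[OF lin lim, rotated])
  then show ?thesis
    unfolding has_vector_derivative_iff_quotient y0 .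
qed

section \<open>Orthogonal projections onto subspaces\<close>

lemma proj_unique:
  assumes "subspace L" "y \<in> L" "\<And>z. z \<in> L \<Longrightarrow> (x - y) \<bullet> z = 0"
  shows "proj L x = y"
  unfolding proj_def
proof (rule closest_point_unique[symmetric])
  show "convex L" "closed L" "y \<in> L"
    using assms by (auto simp: subspace_imp_convex closed_subspace)
  show "\<forall>z\<in>L. dist x y \<le> dist x z"
  proof
    fix z assume z: "z \<in> L"
    have "(norm (x - z))\<^sup>2 = (norm ((x - y) + (y - z)))\<^sup>2"
      by simp
    also have "\<dots> = (norm (x - y))\<^sup>2 + (norm (y - z))\<^sup>2"
      using assms z by (intro norm_add_Pythagorean) (simp add: orthogonal_def subspace_diff)
    finally have "(norm (x - y))\<^sup>2 \<le> (norm (x - z))\<^sup>2"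
      by simp
    then show "dist x y \<le> dist x z"
      by (simp add: dist_norm power2_le_iff_abs_le)
  qed
qed

lemma proj_mem_orthogonal:
  assumes L: "subspace L"
  shows "proj L x \<in> L" "z \<in> L \<Longrightarrow> (x - proj L x) \<bullet> z = 0"
proof -
  obtain y w where "y \<in> span L" "\<And>z. z \<in> span L \<Longrightarrow> orthogonal w z" "x = y + w"
    using orthogonal_subspace_decomp_exists[of L x] by metis
  then have yw: "y \<in> L" "\<And>z. z \<in> L \<Longrightarrow> (x - y) \<bullet> z = 0"
    using L by (auto simp: span_eq_iff[THEN iffD2] orthogonal_def)
  moreover have "proj L x = y"
    by (rule proj_unique[OF L yw])
  ultimately show "proj L x \<in> L" "z \<in> L \<Longrightarrow> (x - proj L x) \<bullet> z = 0"
    by auto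
qed

lemma proj_self: "subspace L \<Longrightarrow> x \<in> L \<Longrightarrow> proj L x = x"
  by (rule proj_unique) auto

lemma proj_orthogonal_zero: "subspace L \<Longrightarrow> (\<And>z. z \<in> L \<Longrightarrow> x \<bullet> z = 0) \<Longrightarrow> proj L x = 0"
  by (rule proj_unique) (auto simp: subspace_0)

lemma linear_proj:
  assumes L: "subspace L"
  shows "linear (proj L)"
proof (rule linearI)
  fix x y :: 'a and c :: real
  show "proj L (x + y) = proj L x + proj L y"
  proof (rule proj_unique[OF L])
    fix z assume "z \<in> L"
    then show "(x + y - (proj L x + proj L y)) \<bullet> z = 0"
      using proj_mem_orthogonal(2)[OF L, of z x] proj_mem_orthogonal(2)[OF L, of z y]
      by (simp add: algebra_simps)
  qed (simp add: L proj_mem_orthogonal subspace_add)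
  show "proj L (c *\<^sub>R x) = c *\<^sub>R proj L x"
  proof (rule proj_unique[OF L])
    fix z assume "z \<in> L"
    then show "(c *\<^sub>R x - c *\<^sub>R proj L x) \<bullet> z = 0"
      using proj_mem_orthogonal(2)[OF L, of z x] by (simp flip: scaleR_diff_right)
  qed (simp add: L proj_mem_orthogonal subspace_scale)
qed

section \<open>Lagrangian subspaces and graph coordinates\<close>

text \<open>Take \<open>x\<close> in \<open>S\<close> outside \<open>A\<close>, and \<open>y\<close>
  in \<open>S\<close> that lies in \<open>A\<close> but in no other member. No point
  \<open>x + k y\<close> is in \<open>A\<close>, so two of these infinitely many points share
  another member, which then contains their difference and thus \<open>y\<close>.\<close>

lemma subspace_finite_cover:
  assumes "finite \<F>" "\<And>F. F \<in> \<F> \<Longrightarrow> subspace F" "subspace S" "S \<subseteq> \<Union>\<F>"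
  shows "\<exists>F\<in>\<F>. S \<subseteq> F"
  using assms
proof (induction \<F> rule: finite_induct)
  case empty
  then show ?case
    using subspace_0 by fastforce
next
  case (insert A \<F>)
  show ?case
  proof (rule ccontr)
    assume *: "\<not> ?thesis"
    then obtain x where x: "x \<in> S" "x \<notin> A" by blast
    have "\<not> S \<subseteq> \<Union>\<F>"
      using insert * by blast
    then obtain y where y: "y \<in> S" "y \<notin> \<Union>\<F>" "y \<in> A"
      using insert.prems by blast
    let ?f = "\<lambda>k::nat. x + real k *\<^sub>R y"
    have "?f k \<in> \<Union>\<F>" for k
    proof -
      have "?f k \<in> S"
        using x y insert.prems(2) by (simp add: subspace_add subspace_scale)
      moreover have "?f k \<notin> A"
      proof
        assume "?f k \<in> A"
        then have "?f k - real k *\<^sub>R y \<in> A"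
          using y(3) insert.prems(1) by (intro subspace_diff subspace_scale) auto
        then show False using x(2) by simp
      qed
      ultimately show ?thesis
        using insert.prems(3) by blast
    qed
    then have "\<forall>k. \<exists>F\<in>\<F>. ?f k \<in> F" by blast
    then obtain g where g: "\<And>k. g k \<in> \<F>" "\<And>k. ?f k \<in> g k" by metis
    have "\<not> inj g"
      using insert.hyps(1) g(1) by (meson finite_subset image_subsetI infinite_UNIV_nat inj_on_finite
          finite_imageD)
    then obtain i j where ij: "g i = g j" "i \<noteq> j"
      by (auto simp: inj_def)
    have sub: "subspace (g i)"
      using g insert.prems(1) by auto
    have "?f i - ?f j \<in> g i"
      using g(2)[of i] g(2)[of j] ij(1) sub by (intro subspace_diff) auto
    then have "(1 / (real i - real j)) *\<^sub>R ((real i - real j) *\<^sub>R y) \<in> g i"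
      by (intro subspace_scale[OF sub, of "(real i - real j) *\<^sub>R y"]) (simp add: scaleR_diff_left)
    then have "y \<in> g i"
      using ij(2) by simp
    then show False
      using y(2) g(1) by blast
  qed
qed

locale symplectic_space =
  fixes \<omega> :: "'a::euclidean_space \<Rightarrow> 'a \<Rightarrow> real"
  assumes sympl: "symplectic_form \<omega>"
begin

lemma bilinear_omega: "bilinear \<omega>"
  using sympl by (simp add: symplectic_form_def)

lemmas om = bilinear_forms[OF bilinear_omega]

lemma om_skew: "\<omega> u v = - \<omega> v u"
  using sympl unfolding symplectic_form_def by blast

lemma om_self [simp]: "\<omega> u u = 0"
  using om_skew[of u u] by simp

lemma om_nondegenerate: "(\<And>u. \<omega> u v = 0) \<Longrightarrow> v = 0"
  using sympl om_skew unfolding symplectic_form_def by (metis neg_equal_0_iff_equal)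

lemma tendsto_om: "(f \<longlongrightarrow> a) Fl \<Longrightarrow> (g \<longlongrightarrow> b) Fl \<Longrightarrow> ((\<lambda>q. \<omega> (f q) (g q)) \<longlongrightarrow> \<omega> a b) Fl"
  by (rule bounded_bilinear.tendsto[OF bilinear_omega[unfolded bilinear_conv_bounded_bilinear]])

text \<open>The operator \<open>J\<close> below need not square to \<open>-1\<close>; it is the Hamiltonian vector field of
  half the squared norm.\<close>

lemma riesz_ex: "\<exists>J. linear J \<and> (\<forall>x y. \<omega> x (J y) = x \<bullet> y)"
proof -
  define S where "S y = (\<Sum>b\<in>Basis. \<omega> b y *\<^sub>R b)" for y
  have linS: "linear S"
    unfolding S_def
    by (rule linearI) (simp_all add: om scaleR_add_left sum.distrib scaleR_sum_right)
  have S: "x \<bullet> S y = \<omega> x y" for x y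
  proof -
    have lin: "linear (\<lambda>x. \<omega> x y)"
      using bilinear_omega by (simp add: bilinear_def)
    have "\<omega> x y = \<omega> (\<Sum>b\<in>Basis. (x \<bullet> b) *\<^sub>R b) y"
      by (simp add: euclidean_representation)
    also have "\<dots> = (\<Sum>b\<in>Basis. (x \<bullet> b) * \<omega> b y)"
      by (simp only: linear_sum[OF lin] om)
    also have "\<dots> = x \<bullet> S y"
      unfolding S_def inner_sum_right by (simp add: mult.commute)
    finally show ?thesis by simp
  qed
  have "inj S"
  proof (subst linear_injective_0[OF linS], intro allI impI)
    fix y assume "S y = 0"
    then show "y = 0"
      using S[of _ y] by (intro om_nondegenerate) simp
  qed
  then obtain J where "linear J" "\<forall>x. S (J x) = x"
    using linear_injective_isomorphism[OF linS] by auto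
  then show ?thesis
    using S by (metis)
qed

definition J :: "'a \<Rightarrow> 'a" where
  "J = (SOME J. linear J \<and> (\<forall>x y. \<omega> x (J y) = x \<bullet> y))"

lemma linear_J: "linear J" and om_J: "\<omega> x (J y) = x \<bullet> y"
  using someI_ex[OF riesz_ex] unfolding J_def by auto

text \<open>The symplectic complement of \<open>E\<close> is the Euclidean orthogonal complement of
  the image of \<open>E\<close> under the inverse of \<open>J\<close>, and that image has the
  dimension of \<open>E\<close>.\<close>

lemma dim_omega_complement:
  assumes E: "subspace E"
  shows "dim {x. \<forall>y\<in>E. \<omega> x y = 0} + dim E = DIM('a)"
proof -
  have injJ: "inj J"
  proof (subst linear_injective_0[OF linear_J], intro allI impI)
    fix y assume "J y = 0"
    then have "y \<bullet> y = 0"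
      using om_J[of y y] by (simp add: om)
    then show "y = 0" by simp
  qed
  obtain S where S: "linear S" "\<And>x. J (S x) = x" "\<And>x. S (J x) = x"
    using linear_injective_isomorphism[OF linear_J injJ] by auto
  have "dim (S ` E) = dim E"
    by (rule dim_image_eq[OF S(1)]) (metis S(2) inj_on_def)
  moreover have "{x. \<forall>y\<in>E. \<omega> x y = 0} = {x \<in> UNIV. \<forall>z\<in>S ` E. orthogonal z x}"
  proof -
    have "\<omega> x y = S y \<bullet> x" for x y
      using om_J[of x "S y"] by (simp add: S(2) inner_commute)
    then show ?thesis
      by (auto simp: orthogonal_def)
  qed
  ultimately show ?thesis
    using dim_subspace_orthogonal_to_vectors[of "S ` E" UNIV] S(1) E
    by (simp add: linear_subspace_image)
qed

lemma lagrangianD: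
  assumes "lagrangian \<omega> L"
  shows "subspace L" "2 * dim L = DIM('a)" "\<And>u v. u \<in> L \<Longrightarrow> v \<in> L \<Longrightarrow> \<omega> u v = 0" "0 \<in> L"
  using assms by (auto simp: lagrangian_def subspace_0)

text \<open>Isotropy puts \<open>L\<close> inside its symplectic complement, and both have half the
  full dimension.\<close>

lemma lagrangian_self_orthogonal:
  assumes L: "lagrangian \<omega> L"
  shows "{x. \<forall>y\<in>L. \<omega> x y = 0} = L"
proof (rule sym, rule subspace_dim_equal)
  show "subspace {x. \<forall>y\<in>L. \<omega> x y = 0}"
    by (auto simp: subspace_def om)
  show "dim {x. \<forall>y\<in>L. \<omega> x y = 0} \<le> dim L"
    using dim_omega_complement[of L] lagrangianD[OF L] by simp
qed (use lagrangianD[OF L] in auto)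

lemma lagrangian_memI: "lagrangian \<omega> L \<Longrightarrow> (\<And>y. y \<in> L \<Longrightarrow> \<omega> x y = 0) \<Longrightarrow> x \<in> L"
  using lagrangian_self_orthogonal by blast

text \<open>A maximal isotropic subspace meeting each of the given Lagrangians trivially is Lagrangian,
  since a vector space is not a finite union of proper subspaces.\<close>

lemma common_transversal:
  assumes fin: "finite \<L>" and lag: "\<And>L. L \<in> \<L> \<Longrightarrow> lagrangian \<omega> L"
  obtains W where "lagrangian \<omega> W" "\<And>L. L \<in> \<L> \<Longrightarrow> W \<inter> L = {0}"
proof -
  define P where "P U \<longleftrightarrow> subspace U \<and> (\<forall>u\<in>U. \<forall>v\<in>U. \<omega> u v = 0) \<and> (\<forall>L\<in>\<L>. U \<inter> L = {0})" for U
  have "P {0}"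
    using lagrangianD(4)[OF lag] by (auto simp: P_def om)
  moreover have "\<forall>U. P U \<longrightarrow> dim U < DIM('a) + 1"
    by (simp add: dim_subset_UNIV less_Suc_eq_le)
  ultimately obtain U where U: "P U" and maxU: "\<And>U'. P U' \<Longrightarrow> dim U' \<le> dim U"
    using ex_has_greatest_nat[of P "{0}" dim "DIM('a) + 1"] by blast
  have subU: "subspace U" and iso: "\<And>u v. u \<in> U \<Longrightarrow> v \<in> U \<Longrightarrow> \<omega> u v = 0"
    and tr: "\<And>L. L \<in> \<L> \<Longrightarrow> U \<inter> L = {0}"
    using U by (auto simp: P_def)
  define C where "C = {x. \<forall>y\<in>U. \<omega> x y = 0}"
  have subC: "subspace C"
    by (auto simp: C_def subspace_def om)
  have UC: "U \<subseteq> C"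
    using iso by (auto simp: C_def)
  have dC: "dim C + dim U = DIM('a)"
    unfolding C_def by (rule dim_omega_complement[OF subU])
  have le: "dim U \<le> dim C"
    by (rule dim_subset[OF UC])
  have "2 * dim U = DIM('a)"
  proof (rule ccontr)
    assume "2 * dim U \<noteq> DIM('a)"
    then have lt: "2 * dim U < DIM('a)"
      using dC le by simp
    \<comment> \<open>What a new vector has to avoid: adjoining to \<open>U\<close> a vector of
      \<open>C\<close> outside \<open>Y L\<close> creates no intersection with \<open>L\<close>. As
      \<open>C \<inter> L\<close> is the symplectic complement of \<open>U + L\<close>, it has half
      the full dimension minus \<open>dim U\<close>; so \<open>Y L\<close> has at most half the full
      dimension, while \<open>C\<close> has more.\<close>
    define Y where "Y L = subspace_sum U (C \<inter> L)" for L
    have dY: "2 * dim (Y L) \<le> DIM('a)" and sY: "subspace (Y L)" if L: "L \<in> \<L>" for L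
    proof -
      note Ld = lagrangianD[OF lag[OF L]]
      have sub: "subspace (C \<inter> L)"
        using subC Ld(1) by (rule subspace_inter)
      show "subspace (Y L)"
        unfolding Y_def by (rule subspace_subspace_sum[OF subU sub])
      have "C \<inter> L = {x. \<forall>y\<in>subspace_sum U L. \<omega> x y = 0}"
      proof safe
        fix x y assume "x \<in> C" "x \<in> L" "y \<in> subspace_sum U L"
        then show "\<omega> x y = 0"
          using Ld(3) by (auto simp: C_def subspace_sum_def om)
      next
        fix x assume *: "\<forall>y\<in>subspace_sum U L. \<omega> x y = 0"
        have "u \<in> subspace_sum U L" if "u \<in> U" for u
          unfolding subspace_sum_def using that Ld(4) by force
        then show "x \<in> C"
          using * by (auto simp: C_def)
        have "u \<in> subspace_sum U L" if "u \<in> L" for u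
          unfolding subspace_sum_def using that subspace_0[OF subU] by force
        then show "x \<in> L"
          using * by (intro lagrangian_memI[OF lag[OF L]]) auto
      qed
      then have "dim (C \<inter> L) + dim (subspace_sum U L) = DIM('a)"
        using dim_omega_complement[OF subspace_subspace_sum[OF subU Ld(1)]] by simp
      moreover have "dim (subspace_sum U L) = dim U + dim L"
        using tr[OF L] by (intro dim_subspace_sum_disjoint[OF subU Ld(1)]) auto
      moreover have "dim (Y L) \<le> dim U + dim (C \<inter> L)"
        using dim_subspace_sum_Int[OF subU sub] unfolding Y_def by simp
      ultimately show "2 * dim (Y L) \<le> DIM('a)"
        using Ld(2) by linarith
    qed
    have "\<not> C \<subseteq> \<Union>(insert U (Y ` \<L>))"
    proof
      assume "C \<subseteq> \<Union>(insert U (Y ` \<L>))"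
      then have "\<exists>F\<in>insert U (Y ` \<L>). C \<subseteq> F"
        using fin sY subU by (intro subspace_finite_cover subC) auto
      then obtain F where "F = U \<or> (\<exists>L\<in>\<L>. F = Y L)" "C \<subseteq> F"
        by blast
      then have "2 * dim F \<le> DIM('a)" "dim C \<le> dim F"
        using lt dY dim_subset by auto
      then show False
        using lt dC by linarith
    qed
    then obtain x where x: "x \<in> C" "x \<notin> U" "\<And>L. L \<in> \<L> \<Longrightarrow> x \<notin> Y L"
      by blast
    have spn: "\<exists>u\<in>U. \<exists>k. v = u + k *\<^sub>R x" if "v \<in> span (insert x U)" for v
      using that subU by (metis add.commute diff_add_cancel span_breakdown_eq span_eq_iff)
    have "P (span (insert x U))"
      unfolding P_def
    proof (intro conjI ballI)
      fix v w assume "v \<in> span (insert x U)" "w \<in> span (insert x U)"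
      then obtain u k u' k' where "u \<in> U" "u' \<in> U" "v = u + k *\<^sub>R x" "w = u' + k' *\<^sub>R x"
        using spn by meson
      moreover have "\<omega> x u' = 0" "\<omega> u x = 0"
        using x(1) \<open>u \<in> U\<close> \<open>u' \<in> U\<close> om_skew[of u x] by (auto simp: C_def)
      ultimately show "\<omega> v w = 0"
        using iso by (simp add: om)
    next
      fix L assume L: "L \<in> \<L>"
      note Ld = lagrangianD[OF lag[OF L]]
      have "v = 0" if "v \<in> span (insert x U)" "v \<in> L" for v
      proof -
        obtain u k where uk: "u \<in> U" "v = u + k *\<^sub>R x"
          using spn \<open>v \<in> span (insert x U)\<close> by blast
        have "k = 0"
        proof (rule ccontr)
          assume "k \<noteq> 0"
          then have "x = (- 1 / k) *\<^sub>R u + (1 / k) *\<^sub>R v"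
            by (simp add: uk(2) algebra_simps)
          moreover have "v \<in> C"
            using uk x(1) UC subC by (auto intro: subspace_add subspace_scale)
          then have "(1 / k) *\<^sub>R v \<in> C \<inter> L"
            using that(2) subC Ld(1) by (auto intro: subspace_scale)
          moreover have "(- 1 / k) *\<^sub>R u \<in> U"
            using uk(1) subU by (rule subspace_scale[rotated])
          ultimately have "x \<in> Y L"
            unfolding Y_def subspace_sum_def by blast
          then show False
            using x(3)[OF L] by simp
        qed
        then show ?thesis
          using uk that(2) tr[OF L] by auto
      qed
      then show "span (insert x U) \<inter> L = {0}"
        using Ld(4) span_0 by blast
    qed simp
    from maxU[OF this] show False
      using x(2) subU by (simp add: dim_insert span_eq_iff[THEN iffD2])
  qed
  then have "lagrangian \<omega> U"
    using subU iso by (simp add: lagrangian_def)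
  with tr show thesis
    using that by blast
qed

section \<open>Graph coordinates over a transversal Lagrangian\<close>

definition transv :: "'a set \<Rightarrow> 'a set \<Rightarrow> bool" where
  "transv W L \<longleftrightarrow> lagrangian \<omega> W \<and> lagrangian \<omega> L \<and> W \<inter> L = {0}"

lemma transvD:
  assumes "transv W L"
  shows "lagrangian \<omega> W" "lagrangian \<omega> L" "\<And>x. x \<in> W \<Longrightarrow> x \<in> L \<Longrightarrow> x = 0"
    "subspace W" "subspace L"
  using assms lagrangianD by (auto simp: transv_def)

lemma transv_sym: "transv W L \<Longrightarrow> transv L W"
  by (auto simp: transv_def)

text \<open>\<open>W\<close>-coordinate of the point of \<open>L\<close> lying over \<open>v\<close>, so that \<open>L\<close> is the graph of \<open>gr W L\<close>
  over any complement of \<open>W\<close>.\<close>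

definition gr :: "'a set \<Rightarrow> 'a set \<Rightarrow> 'a \<Rightarrow> 'a" where
  "gr W L v = (THE w. w \<in> W \<and> v + w \<in> L)"

lemma gr_unique:
  assumes "transv W L" "w \<in> W" "v + w \<in> L"
  shows "gr W L v = w"
  unfolding gr_def
proof (rule the_equality)
  fix w' assume "w' \<in> W \<and> v + w' \<in> L"
  then have "w' - w \<in> W" "(v + w') - (v + w) \<in> L"
    using assms transvD(4,5)[OF assms(1)] by (meson subspace_diff)+
  then show "w' = w"
    using transvD(3)[OF assms(1), of "w' - w"] by simp
qed (use assms in auto)

lemma gr_mem:
  assumes T: "transv W L"
  shows "gr W L v \<in> W" "v + gr W L v \<in> L"
proof -
  note t = transvD[OF T]
  have "dim (subspace_sum W L) = dim W + dim L"
    by (rule dim_subspace_sum_disjoint[OF t(4,5,3)])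
  then have "dim (UNIV :: 'a set) \<le> dim (subspace_sum W L)"
    using lagrangianD(2)[OF t(1)] lagrangianD(2)[OF t(2)] by simp
  then have "subspace_sum W L = UNIV"
    by (intro subspace_dim_equal subspace_subspace_sum t) auto
  then obtain w u where wu: "w \<in> W" "u \<in> L" "v = w + u"
    unfolding subspace_sum_def by blast
  then have "- w \<in> W" "v + - w \<in> L"
    using t(4) by (auto simp: subspace_neg)
  with gr_unique[OF T this] show "gr W L v \<in> W" "v + gr W L v \<in> L"
    by auto
qed

lemma linear_gr:
  assumes T: "transv W L"
  shows "linear (gr W L)"
proof (rule linearI)
  note t = transvD[OF T] and g = gr_mem[OF T]
  fix x y c
  show "gr W L (x + y) = gr W L x + gr W L y"
  proof (rule gr_unique[OF T])
    have "(x + gr W L x) + (y + gr W L y) \<in> L"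
      by (intro subspace_add t g)
    then show "x + y + (gr W L x + gr W L y) \<in> L"
      by (simp add: algebra_simps)
  qed (intro subspace_add t g)
  show "gr W L (c *\<^sub>R x) = c *\<^sub>R gr W L x"
  proof (rule gr_unique[OF T])
    have "c *\<^sub>R (x + gr W L x) \<in> L"
      by (intro subspace_scale t g)
    then show "c *\<^sub>R x + c *\<^sub>R gr W L x \<in> L"
      by (simp add: algebra_simps)
  qed (intro subspace_scale t g)
qed

lemma gr_simps:
  assumes T: "transv W L"
  shows "gr W L (x + y) = gr W L x + gr W L y" "gr W L (c *\<^sub>R x) = c *\<^sub>R gr W L x"
    "gr W L (- x) = - gr W L x" "gr W L (x - y) = gr W L x - gr W L y" "gr W L 0 = 0"
  using linear_gr[OF T]
  by (simp_all add: linear_add linear_cmul linear_neg linear_diff linear_0)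

lemma gr_eq_0: "transv W L \<Longrightarrow> v \<in> L \<Longrightarrow> gr W L v = 0"
  by (rule gr_unique) (auto dest: transvD(4) simp: subspace_0)

lemma gr_on_W: "transv W L \<Longrightarrow> w \<in> W \<Longrightarrow> gr W L w = - w"
  by (rule gr_unique) (auto dest: transvD(4,5) simp: subspace_0 subspace_neg)

lemma gr_eq_0_iff:
  assumes T: "transv W L"
  shows "gr W L v = 0 \<longleftrightarrow> v \<in> L"
  using gr_eq_0[OF T] gr_mem(2)[OF T, of v] by auto

text \<open>Expand \<open>\<omega> (u + gr W L u) (v + gr W L v) = 0\<close>: the terms inside
  \<open>M\<close> and inside \<open>W\<close> vanish too, and the two mixed terms remain.\<close>

lemma gr_symmetric:
  assumes T: "transv W L" and M: "lagrangian \<omega> M" and "u \<in> M" "v \<in> M"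
  shows "\<omega> u (gr W L v) = \<omega> v (gr W L u)"
proof -
  have "\<omega> (u + gr W L u) (v + gr W L v) = 0" "\<omega> (gr W L u) (gr W L v) = 0" "\<omega> u v = 0"
    using gr_mem[OF T] transvD(1,2)[OF T] lagrangianD(3) M assms(3,4) by blast+
  then show ?thesis
    using om_skew[of v "gr W L u"] by (simp add: om)
qed

lemma bilinear_gr:
  assumes T: "transv W L"
  shows "bilinear (\<lambda>u v. \<omega> u (gr W L v))"
  by (rule bilinearI_real) (simp_all add: om gr_simps[OF T])

text \<open>\<open>T q\<close> fixes \<open>W\<close> pointwise and, for \<open>q\<close> far enough
  along the filter, maps \<open>L\<close> onto \<open>l q\<close>. So the coordinate of
  \<open>l q\<close> is that of \<open>L\<close> precomposed with the inverse of \<open>T q\<close>.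
  As \<open>T q\<close> tends to the identity, openness of transversality and the continuity and
  differentiability of \<open>gr\<close> all reduce to the near-identity lemmas.\<close>

lemma chart_operator:
  assumes T: "transv W L"
    and lag: "\<forall>\<^sub>F q in Fl. lagrangian \<omega> (l q)"
    and lim: "\<And>x. ((\<lambda>q. proj (l q) x) \<longlongrightarrow> proj L x) Fl"
  defines "T \<equiv> \<lambda>q x. proj (l q) (x + gr W L x) - gr W L x"
  shows "\<forall>\<^sub>F q in Fl. linear (T q)" "\<And>x. ((\<lambda>q. T q x) \<longlongrightarrow> x) Fl"
    "\<forall>\<^sub>F q in Fl. transv W (l q) \<and> (\<forall>v. \<exists>y. T q y = v) \<and> (\<forall>v y. T q y = v \<longrightarrow> gr W (l q) v = gr W L y)"
proof -
  note t = transvD[OF T] and g = gr_mem[OF T]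
  show lin: "\<forall>\<^sub>F q in Fl. linear (T q)"
    using lag
  proof eventually_elim
    case (elim q)
    note lp = linear_proj[OF lagrangianD(1)[OF elim]]
    show ?case
      unfolding T_def
      by (rule linearI)
        (simp_all add: gr_simps[OF T] linear_add[OF lp] linear_cmul[OF lp] algebra_simps)
  qed
  show lim': "((\<lambda>q. T q x) \<longlongrightarrow> x) Fl" for x
  proof -
    have "((\<lambda>q. T q x) \<longlongrightarrow> proj L (x + gr W L x) - gr W L x) Fl"
      unfolding T_def by (intro tendsto_intros lim)
    then show ?thesis
      using proj_self[OF t(5) g(2), of x] by simp
  qed
  show "\<forall>\<^sub>F q in Fl. transv W (l q) \<and> (\<forall>v. \<exists>y. T q y = v) \<and> (\<forall>v y. T q y = v \<longrightarrow> gr W (l q) v = gr W L y)"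
    using lag lin near_identity_bij[OF lin lim']
  proof eventually_elim
    case (elim q)
    note lq = lagrangianD[OF elim(1)]
    have TW: "T q w = w" if "w \<in> W" for w
      using that linear_0[OF linear_proj[OF lq(1)]] unfolding T_def by (simp add: gr_on_W[OF T])
    have TL: "T q x \<in> l q" if "x \<in> L" for x
      using that lq(1) unfolding T_def by (simp add: gr_eq_0[OF T] proj_mem_orthogonal)
    have inj: "inj (T q)"
      using elim(3) by (simp add: bij_def)
    have "dim (T q ` L) = dim L"
      using inj by (intro dim_image_eq[OF elim(2)]) (auto intro: inj_on_subset)
    then have TL': "T q ` L = l q"
      using TL lq(1,2) lagrangianD(2)[OF t(2)] elim(2) t(5)
      by (intro subspace_dim_equal linear_subspace_image) auto
    have tr: "transv W (l q)"
    proof -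
      have "y = 0" if "y \<in> W" "y \<in> l q" for y
      proof -
        obtain x where "x \<in> L" "y = T q x"
          using TL' \<open>y \<in> l q\<close> by blast
        then have "x = y"
          using TW[OF \<open>y \<in> W\<close>] inj by (metis injD)
        then show ?thesis
          using \<open>x \<in> L\<close> \<open>y \<in> W\<close> t(3) by blast
      qed
      then show ?thesis
        using t(1,4) elim(1) lq(4) subspace_0 unfolding transv_def by blast
    qed
    moreover have "gr W (l q) v = gr W L y" if "T q y = v" for v y
    proof (rule gr_unique[OF tr g(1)])
      show "v + gr W L y \<in> l q"
        unfolding that[symmetric] T_def using lq(1) by (simp add: proj_mem_orthogonal)
    qed
    moreover have "\<forall>v. \<exists>y. T q y = v"
      using elim(3) by (metis bij_pointE)
    ultimately show ?case
      by blast
  qed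
qed

lemma transv_eventually:
  assumes "transv W L"
    and "\<forall>\<^sub>F q in Fl. lagrangian \<omega> (l q)"
    and "\<And>x. ((\<lambda>q. proj (l q) x) \<longlongrightarrow> proj L x) Fl"
  shows "\<forall>\<^sub>F q in Fl. transv W (l q)"
  using chart_operator(3)[OF assms] by (rule eventually_mono) blast

lemma linear_tendsto:
  fixes f :: "'a \<Rightarrow> 'a"
  shows "linear f \<Longrightarrow> (g \<longlongrightarrow> x) Fl \<Longrightarrow> ((\<lambda>q. f (g q)) \<longlongrightarrow> f x) Fl"
  by (rule bounded_linear.tendsto) (simp add: linear_conv_bounded_linear)

lemma gr_tendsto:
  assumes T: "transv W L"
    and lag: "\<forall>\<^sub>F q in Fl. lagrangian \<omega> (l q)"
    and lim: "\<And>x. ((\<lambda>q. proj (l q) x) \<longlongrightarrow> proj L x) Fl"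
  shows "((\<lambda>q. gr W (l q) v) \<longlongrightarrow> gr W L v) Fl"
proof -
  note co = chart_operator[OF T lag lim]
  define y where "y q = (SOME y. proj (l q) (y + gr W L y) - gr W L y = v)" for q
  have sol: "\<forall>\<^sub>F q in Fl. proj (l q) (y q + gr W L (y q)) - gr W L (y q) = v"
    using co(3)
  proof eventually_elim
    case (elim q)
    then have "\<exists>y. proj (l q) (y + gr W L y) - gr W L y = v" by blast
    then show ?case
      unfolding y_def by (rule someI_ex)
  qed
  have "(y \<longlongrightarrow> v) Fl"
    by (rule near_identity_solution_tendsto[OF co(1,2) sol tendsto_const])
  then have "((\<lambda>q. gr W L (y q)) \<longlongrightarrow> gr W L v) Fl"
    by (rule linear_tendsto[OF linear_gr[OF T]])
  moreover have "\<forall>\<^sub>F q in Fl. gr W L (y q) = gr W (l q) v"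
    using co(3) sol by eventually_elim metis
  ultimately show ?thesis
    by (rule Lim_transform_eventually)
qed

text \<open>\<open>gr W (l t) v\<close> is the fixed linear map \<open>gr W (l t0)\<close> applied
  to the solution \<open>y t\<close> of the chart equation, and the derivative of that solution is
  known.\<close>

lemma gr_derivative:
  fixes l :: "real \<Rightarrow> 'a set"
  assumes T: "transv W (l t0)"
    and lag: "\<forall>\<^sub>F t in at t0 within S. lagrangian \<omega> (l t)"
    and der: "\<And>x. ((\<lambda>t. proj (l t) x) has_vector_derivative D x) (at t0 within S)"
  shows "((\<lambda>t. gr W (l t) v) has_vector_derivative
      - gr W (l t0) (D (v + gr W (l t0) v))) (at t0 within S)"
proof -
  let ?L = "l t0"
  have lim: "((\<lambda>t. proj (l t) x) \<longlongrightarrow> proj ?L x) (at t0 within S)" for x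
    using has_vector_derivative_continuous[OF der[of x]] by (simp add: continuous_within)
  note co = chart_operator[OF T lag lim]
  let ?T = "\<lambda>t y. proj (l t) (y + gr W ?L y) - gr W ?L y"
  define y where "y t = (if t = t0 then v else (SOME y. ?T t y = v))" for t
  have ne: "\<forall>\<^sub>F t in at t0 within S. t \<noteq> t0"
    by (simp add: eventually_at_filter)
  have sol: "\<forall>\<^sub>F t in at t0 within S. ?T t (y t) = v"
    using co(3) ne
  proof eventually_elim
    case (elim t)
    then have "\<exists>y. ?T t y = v" by blast
    then show ?case
      unfolding y_def using someI_ex[of "\<lambda>y. ?T t y = v"] elim(2) by simp
  qed
  have T0: "?T t0 v = v"
    using gr_mem(2)[OF T] transvD(5)[OF T] by (simp add: proj_self)
  have "((\<lambda>t. ?T t v) has_vector_derivative D (v + gr W ?L v) - 0) (at t0 within S)"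
    by (intro has_vector_derivative_diff der has_vector_derivative_const)
  then have "(y has_vector_derivative - D (v + gr W ?L v)) (at t0 within S)"
    by (intro near_identity_solution_derivative[OF co(1,2) T0 _ sol]) (auto simp: y_def)
  then have "((\<lambda>t. gr W ?L (y t)) has_vector_derivative gr W ?L (- D (v + gr W ?L v))) (at t0 within S)"
    by (rule bounded_linear.has_vector_derivative[OF linear_gr[OF T, unfolded linear_conv_bounded_linear]])
  then have "((\<lambda>t. (gr W ?L (y t) - gr W ?L v) /\<^sub>R (t - t0)) \<longlongrightarrow> gr W ?L (- D (v + gr W ?L v))) (at t0 within S)"
    unfolding has_vector_derivative_iff_quotient by (simp add: y_def)
  moreover have "\<forall>\<^sub>F t in at t0 within S. (gr W ?L (y t) - gr W ?L v) /\<^sub>R (t - t0)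
      = (gr W (l t) v - gr W ?L v) /\<^sub>R (t - t0)"
    using co(3) sol by eventually_elim metis
  ultimately have "((\<lambda>t. (gr W (l t) v - gr W ?L v) /\<^sub>R (t - t0)) \<longlongrightarrow> gr W ?L (- D (v + gr W ?L v))) (at t0 within S)"
    by (rule Lim_transform_eventually)
  then show ?thesis
    unfolding has_vector_derivative_iff_quotient by (simp add: gr_simps[OF T])
qed

section \<open>The index of a Lagrangian in a chart\<close>

definition chart_index :: "'a set \<Rightarrow> 'a set \<Rightarrow> 'a set \<Rightarrow> nat" where
  "chart_index L0 W L = n_plus (\<lambda>v. \<omega> v (gr W L v)) L0"

text \<open>For \<open>v\<close> in the radical, \<open>gr W L v\<close> is symplectically
  orthogonal to \<open>L0\<close>; so it lies in \<open>L0 \<inter> W\<close> and vanishes.\<close>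

lemma chart_radical:
  assumes T: "transv W L" and T0: "transv W L0"
  shows "form_radical (\<lambda>u v. \<omega> u (gr W L v)) L0 = L \<inter> L0"
proof safe
  fix v assume v: "v \<in> form_radical (\<lambda>u v. \<omega> u (gr W L v)) L0"
  then have "gr W L v \<in> L0"
    using om_skew[of "gr W L v"] by (intro lagrangian_memI[OF transvD(2)[OF T0]]) (auto simp: form_radical_def)
  then have "gr W L v = 0"
    using gr_mem(1)[OF T] transvD(3)[OF T0] by blast
  then show "v \<in> L"
    by (simp add: gr_eq_0_iff[OF T])
  show "v \<in> L0"
    using v by (simp add: form_radical_def)
next
  fix v assume "v \<in> L" "v \<in> L0"
  then show "v \<in> form_radical (\<lambda>u v. \<omega> u (gr W L v)) L0"
    by (simp add: form_radical_def gr_eq_0[OF T] om)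
qed

lemma chart_sylvester:
  assumes T: "transv W L" and T0: "transv W L0"
  shows "chart_index L0 W L + n_plus (\<lambda>v. - \<omega> v (gr W L v)) L0 + dim (L \<inter> L0) = dim L0"
  using sylvester_inertia[OF bilinear_gr[OF T] transvD(5)[OF T0] gr_symmetric[OF T transvD(2)[OF T0]]]
  unfolding chart_radical[OF T T0] chart_index_def .

text \<open>In block form with respect to \<open>V = L0 \<oplus> W\<close> this is the matrix with diagonal blocks \<open>A\<close>, \<open>B\<close>
  and off-diagonal blocks the identity, where \<open>L\<close> is the graph of \<open>A\<close> and \<open>W'\<close> that of \<open>B\<close>.
  In the chart of \<open>W'\<close> the form of \<open>L\<close> is \<open>A - A B A\<close>; its negative and \<open>A\<close> are the restrictions
  of this form to two mutually orthogonal subspaces.\<close>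

definition compare_form :: "'a set \<Rightarrow> 'a set \<Rightarrow> 'a set \<Rightarrow> 'a set \<Rightarrow> 'a \<Rightarrow> 'a \<Rightarrow> real" where
  "compare_form L0 W W' L x y =
     \<omega> (x + gr W L0 x) (gr W L (y + gr W L0 y)) - \<omega> (x + gr W L0 x) (gr W L0 y)
     - \<omega> (y + gr W L0 y) (gr W L0 x) + \<omega> (gr L0 W' (gr W L0 x)) (gr W L0 y)"

section \<open>Comparison of the indices in two charts\<close>

context
  fixes L0 W W' L
  assumes T0: "transv W L0" and T0': "transv W' L0" and T: "transv W L" and T': "transv W' L"
begin

lemma bilinear_compare_form: "bilinear (compare_form L0 W W' L)"
  unfolding compare_form_def
  by (rule bilinearI_real)
    (simp_all add: om gr_simps[OF T0] gr_simps[OF T] gr_simps[OF transv_sym[OF T0']] algebra_simps)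

lemma compare_form_symmetric: "compare_form L0 W W' L x y = compare_form L0 W W' L y x"
proof -
  note g0 = gr_mem[OF T0] and L0 = transvD(2)[OF T0]
  have 1: "\<omega> (x + gr W L0 x) (gr W L (y + gr W L0 y)) = \<omega> (y + gr W L0 y) (gr W L (x + gr W L0 x))"
    by (rule gr_symmetric[OF T L0 g0(2) g0(2)])
  have "\<omega> (gr W L0 y) (gr L0 W' (gr W L0 x)) = \<omega> (gr W L0 x) (gr L0 W' (gr W L0 y))"
    by (rule gr_symmetric[OF transv_sym[OF T0'] transvD(1)[OF T0] g0(1) g0(1)])
  then have 2: "\<omega> (gr L0 W' (gr W L0 x)) (gr W L0 y) = \<omega> (gr L0 W' (gr W L0 y)) (gr W L0 x)"
    using om_skew[of "gr L0 W' (gr W L0 x)"] om_skew[of "gr L0 W' (gr W L0 y)"] by simp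
  show ?thesis
    unfolding compare_form_def 1 2 by simp
qed

text \<open>In blocks a null vector \<open>(v, w)\<close> satisfies \<open>A v + w = 0\<close> and
  \<open>v + B w = 0\<close>. Then \<open>v + A v\<close> lies both on \<open>L\<close> and on
  \<open>W'\<close>, whose transversality makes it zero.\<close>

lemma compare_form_nondegenerate: "form_radical (compare_form L0 W W' L) UNIV = {0}"
proof -
  note g0 = gr_mem[OF T0] and L0 = transvD(2)[OF T0] and T0s = transv_sym[OF T0']
  have "z = 0" if z: "\<And>u. compare_form L0 W W' L u z = 0" for z
  proof -
    define v w where "v = z + gr W L0 z" and "w = - gr W L0 z"
    have v: "v \<in> L0" and w: "w \<in> W" and zvw: "z = v + w"
      using g0 transvD(4)[OF T0] by (auto simp: v_def w_def subspace_neg)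
    have "\<omega> u (gr W L v + w) = 0" if "u \<in> L0" for u
      using z[of u] gr_eq_0[OF T0 that] gr_simps(5)[OF T0s]
      by (simp add: compare_form_def v_def w_def om)
    then have "gr W L v + w \<in> L0"
      using om_skew[of "gr W L v + w"] by (intro lagrangian_memI[OF L0]) simp
    moreover have "gr W L v + w \<in> W"
      using gr_mem(1)[OF T] w transvD(4)[OF T0] by (simp add: subspace_add)
    ultimately have "gr W L v + w = 0"
      using transvD(3)[OF T0] by blast
    then have wA: "w = - gr W L v"
      by (simp add: eq_neg_iff_add_eq_0 add.commute)
    have "\<omega> (v + gr L0 W' w) u = 0" if u: "u \<in> W" for u
    proof -
      have "0 = \<omega> v u - \<omega> (gr L0 W' u) (gr W L0 z)"
        using z[of u] gr_on_W[OF T0 u] by (simp add: compare_form_def v_def om gr_simps[OF T0s])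
      also have "\<omega> (gr L0 W' u) (gr W L0 z) = \<omega> (gr L0 W' (gr W L0 z)) u"
        using gr_symmetric[OF T0s transvD(1)[OF T0] u g0(1), of z]
          om_skew[of "gr L0 W' u"] om_skew[of "gr L0 W' (gr W L0 z)"] by simp
      finally show ?thesis
        by (simp add: w_def om gr_simps[OF T0s])
    qed
    then have "v + gr L0 W' w \<in> W"
      by (rule lagrangian_memI[OF transvD(1)[OF T0]])
    moreover have "v + gr L0 W' w \<in> L0"
      using v gr_mem(1)[OF T0s] lagrangianD(1)[OF L0] by (simp add: subspace_add)
    ultimately have "v + gr L0 W' w = 0"
      using transvD(3)[OF T0] by blast
    then have vB: "v = gr L0 W' (gr W L v)"
      using wA by (simp add: gr_simps[OF T0s] eq_neg_iff_add_eq_0)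
    have "v + gr W L v \<in> W'"
      using gr_mem(2)[OF T0s, of "gr W L v"] vB by (simp add: add.commute)
    then have "v + gr W L v = 0"
      using gr_mem(2)[OF T, of v] transvD(3)[OF T'] by blast
    then have "v = - gr W L v"
      by (simp add: eq_neg_iff_add_eq_0)
    then have "v \<in> W"
      using gr_mem(1)[OF T, of v] transvD(4)[OF T] by (metis subspace_neg)
    then have "v = 0"
      using v transvD(3)[OF T0] by blast
    then show "z = 0"
      using wA zvw by (simp add: gr_simps[OF T])
  qed
  then show ?thesis
    by (auto simp: form_radical_def bilinear_forms[OF bilinear_compare_form])
qed

lemma compare_form_sylvester:
  "n_plus (\<lambda>z. compare_form L0 W W' L z z) UNIV + n_plus (\<lambda>z. - compare_form L0 W W' L z z) UNIV = DIM('a)"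
  using sylvester_inertia[OF bilinear_compare_form subspace_UNIV compare_form_symmetric]
  unfolding compare_form_nondegenerate by simp

text \<open>The subspace \<open>F + R\<close> of \<open>L0\<close> and the image of
  \<open>F'\<close> under \<open>k\<close> are orthogonal for the compare form. On the former it is
  the form of \<open>L\<close> in the chart of \<open>W\<close>; on the latter it is minus the form
  of \<open>L\<close> in the chart of \<open>W'\<close>. The sign \<sigma> treats both inertia
  indices at once.\<close>

lemma compare_form_ge:
  assumes \<sigma>: "\<sigma> = 1 \<or> \<sigma> = -1"
  shows "n_plus (\<lambda>v. \<sigma> * \<omega> v (gr W L v)) L0 + n_plus (\<lambda>v. - \<sigma> * \<omega> v (gr W' L v)) L0 + dim (L \<inter> L0)
    \<le> n_plus (\<lambda>z. \<sigma> * compare_form L0 W W' L z z) UNIV"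
proof -
  note g0 = gr_mem[OF T0] and L0 = transvD(2)[OF T0] and T0s = transv_sym[OF T0']
  note s0 = gr_simps[OF T0] and sA = gr_simps[OF T] and sB = gr_simps[OF T0s]
  let ?P = "compare_form L0 W W' L"
  note P = bilinear_forms[OF bilinear_compare_form]
  have subL0: "subspace L0"
    using lagrangianD(1)[OF L0] .
  define R where "R = L \<inter> L0"
  have R: "subspace R"
    unfolding R_def using transvD(5)[OF T] subL0 by (rule subspace_inter)
  obtain F where F: "subspace F" "F \<subseteq> L0" "\<And>v. v \<in> F \<Longrightarrow> v \<noteq> 0 \<Longrightarrow> \<sigma> * \<omega> v (gr W L v) > 0"
      "dim F = n_plus (\<lambda>v. \<sigma> * \<omega> v (gr W L v)) L0"
    using n_plus_attained[of L0 "\<lambda>v. \<sigma> * \<omega> v (gr W L v)"] subspace_0[OF subL0] by blast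
  obtain F' where F': "subspace F'" "F' \<subseteq> L0" "\<And>v. v \<in> F' \<Longrightarrow> v \<noteq> 0 \<Longrightarrow> - \<sigma> * \<omega> v (gr W' L v) > 0"
      "dim F' = n_plus (\<lambda>v. - \<sigma> * \<omega> v (gr W' L v)) L0"
    using n_plus_attained[of L0 "\<lambda>v. - \<sigma> * \<omega> v (gr W' L v)"] subspace_0[OF subL0] by blast
  define Y where "Y x = x + gr W' L x" for x
  \<comment> \<open>The point \<open>Y x\<close> of \<open>L\<close> with its
    \<open>W\<close>-component reversed. In blocks it is \<open>(u, - A u)\<close>, exactly the
    shape that orthogonality to \<open>L0\<close> demands.\<close>
  define k where "k x = Y x + 2 *\<^sub>R gr W L0 (Y x)" for x
  have link: "linear k"
    unfolding k_def Y_def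
    by (rule linearI) (simp_all add: s0 gr_simps[OF T'] algebra_simps)
  have gk: "gr W L0 (k x) = - gr W L0 (Y x)" for x
    using gr_on_W[OF T0 g0(1), of "Y x"] by (simp add: k_def s0 scaleR_2)
  define u where "u x = Y x + gr W L0 (Y x)" for x
  have uk: "k x + gr W L0 (k x) = u x" for x
    by (simp add: gk) (simp add: k_def u_def scaleR_2)
  have uL0: "u x \<in> L0" for x
    unfolding u_def by (rule g0)
  have Au: "gr W L (u x) = - gr W L0 (Y x)" for x
  proof (rule gr_unique[OF T])
    show "- gr W L0 (Y x) \<in> W"
      using g0(1) transvD(4)[OF T0] by (simp add: subspace_neg)
    show "u x + - gr W L0 (Y x) \<in> L"
      using gr_mem(2)[OF T', of x] by (simp add: u_def Y_def)
  qed
  have gk': "gr W L0 (k x) = gr W L (u x)" for x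
    by (simp add: gk Au)
  have x_eq: "x = u x - gr L0 W' (gr W L (u x))" if "x \<in> L0" for x
  proof -
    let ?d = "x - (u x - gr L0 W' (gr W L (u x)))"
    have "?d \<in> L0"
      using that uL0 gr_mem(1)[OF T0s] subL0 by (simp add: subspace_diff)
    moreover have "?d = (gr W L (u x) + gr L0 W' (gr W L (u x))) - gr W' L x"
      by (simp only: Au) (simp add: u_def Y_def)
    then have "?d \<in> W'"
      using gr_mem(2)[OF T0s] gr_mem(1)[OF T'] transvD(4)[OF T0'] by (simp only: subspace_diff)
    ultimately show ?thesis
      using transvD(3)[OF T0'] by force
  qed
  have PL: "?P z z' = \<omega> z (gr W L z')" if "z \<in> L0" "z' \<in> L0" for z z'
    using gr_eq_0[OF T0 that(1)] gr_eq_0[OF T0 that(2)] by (simp add: compare_form_def om)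
  have Pk: "?P z (k x) = 0" if "z \<in> L0" for z x
    using gr_eq_0[OF T0 that] unfolding compare_form_def uk unfolding gk' by (simp add: om sB)
  have Pkk: "?P (k x) (k x) = - \<omega> x (gr W' L x)" if x: "x \<in> L0" for x
  proof -
    have "?P (k x) (k x) = - \<omega> (u x - gr L0 W' (gr W L (u x))) (gr W L (u x))"
      unfolding compare_form_def uk unfolding gk' by (simp add: om)
    also have "\<dots> = - \<omega> x (gr W L (u x))"
      using x_eq[OF x] by simp
    also have "gr W L (u x) = x + gr W' L x - u x"
      by (simp only: Au) (simp add: u_def Y_def)
    also have "\<omega> x (x + gr W' L x - u x) = \<omega> x (gr W' L x)"
      using lagrangianD(3)[OF L0 x uL0] by (simp add: om)
    finally show ?thesis .
  qed
  have kL0: "x = 0" if x: "x \<in> F'" "k x \<in> L0" for x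
  proof (rule ccontr)
    assume "x \<noteq> 0"
    have 0: "gr W L (u x) = 0"
      using gr_eq_0[OF T0 x(2)] gk' by simp
    then have "u x \<in> L"
      by (simp add: gr_eq_0_iff[OF T])
    moreover have "x = u x"
      using x_eq[of x] x(1) F'(2) unfolding 0 by (auto simp: sB)
    ultimately have "x \<in> L"
      by simp
    then have "gr W' L x = 0"
      using gr_eq_0[OF T'] by simp
    then show False
      using F'(3)[OF x(1) \<open>x \<noteq> 0\<close>] by (simp add: om)
  qed
  let ?G = "k ` F'"
  have G: "subspace ?G"
    using link F'(1) by (simp add: linear_subspace_image)
  have dG: "dim ?G = dim F'"
  proof (rule dim_image_eq[OF link])
    have "inj_on k F'"
    proof (rule inj_onI)
      fix x y assume "x \<in> F'" "y \<in> F'" "k x = k y"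
      then have "k (x - y) = 0" "x - y \<in> F'"
        using F'(1) by (auto simp: linear_diff[OF link] subspace_diff)
      then show "x = y"
        using kL0[of "x - y"] subspace_0[OF subL0] by simp
    qed
    then show "inj_on k (span F')"
      using F'(1) by (simp add: span_eq_iff[THEN iffD2])
  qed
  let ?FR = "subspace_sum F R"
  have FR: "subspace ?FR" "?FR \<subseteq> L0"
    by (rule subspace_subspace_sum[OF F(1) R], rule subspace_sum_subset[OF subL0 F(2)])
      (simp add: R_def)
  have dFR: "dim ?FR = dim F + dim R"
  proof (rule dim_subspace_sum_disjoint[OF F(1) R])
    fix x assume "x \<in> F" "x \<in> R"
    then show "x = 0"
      using F(3)[of x] gr_eq_0[OF T, of x] by (force simp: R_def om)
  qed
  let ?Z = "subspace_sum ?FR ?G"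
  have dZ: "dim ?Z = dim F + dim R + dim F'"
    unfolding dFR[symmetric] dG[symmetric]
  proof (rule dim_subspace_sum_disjoint[OF FR(1) G])
    fix z assume "z \<in> ?FR" "z \<in> ?G"
    then show "z = 0"
      using kL0 FR(2) linear_0[OF link] by force
  qed
  have "dim ?Z + n_plus (\<lambda>v. - (\<sigma> * ?P v v)) UNIV \<le> dim (UNIV :: 'a set)"
  proof (rule dim_nonneg_le)
    fix z assume "z \<in> ?Z"
    then obtain f r x where z: "f \<in> F" "r \<in> R" "x \<in> F'" "z = f + r + k x"
      unfolding subspace_sum_def by blast
    have in0: "f \<in> L0" "r \<in> L0" "x \<in> L0" "r \<in> L" "f + r \<in> L0"
      using z F(2) F'(2) subL0 by (auto simp: R_def subspace_add)
    have "?P z z = ?P (f + r) (f + r) + 2 * ?P (f + r) (k x) + ?P (k x) (k x)"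
      using compare_form_symmetric[of "k x" "f + r"] by (simp add: z(4) P)
    also have "\<dots> = ?P (f + r) (f + r) - \<omega> x (gr W' L x)"
      by (simp only: Pk[OF in0(5)] Pkk[OF in0(3)])
    also have "?P (f + r) (f + r) = ?P f f + 2 * ?P f r + ?P r r"
      using compare_form_symmetric[of r f] by (simp add: P)
    also have "\<dots> = \<omega> f (gr W L f)"
      using PL in0 gr_eq_0[OF T in0(4)] by (simp add: om)
    finally have "?P z z = \<omega> f (gr W L f) - \<omega> x (gr W' L x)" .
    then have "\<sigma> * ?P z z = \<sigma> * \<omega> f (gr W L f) + - \<sigma> * \<omega> x (gr W' L x)"
      by (simp add: right_diff_distrib)
    moreover have "\<sigma> * \<omega> f (gr W L f) \<ge> 0"
      using F(3)[OF z(1)] by (cases "f = 0") (auto simp: om)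
    moreover have "- \<sigma> * \<omega> x (gr W' L x) \<ge> 0"
      using F'(3)[OF z(3)] by (cases "x = 0") (auto simp: om)
    ultimately show "0 \<le> \<sigma> * ?P z z"
      by simp
  qed (auto intro: subspace_subspace_sum[OF FR(1) G])
  moreover have "n_plus (\<lambda>z. \<sigma> * ?P z z) UNIV + n_plus (\<lambda>z. - (\<sigma> * ?P z z)) UNIV = DIM('a)"
    using compare_form_sylvester \<sigma> by auto
  ultimately show ?thesis
    using dZ F(4) F'(4) by (simp add: R_def)
qed

text \<open>By Sylvester in both charts, the lower bounds for the signs 1 and -1 add up to the full
  dimension, so both are sharp.\<close>

lemma chart_index_change:
  "n_plus (\<lambda>z. compare_form L0 W W' L z z) UNIV + chart_index L0 W' L = chart_index L0 W L + dim L0"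
proof -
  have "chart_index L0 W L + n_plus (\<lambda>v. - \<omega> v (gr W' L v)) L0 + dim (L \<inter> L0)
      \<le> n_plus (\<lambda>z. compare_form L0 W W' L z z) UNIV"
    using compare_form_ge[of 1] by (simp add: chart_index_def)
  moreover have "n_plus (\<lambda>v. - \<omega> v (gr W L v)) L0 + chart_index L0 W' L + dim (L \<inter> L0)
      \<le> n_plus (\<lambda>z. - compare_form L0 W W' L z z) UNIV"
    using compare_form_ge[of "-1"] by (simp add: chart_index_def)
  moreover have "2 * dim L0 = DIM('a)"
    by (rule lagrangianD(2)[OF transvD(2)[OF T0]])
  ultimately show ?thesis
    using compare_form_sylvester chart_sylvester[OF T T0] chart_sylvester[OF T' T0'] by linarith
qed

end

text \<open>The compare form stays nondegenerate along the family. Both its indices are lower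
  semicontinuous and their sum is constant, so neither can change.\<close>

lemma chart_index_difference_locally_constant:
  assumes T0: "transv W L0" and T0': "transv W' L0" and T: "transv W L" and T': "transv W' L"
    and lag: "\<forall>\<^sub>F q in Fl. lagrangian \<omega> (l q)"
    and lim: "\<And>x. ((\<lambda>q. proj (l q) x) \<longlongrightarrow> proj L x) Fl"
  shows "\<forall>\<^sub>F q in Fl. int (chart_index L0 W (l q)) - int (chart_index L0 W' (l q))
      = int (chart_index L0 W L) - int (chart_index L0 W' L)"
proof -
  let ?P = "compare_form L0 W W'"
  note tr = transv_eventually[OF T lag lim] transv_eventually[OF T' lag lim]
  have bil: "\<forall>\<^sub>F q in Fl. bilinear (?P (l q))"
    using tr by eventually_elim (rule bilinear_compare_form[OF T0 T0'])
  have limP: "((\<lambda>q. ?P (l q) u v) \<longlongrightarrow> ?P L u v) Fl" for u v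
    unfolding compare_form_def
    by (intro tendsto_intros tendsto_om gr_tendsto[OF T lag lim])
  have B0: "bilinear (?P L)"
    by (rule bilinear_compare_form[OF T0 T0' T T'])
  have pos: "\<forall>\<^sub>F q in Fl. n_plus (\<lambda>v. ?P L v v) UNIV \<le> n_plus (\<lambda>v. ?P (l q) v v) UNIV"
    by (rule n_plus_lower_semicontinuous[OF bil B0 limP subspace_UNIV])
  have neg: "\<forall>\<^sub>F q in Fl. n_plus (\<lambda>v. - ?P L v v) UNIV \<le> n_plus (\<lambda>v. - ?P (l q) v v) UNIV"
  proof (rule n_plus_lower_semicontinuous[where B = "\<lambda>q u v. - ?P (l q) u v"
        and ?B0.0 = "\<lambda>u v. - ?P L u v"])
    show "\<forall>\<^sub>F q in Fl. bilinear (\<lambda>u v. - ?P (l q) u v)"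
      using bil
    proof eventually_elim
      case (elim q)
      show ?case
        by (rule bilinearI_real) (simp_all add: bilinear_forms[OF elim])
    qed
    show "bilinear (\<lambda>u v. - ?P L u v)"
      by (rule bilinearI_real) (simp_all add: bilinear_forms[OF B0])
    show "((\<lambda>q. - ?P (l q) u v) \<longlongrightarrow> - ?P L u v) Fl" for u v
      by (rule tendsto_minus[OF limP])
  qed simp
  from pos neg tr show ?thesis
  proof eventually_elim
    case (elim q)
    show ?case
      using elim(1,2) compare_form_sylvester[OF T0 T0' T T']
        compare_form_sylvester[OF T0 T0' elim(3,4)]
        chart_index_change[OF T0 T0' T T'] chart_index_change[OF T0 T0' elim(3,4)]
      by linarith
  qed
qed

section \<open>Index functions of families of Lagrangians\<close>

definition cont_lag :: "'p::topological_space set \<Rightarrow> ('p \<Rightarrow> 'a set) \<Rightarrow> bool" where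
  "cont_lag S l \<longleftrightarrow> (\<forall>p\<in>S. lagrangian \<omega> (l p)) \<and> (\<forall>x. continuous_on S (\<lambda>p. proj (l p) x))"

lemma cont_lagD:
  assumes "cont_lag S l" "p \<in> S"
  shows "lagrangian \<omega> (l p)" "\<forall>\<^sub>F q in at p within S. lagrangian \<omega> (l q)"
    "((\<lambda>q. proj (l q) x) \<longlongrightarrow> proj (l p) x) (at p within S)"
  using assms by (auto simp: cont_lag_def continuous_on_def eventually_at_filter)

lemma cont_lag_subset: "cont_lag S l \<Longrightarrow> S' \<subseteq> S \<Longrightarrow> cont_lag S' l"
  unfolding cont_lag_def by (meson continuous_on_subset subsetD)

text \<open>A primitive for the Maslov index. Requiring the condition in all charts at
  \<open>p\<close> makes the notion free of choices; \<open>index_funI\<close> reduces its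
  verification to one chart per point.\<close>

definition index_fun :: "'a set \<Rightarrow> ('p::topological_space \<Rightarrow> 'a set) \<Rightarrow> 'p set \<Rightarrow> ('p \<Rightarrow> int) \<Rightarrow> bool" where
  "index_fun L0 l S F \<longleftrightarrow> (\<forall>p\<in>S. \<forall>W. transv W L0 \<longrightarrow> transv W (l p) \<longrightarrow>
     (\<forall>\<^sub>F q in at p within S. F q - int (chart_index L0 W (l q)) = F p - int (chart_index L0 W (l p))))"

lemma index_funD:
  "index_fun L0 l S F \<Longrightarrow> p \<in> S \<Longrightarrow> transv W L0 \<Longrightarrow> transv W (l p) \<Longrightarrow>
     \<forall>\<^sub>F q in at p within S. F q - int (chart_index L0 W (l q)) = F p - int (chart_index L0 W (l p))"
  by (simp add: index_fun_def)

lemma index_funI: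
  assumes c: "cont_lag S l"
    and ex: "\<And>p. p \<in> S \<Longrightarrow> \<exists>W. transv W L0 \<and> transv W (l p) \<and>
     (\<forall>\<^sub>F q in at p within S. F q - int (chart_index L0 W (l q)) = F p - int (chart_index L0 W (l p)))"
  shows "index_fun L0 l S F"
  unfolding index_fun_def
proof (intro ballI allI impI)
  fix p W assume p: "p \<in> S" and W: "transv W L0" "transv W (l p)"
  obtain W' where W': "transv W' L0" "transv W' (l p)"
      and ev: "\<forall>\<^sub>F q in at p within S. F q - int (chart_index L0 W' (l q)) = F p - int (chart_index L0 W' (l p))"
    using ex[OF p] by blast
  from ev chart_index_difference_locally_constant[OF W(1) W'(1) W(2) W'(2) cont_lagD(2,3)[OF c p]]
  show "\<forall>\<^sub>F q in at p within S. F q - int (chart_index L0 W (l q)) = F p - int (chart_index L0 W (l p))"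
    by eventually_elim simp
qed

lemma transv_ex:
  assumes "lagrangian \<omega> L" "lagrangian \<omega> L'"
  obtains W where "transv W L" "transv W L'"
proof -
  obtain W where "lagrangian \<omega> W" "\<And>K. K \<in> {L, L'} \<Longrightarrow> W \<inter> K = {0}"
    using common_transversal[of "{L, L'}"] assms by auto
  with assms show thesis
    by (intro that[of W]) (simp_all add: transv_def)
qed

lemma index_fun_subset:
  assumes "index_fun L0 l S F" "S' \<subseteq> S"
  shows "index_fun L0 l S' F"
  unfolding index_fun_def
  using assms filter_leD[OF at_le[OF assms(2)]] by (auto simp: index_fun_def subset_iff)

text \<open>The chart term cancels in the difference of two index functions, which is therefore
  locally constant.\<close>

lemma index_fun_unique:
  assumes L0: "lagrangian \<omega> L0" and c: "cont_lag S l" and con: "connected S"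
    and F: "index_fun L0 l S F" and G: "index_fun L0 l S G" and pq: "p \<in> S" "q \<in> S"
  shows "F p - G p = F q - G q"
proof (rule connected_local_const[OF con pq], rule ballI)
  fix p assume p: "p \<in> S"
  obtain W where W: "transv W L0" "transv W (l p)"
    using transv_ex[OF L0 cont_lagD(1)[OF c p]] by blast
  from index_funD[OF F p W] index_funD[OF G p W]
  show "\<forall>\<^sub>F q in at p within S. F p - G p = F q - G q"
    by eventually_elim simp
qed

lemma index_fun_add_const: "index_fun L0 l S F \<Longrightarrow> index_fun L0 l S (\<lambda>p. F p + c)"
  by (simp add: index_fun_def algebra_simps)

text \<open>On the connected overlap the two functions differ by a constant; shifting one of them
  makes them agree there.\<close>

lemma index_fun_Un:
  fixes S1 S2 :: "'p::topological_space set"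
  assumes L0: "lagrangian \<omega> L0" and c: "cont_lag (S1 \<union> S2) l"
    and con: "connected (S1 \<inter> S2)" and cl: "closed S1" "closed S2"
    and F: "index_fun L0 l S1 F" and G: "index_fun L0 l S2 G"
  shows "\<exists>H. index_fun L0 l (S1 \<union> S2) H"
proof -
  obtain k where k: "\<And>p. p \<in> S1 \<inter> S2 \<Longrightarrow> F p = G p + k"
  proof (cases "S1 \<inter> S2 = {}")
    case True
    then show ?thesis using that by blast
  next
    case False
    then obtain p0 where p0: "p0 \<in> S1 \<inter> S2" by blast
    have "F p - G p = F p0 - G p0" if "p \<in> S1 \<inter> S2" for p
      by (rule index_fun_unique[OF L0 cont_lag_subset[OF c] con index_fun_subset[OF F]
            index_fun_subset[OF G] that p0]) auto
    then show ?thesis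
      using that[of "F p0 - G p0"] by force
  qed
  define H where "H p = (if p \<in> S1 then F p else G p + k)" for p
  have H1: "H p = F p" if "p \<in> S1" for p
    using that by (simp add: H_def)
  have H2: "H p = G p + k" if "p \<in> S2" for p
    using that k by (simp add: H_def)
  have within: "\<forall>\<^sub>F q in at p within S. q \<in> S" for p and S :: "'p set"
    by (simp add: eventually_at_filter)
  have part: "\<forall>\<^sub>F q in at p within S. H q - int (chart_index L0 W (l q)) = H p - int (chart_index L0 W (l p))"
    if S: "closed S" "index_fun L0 l S G'" "\<And>p. p \<in> S \<Longrightarrow> H p = G' p" and W: "transv W L0" "transv W (l p)"
    for p S G' W
  proof (cases "p \<in> S")
    case True
    show ?thesis
      using index_funD[OF S(2) True W] within
      by eventually_elim (simp add: S(3) True)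
  next
    case False
    \<comment> \<open>Off a closed piece the filter within that piece is trivial, so at each point
      only the pieces through it impose a condition.\<close>
    then have "at p within S = bot"
      using S(1) by (meson closed_limpt trivial_limit_within)
    then show ?thesis by simp
  qed
  have "index_fun L0 l (S1 \<union> S2) H"
    unfolding index_fun_def
    using part[OF cl(1) F H1] part[OF cl(2) index_fun_add_const[OF G] H2]
    by (auto simp: at_within_union eventually_sup)
  then show ?thesis by blast
qed

text \<open>Near \<open>p\<close> a single chart covers the family, and its own index serves. All
  subsets are allowed because the subdivision below works with clipped rectangles.\<close>

lemma index_fun_local:
  fixes S :: "'p::topological_space set"
  assumes L0: "lagrangian \<omega> L0" and c: "cont_lag S l" and p: "p \<in> S"
  shows "\<exists>U. open U \<and> p \<in> U \<and> (\<forall>S'\<subseteq>S \<inter> U. \<exists>F. index_fun L0 l S' F)"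
proof -
  obtain W where W: "transv W L0" "transv W (l p)"
    using transv_ex[OF L0 cont_lagD(1)[OF c p]] by blast
  have "\<forall>\<^sub>F q in at p within S. transv W (l q)"
    by (rule transv_eventually[OF W(2) cont_lagD(2,3)[OF c p]])
  then obtain U where U: "open U" "p \<in> U" "\<And>q. q \<in> U \<Longrightarrow> q \<noteq> p \<Longrightarrow> q \<in> S \<Longrightarrow> transv W (l q)"
    unfolding eventually_at_topological by blast
  have "\<exists>F. index_fun L0 l S' F" if S': "S' \<subseteq> S \<inter> U" for S'
  proof (rule exI[of _ "\<lambda>q. int (chart_index L0 W (l q))"], rule index_funI)
    show "cont_lag S' l"
      using c S' by (auto intro: cont_lag_subset)
    fix q assume "q \<in> S'"
    then have "transv W (l q)"
      using U(3) W(2) S' by (cases "q = p") auto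
    then show "\<exists>W'. transv W' L0 \<and> transv W' (l q) \<and>
      (\<forall>\<^sub>F q' in at q within S'. int (chart_index L0 W (l q')) - int (chart_index L0 W' (l q'))
         = int (chart_index L0 W (l q)) - int (chart_index L0 W' (l q)))"
      using W(1) by (intro exI[of _ W]) simp
  qed
  with U show ?thesis by blast
qed

text \<open>A nested interval induction, one for each coordinate. Adjacent rectangles overlap in an
  edge, which is connected, so they can be glued. Every rectangle is clipped to the given one
  because \<open>Bolzano\<close> also asks about intervals that stick out.\<close>

lemma index_fun_rectangle:
  fixes l :: "real \<times> real \<Rightarrow> 'a set"
  assumes L0: "lagrangian \<omega> L0" and c: "cont_lag ({a..b} \<times> {c..d}) l" and "a \<le> b" "c \<le> d"
  shows "\<exists>F. index_fun L0 l ({a..b} \<times> {c..d}) F"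
proof -
  define R where "R s1 s2 t1 t2 = ({s1..s2} \<inter> {a..b}) \<times> ({t1..t2} \<inter> {c..d})" for s1 s2 t1 t2 :: real
  define Ex where "Ex s1 s2 t1 t2 \<longleftrightarrow> (\<exists>F. index_fun L0 l (R s1 s2 t1 t2) F)" for s1 s2 t1 t2
  have Rsub: "R s1 s2 t1 t2 \<subseteq> {a..b} \<times> {c..d}" for s1 s2 t1 t2
    by (auto simp: R_def)
  have cl: "closed (R s1 s2 t1 t2)" for s1 s2 t1 t2
    unfolding R_def by (intro closed_Times closed_Int closed_atLeastAtMost)
  have con: "connected (R s1 s2 t1 t2)" for s1 s2 t1 t2
    unfolding R_def
    by (intro convex_connected convex_Times convex_Int convex_real_interval)
  have merge: "\<exists>F. index_fun L0 l S F" if "S1 \<union> S2 = S" "S1 \<inter> S2 = R ua ub va vb"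
      "\<exists>F. index_fun L0 l S1 F" "\<exists>F. index_fun L0 l S2 F" "closed S1" "closed S2" "S \<subseteq> {a..b} \<times> {c..d}"
    for S1 S2 S ua ub va vb
  proof -
    from that(3,4) obtain F G where "index_fun L0 l S1 F" "index_fun L0 l S2 G"
      by blast
    then show ?thesis
      using index_fun_Un[OF L0, of S1 S2 l] that con cont_lag_subset[OF c] by metis
  qed
  have "Ex a b c d"
    using \<open>a \<le> b\<close>
  proof (induction a b rule: Bolzano)
    case (trans s1 s2 s3)
    show ?case
      using trans(1,2) unfolding Ex_def
      by (rule merge[of "R s1 s2 c d" "R s2 s3 c d" "R s1 s3 c d" s2 s2 c d, rotated 2])
        (rule cl, rule cl, rule Rsub, use trans(3,4) in \<open>auto simp: R_def\<close>)
  next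
    case (local s)
    \<comment> \<open>The inner induction makes the width \<open>e\<close> uniform along the whole
      strip over \<open>s\<close>.\<close>
    have "\<exists>e>0. \<forall>s1 s2. s1 \<le> s \<and> s \<le> s2 \<and> s2 - s1 < e \<longrightarrow> Ex s1 s2 c d"
      using \<open>c \<le> d\<close>
    proof (induction c d rule: Bolzano)
      case (trans t1 t2 t3)
      obtain e1 where e1: "e1 > 0" "\<And>s1 s2. s1 \<le> s \<and> s \<le> s2 \<and> s2 - s1 < e1 \<Longrightarrow> Ex s1 s2 t1 t2"
        using trans(1) by blast
      obtain e2 where e2: "e2 > 0" "\<And>s1 s2. s1 \<le> s \<and> s \<le> s2 \<and> s2 - s1 < e2 \<Longrightarrow> Ex s1 s2 t2 t3"
        using trans(2) by blast
      have "Ex s1 s2 t1 t3" if "s1 \<le> s \<and> s \<le> s2 \<and> s2 - s1 < min e1 e2" for s1 s2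
      proof -
        have "Ex s1 s2 t1 t2" "Ex s1 s2 t2 t3"
          using e1(2)[of s1 s2] e2(2)[of s1 s2] that by auto
        then show ?thesis
          unfolding Ex_def
          by (rule merge[of "R s1 s2 t1 t2" "R s1 s2 t2 t3" "R s1 s2 t1 t3" s1 s2 t2 t2, rotated 2])
            (rule cl, rule cl, rule Rsub, use trans(3,4) in \<open>auto simp: R_def\<close>)
      qed
      then show ?case
        using e1(1) e2(1) by (intro exI[of _ "min e1 e2"]) auto
    next
      case (local t)
      have "(s, t) \<in> {a..b} \<times> {c..d}"
        using local \<open>a \<le> s\<close> \<open>s \<le> b\<close> by auto
      from index_fun_local[OF L0 c this]
      obtain U where U: "open U" "(s, t) \<in> U"
          "\<And>S'. S' \<subseteq> {a..b} \<times> {c..d} \<inter> U \<Longrightarrow> \<exists>F. index_fun L0 l S' F"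
        by blast
      obtain A B where AB: "open A" "open B" "s \<in> A" "t \<in> B" "A \<times> B \<subseteq> U"
        using U(1,2) by (metis open_prod_elim mem_Times_iff fst_conv snd_conv)
      obtain e1 where e1: "e1 > 0" "ball s e1 \<subseteq> A"
        using AB by (meson openE)
      obtain e2 where e2: "e2 > 0" "ball t e2 \<subseteq> B"
        using AB by (meson openE)
      have "Ex s1 s2 t1 t2" if "s1 \<le> s" "s \<le> s2" "s2 - s1 < e1" "t1 \<le> t" "t \<le> t2" "t2 - t1 < e2"
        for s1 s2 t1 t2
        unfolding Ex_def
      proof (rule U(3))
        have "{s1..s2} \<subseteq> ball s e1" "{t1..t2} \<subseteq> ball t e2"
          using that by (auto simp: dist_real_def)
        then have "{s1..s2} \<times> {t1..t2} \<subseteq> U"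
          using AB(5) e1(2) e2(2) by blast
        then show "R s1 s2 t1 t2 \<subseteq> {a..b} \<times> {c..d} \<inter> U"
          by (auto simp: R_def)
      qed
      then show ?case
        using e1(1) e2(1) by (intro exI[of _ e2]) blast
    qed
    then show ?case .
  qed
  then show ?thesis
    by (simp add: Ex_def R_def)
qed

section \<open>Regular crossings\<close>

lemma lag_path_cont_lag: "lag_path \<omega> l a b \<longleftrightarrow> cont_lag {a..b} l"
  by (simp add: lag_path_def cont_lag_def)

lemma at_within_interval_nontrivial:
  fixes a b t :: real
  assumes "a < b" "t \<in> {a..b}"
  shows "at t within {a..b} \<noteq> bot"
  using assms by (simp add: trivial_limit_within islimpt_Icc)

text \<open>\<open>C1_lag_path\<close> supplies a derivative for each vector separately; combining
  those of the basis vectors yields one that is linear in \<open>x\<close>.\<close>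

lemma proj_derivative_linear:
  fixes l :: "real \<Rightarrow> 'a set"
  assumes sub: "t0 \<in> S" "\<And>t. t \<in> S \<Longrightarrow> subspace (l t)"
    and ex: "\<And>x. \<exists>d. ((\<lambda>t. proj (l t) x) has_vector_derivative d) (at t0 within S)"
  obtains D where "linear D" "\<And>x. ((\<lambda>t. proj (l t) x) has_vector_derivative D x) (at t0 within S)"
proof -
  obtain d where d: "\<And>x. ((\<lambda>t. proj (l t) x) has_vector_derivative d x) (at t0 within S)"
    using ex by metis
  define D where "D x = (\<Sum>b\<in>Basis. (x \<bullet> b) *\<^sub>R d b)" for x
  have "linear D"
    unfolding D_def
    by (rule linearI)
      (simp_all add: inner_add_left scaleR_add_left sum.distrib scaleR_sum_right)
  moreover have "((\<lambda>t. proj (l t) x) has_vector_derivative D x) (at t0 within S)" for x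
  proof -
    let ?s = "\<lambda>t. \<Sum>b\<in>Basis. (x \<bullet> b) *\<^sub>R proj (l t) b"
    have "(?s has_vector_derivative D x) (at t0 within S)"
      unfolding D_def
      by (intro has_vector_derivative_sum bounded_linear.has_vector_derivative[OF bounded_linear_scaleR_right] d)
    moreover have "proj (l t) x = ?s t" if "t \<in> S" for t
    proof -
      note lin = linear_proj[OF sub(2)[OF that]]
      have "proj (l t) x = proj (l t) (\<Sum>b\<in>Basis. (x \<bullet> b) *\<^sub>R b)"
        by (simp add: euclidean_representation)
      then show ?thesis
        by (simp only: linear_sum[OF lin] linear_cmul[OF lin])
    qed
    ultimately show ?thesis
      by (rule has_vector_derivative_transform[OF sub(1), rotated])
  qed
  ultimately show thesis
    using that by blast
qed

text \<open>The definition picks a transversal by \<open>SOME\<close>, and the value does not depend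
  on it: since \<open>l t\<close> is isotropic, the functions for two choices differ by
  \<open>\<omega> (gr W (l t) v) (gr W0 (l t) v)\<close>. Both arguments vanish at
  \<open>t0\<close>, so this difference has derivative zero there.\<close>

lemma crossing_form_eq:
  fixes l :: "real \<Rightarrow> 'a set"
  assumes c: "cont_lag {a..b} l" and ab: "a < b" and t0: "t0 \<in> {a..b}"
    and ex: "\<And>x. \<exists>d. ((\<lambda>t. proj (l t) x) has_vector_derivative d) (at t0 within {a..b})"
    and T: "transv W (l t0)" and v: "v \<in> l t0"
    and der: "((\<lambda>t. gr W (l t) v) has_vector_derivative e) (at t0 within {a..b})"
  shows "crossing_form \<omega> l a b t0 v = \<omega> v e"
proof -
  let ?Fl = "at t0 within {a..b}"
  have nt: "?Fl \<noteq> bot"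
    by (rule at_within_interval_nontrivial[OF ab t0])
  define W0 where "W0 = (SOME W. lagrangian \<omega> W \<and> W \<inter> l t0 = {0})"
  have L: "lagrangian \<omega> (l t0)"
    by (rule transvD(2)[OF T])
  have "\<exists>W. lagrangian \<omega> W \<and> W \<inter> l t0 = {0}"
    using T by (auto simp: transv_def)
  then have "lagrangian \<omega> W0 \<and> W0 \<inter> l t0 = {0}"
    unfolding W0_def by (rule someI_ex)
  then have T0: "transv W0 (l t0)"
    using L by (simp add: transv_def)
  obtain D where D: "linear D" "\<And>x. ((\<lambda>t. proj (l t) x) has_vector_derivative D x) ?Fl"
    using proj_derivative_linear[OF t0 lagrangianD(1)[OF cont_lagD(1)[OF c]] ex] by blast
  obtain e0 where e0: "((\<lambda>t. gr W0 (l t) v) has_vector_derivative e0) ?Fl"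
    using gr_derivative[OF T0 cont_lagD(2)[OF c t0] D(2)] by blast
  have bl: "bounded_linear (\<omega> v)"
    using bilinear_omega by (simp add: bilinear_def linear_conv_bounded_linear)
  have der0: "((\<lambda>t. \<omega> v (gr W0 (l t) v)) has_real_derivative \<omega> v e0) ?Fl"
    using bounded_linear.has_vector_derivative[OF bl e0]
    by (simp add: has_real_derivative_iff_has_vector_derivative)
  have "d = \<omega> v e0" if "((\<lambda>t. \<omega> v (gr W0 (l t) v)) has_real_derivative d) ?Fl" for d
    using tendsto_unique[OF nt that[unfolded has_field_derivative_iff] der0[unfolded has_field_derivative_iff]] .
  then have "(SOME d. ((\<lambda>t. \<omega> v (gr W0 (l t) v)) has_real_derivative d) ?Fl) = \<omega> v e0"
    by (rule some_equality[where P = "\<lambda>d. ((\<lambda>t. \<omega> v (gr W0 (l t) v)) has_real_derivative d) ?Fl", OF der0])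
  then have cf: "crossing_form \<omega> l a b t0 v = \<omega> v e0"
    by (simp add: crossing_form_def Let_def W0_def gr_def)
  have g0: "gr W (l t0) v = 0" "gr W0 (l t0) v = 0"
    using gr_eq_0[OF T v] gr_eq_0[OF T0 v] by auto
  have q: "((\<lambda>t. gr W (l t) v /\<^sub>R (t - t0)) \<longlongrightarrow> e) ?Fl" "((\<lambda>t. gr W0 (l t) v /\<^sub>R (t - t0)) \<longlongrightarrow> e0) ?Fl"
    using der e0 unfolding has_vector_derivative_iff_quotient by (simp_all add: g0)
  have lhs: "((\<lambda>t. \<omega> v (gr W (l t) v /\<^sub>R (t - t0)) - \<omega> v (gr W0 (l t) v /\<^sub>R (t - t0))) \<longlongrightarrow> \<omega> v e - \<omega> v e0) ?Fl"
    by (intro tendsto_intros tendsto_om q)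
  have rhs: "((\<lambda>t. \<omega> (gr W (l t) v) (gr W0 (l t) v /\<^sub>R (t - t0))) \<longlongrightarrow> \<omega> (gr W (l t0) v) e0) ?Fl"
    by (intro tendsto_om q gr_tendsto[OF T cont_lagD(2,3)[OF c t0]])
  have eq: "\<forall>\<^sub>F t in ?Fl. \<omega> v (gr W (l t) v /\<^sub>R (t - t0)) - \<omega> v (gr W0 (l t) v /\<^sub>R (t - t0))
      = \<omega> (gr W (l t) v) (gr W0 (l t) v /\<^sub>R (t - t0))"
    using transv_eventually[OF T cont_lagD(2,3)[OF c t0]] transv_eventually[OF T0 cont_lagD(2,3)[OF c t0]]
  proof eventually_elim
    case (elim t)
    have "\<omega> (v + gr W (l t) v) (v + gr W0 (l t) v) = 0"
      using gr_mem(2)[OF elim(1)] gr_mem(2)[OF elim(2)] lagrangianD(3)[OF transvD(2)[OF elim(1)]] by blast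
    then have "\<omega> v (gr W (l t) v) - \<omega> v (gr W0 (l t) v) = \<omega> (gr W (l t) v) (gr W0 (l t) v)"
      using om_skew[of v "gr W (l t) v"] by (simp add: om)
    then show ?case
      by (simp add: om flip: right_diff_distrib)
  qed
  have "\<omega> v e - \<omega> v e0 = \<omega> (gr W (l t0) v) e0"
    by (rule tendsto_unique[OF nt Lim_transform_eventually[OF lhs eq] rhs])
  then show ?thesis
    using cf g0 by (simp add: om)
qed

text \<open>Near \<open>t0\<close> the chart form is \<open>B0 + (t - t0) * C t\<close>, where the
  radical of \<open>B0\<close> is the crossing space and \<open>C t\<close> tends to the crossing
  form on it. The perturbation lemma is used with \<open>h = t - t0\<close> to the right, and with
  \<open>h = t0 - t\<close> and \<open>- C\<close> to the left, which turns \<open>n_plus\<close>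
  into \<open>n_minus\<close>.\<close>

lemma regular_crossing_jump:
  fixes l :: "real \<Rightarrow> 'a set"
  assumes L0: "lagrangian \<omega> L0" and c: "cont_lag {a..b} l" and ab: "a < b" and t0: "t0 \<in> {a..b}"
    and ex: "\<And>x. \<exists>d. ((\<lambda>t. proj (l t) x) has_vector_derivative d) (at t0 within {a..b})"
    and reg: "crossing l L0 t0 \<longrightarrow> nondegenerate_on (crossing_form \<omega> l a b t0) (l t0 \<inter> L0)"
    and T: "transv W (l t0)" and T0: "transv W L0"
  shows "\<forall>\<^sub>F t in at t0 within ({a..b} \<inter> {t0<..}).
      chart_index L0 W (l t) = chart_index L0 W (l t0) + n_plus (crossing_form \<omega> l a b t0) (l t0 \<inter> L0)
      \<and> \<not> crossing l L0 t"
    and "\<forall>\<^sub>F t in at t0 within ({a..b} \<inter> {..<t0}).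
      chart_index L0 W (l t) = chart_index L0 W (l t0) + n_minus (crossing_form \<omega> l a b t0) (l t0 \<inter> L0)
      \<and> \<not> crossing l L0 t"
proof -
  let ?Fl = "at t0 within {a..b}" and ?K = "l t0 \<inter> L0"
  have nt: "?Fl \<noteq> bot"
    by (rule at_within_interval_nontrivial[OF ab t0])
  obtain D where D: "linear D" "\<And>x. ((\<lambda>t. proj (l t) x) has_vector_derivative D x) ?Fl"
    using proj_derivative_linear[OF t0 lagrangianD(1)[OF cont_lagD(1)[OF c]] ex] by blast
  define E where "E v = - gr W (l t0) (D (v + gr W (l t0) v))" for v
  have E: "((\<lambda>t. gr W (l t) v) has_vector_derivative E v) ?Fl" for v
    unfolding E_def by (rule gr_derivative[OF T cont_lagD(2)[OF c t0] D(2)])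
  define B0 where "B0 = (\<lambda>u v. \<omega> u (gr W (l t0) v))"
  define C where "C = (\<lambda>t u v. \<omega> u ((gr W (l t) v - gr W (l t0) v) /\<^sub>R (t - t0)))"
  define C0 where "C0 = (\<lambda>u v. \<omega> u (E v))"
  note tr = transv_eventually[OF T cont_lagD(2,3)[OF c t0]]
  have B0: "bilinear B0"
    unfolding B0_def by (rule bilinear_gr[OF T])
  have C0: "bilinear C0"
    unfolding C0_def E_def
    by (rule bilinearI_real)
      (simp_all add: om gr_simps[OF T] linear_add[OF D(1)] linear_cmul[OF D(1)] algebra_simps)
  have bilC: "\<forall>\<^sub>F t in ?Fl. bilinear (C t)"
    using tr
  proof eventually_elim
    case (elim t)
    show ?case
      unfolding C_def
      by (rule bilinearI_real) (simp_all add: om gr_simps[OF T] gr_simps[OF elim] algebra_simps)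
  qed
  have limC: "((\<lambda>t. C t u v) \<longlongrightarrow> C0 u v) ?Fl" for u v
    unfolding C_def C0_def
    by (intro tendsto_om tendsto_const E[unfolded has_vector_derivative_iff_quotient])
  have sym0: "B0 u v = B0 v u" if "u \<in> L0" "v \<in> L0" for u v
    unfolding B0_def by (rule gr_symmetric[OF T L0 that])
  have symC: "\<forall>\<^sub>F t in ?Fl. \<forall>u\<in>L0. \<forall>v\<in>L0. C t u v = C t v u"
    using tr
  proof eventually_elim
    case (elim t)
    show ?case
      using gr_symmetric[OF T L0] gr_symmetric[OF elim L0] by (simp add: C_def om)
  qed
  have symC0: "C0 u v = C0 v u" if "u \<in> L0" "v \<in> L0" for u v
  proof (rule tendsto_unique[OF nt limC])
    have "\<forall>\<^sub>F t in ?Fl. C t v u = C t u v"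
      using symC by eventually_elim (use that in blast)
    then show "((\<lambda>t. C t u v) \<longlongrightarrow> C0 v u) ?Fl"
      by (rule Lim_transform_eventually[OF limC])
  qed
  have rad: "form_radical B0 L0 = ?K"
    unfolding B0_def by (rule chart_radical[OF T T0])
  have subL0: "subspace L0" and subK: "subspace ?K"
    using lagrangianD(1)[OF L0] lagrangianD(1)[OF transvD(2)[OF T]] by (auto intro: subspace_inter)
  have \<Gamma>: "crossing_form \<omega> l a b t0 v = C0 v v" if "v \<in> ?K" for v
    unfolding C0_def by (rule crossing_form_eq[OF c ab t0 ex T _ E]) (use that in auto)
  \<comment> \<open>The polar form of the crossing form is \<open>C0\<close>, which is symmetric as
    a limit of symmetric forms; so regularity of the crossing says that \<open>C0\<close> has no
    radical there.\<close>
  have nondeg: "form_radical C0 ?K = {0}"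
  proof (cases "crossing l L0 t0")
    case True
    have "u = 0" if u: "u \<in> form_radical C0 ?K" for u
    proof -
      have uK: "u \<in> ?K"
        using u by (simp add: form_radical_def)
      have "polar (crossing_form \<omega> l a b t0) u v = 0" if v: "v \<in> ?K" for v
      proof -
        have "u + v \<in> ?K"
          using uK v subK by (rule subspace_add[rotated])
        then have "polar (crossing_form \<omega> l a b t0) u v = (C0 u v + C0 v u) / 2"
          unfolding polar_def by (simp only: \<Gamma>[OF uK] \<Gamma>[OF v] \<Gamma>[of "u + v"] bilinear_forms[OF C0]) simp
        also have "\<dots> = C0 v u"
          using symC0[of u v] uK v by simp
        also have "\<dots> = 0"
          using u v by (simp add: form_radical_def)
        finally show ?thesis .
      qed
      then show "u = 0"
        using reg True uK unfolding nondegenerate_on_def by blast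
    qed
    then show ?thesis
      using subspace_0[OF subspace_form_radical[OF C0 subK]] by blast
  next
    case False
    then have "?K = {0}"
      by (simp add: crossing_def)
    then show ?thesis
      by (auto simp: form_radical_def bilinear_forms[OF C0])
  qed
  have noncross: "\<not> crossing l L0 t" if "transv W (l t)" "form_radical (\<lambda>u v. \<omega> u (gr W (l t) v)) L0 = {0}" for t
    using chart_radical[OF that(1) T0] that(2) by (simp add: crossing_def)
  have split: "B0 u v + (t - t0) * C t u v = \<omega> u (gr W (l t) v)" if "t \<noteq> t0" for t u v
    using that by (simp add: B0_def C_def om mult.assoc[symmetric])
  have ne: "\<forall>\<^sub>F t in ?Fl. t \<noteq> t0"
    by (simp add: eventually_at_filter)
  have t_lim: "((\<lambda>t. t - t0) \<longlongrightarrow> 0) ?Fl"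
    using tendsto_diff[OF tendsto_ident_at tendsto_const, of t0 t0 "{a..b}"] by simp
  show "\<forall>\<^sub>F t in at t0 within ({a..b} \<inter> {t0<..}).
      chart_index L0 W (l t) = chart_index L0 W (l t0) + n_plus (crossing_form \<omega> l a b t0) ?K
      \<and> \<not> crossing l L0 t"
  proof -
    let ?F = "at t0 within ({a..b} \<inter> {t0<..})"
    have le: "?F \<le> ?Fl"
      by (rule at_le) auto
    have "\<forall>\<^sub>F t in ?F. t - t0 > 0"
      by (simp add: eventually_at_filter)
    from n_plus_perturb_nondegenerate[OF filter_leD[OF le bilC] B0 C0 tendsto_mono[OF le limC] this
        tendsto_mono[OF le t_lim] subL0 sym0 filter_leD[OF le symC]]
    have "\<forall>\<^sub>F t in ?F. n_plus (\<lambda>v. B0 v v + (t - t0) * C t v v) L0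
        = n_plus (\<lambda>v. B0 v v) L0 + n_plus (\<lambda>v. C0 v v) ?K
        \<and> form_radical (\<lambda>u v. B0 u v + (t - t0) * C t u v) L0 = {0}"
      using symC0 nondeg unfolding rad by blast
    with filter_leD[OF le tr] filter_leD[OF le ne] show ?thesis
    proof eventually_elim
      case (elim t)
      then show ?case
        using noncross[OF elim(1)] n_plus_cong[of ?K "crossing_form \<omega> l a b t0" "\<lambda>v. C0 v v", OF \<Gamma>]
        unfolding split[OF elim(2)] unfolding chart_index_def B0_def by simp
    qed
  qed
  show "\<forall>\<^sub>F t in at t0 within ({a..b} \<inter> {..<t0}).
      chart_index L0 W (l t) = chart_index L0 W (l t0) + n_minus (crossing_form \<omega> l a b t0) ?K
      \<and> \<not> crossing l L0 t"
  proof -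
    let ?F = "at t0 within ({a..b} \<inter> {..<t0})"
    have le: "?F \<le> ?Fl"
      by (rule at_le) auto
    have hpos: "\<forall>\<^sub>F t in ?F. t0 - t > 0"
      by (simp add: eventually_at_filter)
    have hlim: "((\<lambda>t. t0 - t) \<longlongrightarrow> 0) ?F"
      using tendsto_minus[OF tendsto_mono[OF le t_lim]] by simp
    have bilC': "\<forall>\<^sub>F t in ?F. bilinear (\<lambda>u v. - C t u v)"
      using filter_leD[OF le bilC]
    proof eventually_elim
      case (elim t)
      show ?case
        by (rule bilinearI_real) (simp_all add: bilinear_forms[OF elim])
    qed
    have C0': "bilinear (\<lambda>u v. - C0 u v)"
      by (rule bilinearI_real) (simp_all add: bilinear_forms[OF C0])
    have nondeg': "form_radical (\<lambda>u v. - C0 u v) ?K = {0}"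
      using nondeg by (simp add: form_radical_def)
    have symC': "\<forall>\<^sub>F t in ?F. \<forall>u\<in>L0. \<forall>v\<in>L0. - C t u v = - C t v u"
      using filter_leD[OF le symC] by eventually_elim simp
    from n_plus_perturb_nondegenerate[OF bilC' B0 C0' tendsto_minus[OF tendsto_mono[OF le limC]] hpos
        hlim subL0 sym0 symC']
    have "\<forall>\<^sub>F t in ?F. n_plus (\<lambda>v. B0 v v + (t0 - t) * - C t v v) L0
        = n_plus (\<lambda>v. B0 v v) L0 + n_plus (\<lambda>v. - C0 v v) ?K
        \<and> form_radical (\<lambda>u v. B0 u v + (t0 - t) * - C t u v) L0 = {0}"
      using symC0 nondeg' unfolding rad by fastforce
    with filter_leD[OF le tr] filter_leD[OF le ne] show ?thesis
    proof eventually_elim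
      case (elim t)
      have split': "B0 u v + (t0 - t) * - C t u v = \<omega> u (gr W (l t) v)" for u v
        using split[OF elim(2), of u v] by (simp add: algebra_simps)
      have "n_minus (crossing_form \<omega> l a b t0) ?K = n_plus (\<lambda>v. - C0 v v) ?K"
        unfolding n_minus_eq_n_plus by (rule n_plus_cong) (simp add: \<Gamma>)
      then show ?case
        using noncross[OF elim(1)] elim(3)
        unfolding split' unfolding chart_index_def B0_def by simp
    qed
  qed
qed

text \<open>\<open>F\<close> gains \<open>np\<close> on leaving a point and loses \<open>nm\<close>
  on arriving at one, and both numbers vanish off the crossings. An interior crossing thus
  contributes its signature, and each end point only one of the two terms, as in
  \<open>crossing_sum\<close>.\<close>

lemma crossing_sum_eq_index_difference:
  assumes L0: "lagrangian \<omega> L0" and reg: "regular_path \<omega> L0 l a b" and ab: "a < b"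
    and F: "index_fun L0 l {a..b} F"
  shows "crossing_sum \<omega> L0 l a b = F b - F a"
proof -
  have c: "cont_lag {a..b} l"
    using reg by (simp add: regular_path_def C1_lag_path_def lag_path_cont_lag)
  have ex: "\<exists>d. ((\<lambda>t. proj (l t) x) has_vector_derivative d) (at t0 within {a..b})" if "t0 \<in> {a..b}" for x t0
    using reg that unfolding regular_path_def C1_lag_path_def by blast
  define np nm where "np t = int (n_plus (crossing_form \<omega> l a b t) (l t \<inter> L0))"
    and "nm t = int (n_minus (crossing_form \<omega> l a b t) (l t \<inter> L0))" for t
  have zero: "np t = 0" "nm t = 0" if "\<not> crossing l L0 t" for t
    using that by (simp_all add: np_def nm_def crossing_def n_minus_eq_n_plus n_plus_trivial)
  define X where "X c d = {t. c < t \<and> t < d \<and> crossing l L0 t}" for c d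
  have jump: "\<exists>e>0. \<forall>t\<in>{a..b}. \<bar>t - x\<bar> < e \<longrightarrow>
      (x < t \<longrightarrow> F t - F x = np x \<and> \<not> crossing l L0 t) \<and> (t < x \<longrightarrow> F t - F x = nm x \<and> \<not> crossing l L0 t)"
    if x: "x \<in> {a..b}" for x
  proof -
    obtain W where W: "transv W L0" "transv W (l x)"
      using transv_ex[OF L0 cont_lagD(1)[OF c x]] by blast
    have nd: "crossing l L0 x \<longrightarrow> nondegenerate_on (crossing_form \<omega> l a b x) (l x \<inter> L0)"
      using reg x by (simp add: regular_path_def)
    note J = regular_crossing_jump[OF L0 c ab x ex[OF x] nd W(2,1)]
    note FD = index_funD[OF F x W]
    have 1: "\<forall>\<^sub>F t in at x within ({a..b} \<inter> {x<..}). F t - F x = np x \<and> \<not> crossing l L0 t"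
      using J(1) filter_leD[OF at_le[OF Int_lower1] FD]
      by eventually_elim (auto simp: np_def)
    have 2: "\<forall>\<^sub>F t in at x within ({a..b} \<inter> {..<x}). F t - F x = nm x \<and> \<not> crossing l L0 t"
      using J(2) filter_leD[OF at_le[OF Int_lower1] FD]
      by eventually_elim (auto simp: nm_def)
    obtain e1 where e1: "e1 > 0" "\<And>t. t \<in> {a..b} \<Longrightarrow> x < t \<Longrightarrow> \<bar>t - x\<bar> < e1 \<Longrightarrow> F t - F x = np x \<and> \<not> crossing l L0 t"
      using 1 unfolding eventually_at dist_real_def by auto
    obtain e2 where e2: "e2 > 0" "\<And>t. t \<in> {a..b} \<Longrightarrow> t < x \<Longrightarrow> \<bar>t - x\<bar> < e2 \<Longrightarrow> F t - F x = nm x \<and> \<not> crossing l L0 t"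
      using 2 unfolding eventually_at dist_real_def by auto
    show ?thesis
      using e1 e2 by (intro exI[of _ "min e1 e2"]) auto
  qed
  \<comment> \<open>Finiteness of the crossing set is carried along. The premise voids the claim for
    degenerate intervals and for those that leave \<open>[a,b]\<close>.\<close>
  define P where "P c d \<longleftrightarrow> (c < d \<and> a \<le> c \<and> d \<le> b \<longrightarrow>
      finite (X c d) \<and> F d - F c = np c + (\<Sum>t\<in>X c d. np t - nm t) - nm d)" for c d
  have "P a b"
    using less_imp_le[OF ab]
  proof (induction a b rule: Bolzano)
    case (trans c d e)
    show ?case
    proof (cases "c < d \<and> d < e \<and> a \<le> c \<and> e \<le> b")
      case True
      then have fin: "finite (X c d)" "finite (X d e)"
        and eq: "F d - F c = np c + (\<Sum>t\<in>X c d. np t - nm t) - nm d"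
          "F e - F d = np d + (\<Sum>t\<in>X d e. np t - nm t) - nm e"
        using trans(1,2) by (auto simp: P_def)
      \<comment> \<open>The joint \<open>d\<close> turns from an end point of both halves into an
        interior point; its contributions \<open>- nm d\<close> and \<open>np d\<close> merge into
        the signature, or are both zero if \<open>d\<close> is no crossing.\<close>
      have X: "X c e = X c d \<union> X d e \<union> {t\<in>{d}. crossing l L0 t}"
        using True by (auto simp: X_def)
      have dsum: "(\<Sum>t\<in>{t\<in>{d}. crossing l L0 t}. np t - nm t) = np d - nm d"
      proof (cases "crossing l L0 d")
        case True
        then have "{t\<in>{d}. crossing l L0 t} = {d}" by auto
        then show ?thesis by simp
      next
        case False
        then have "{t\<in>{d}. crossing l L0 t} = {}" by auto
        then show ?thesis using zero[OF False] by simp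
      qed
      have "(\<Sum>t\<in>X c e. np t - nm t) = (\<Sum>t\<in>X c d. np t - nm t) + (\<Sum>t\<in>X d e. np t - nm t) + (np d - nm d)"
        unfolding X dsum[symmetric]
        by (subst sum.union_disjoint; (subst sum.union_disjoint)?) (use fin in \<open>auto simp: X_def\<close>)
      then show ?thesis
        using fin eq unfolding P_def X by auto
    next
      case False
      then show ?thesis
        using trans by (cases "c = d"; cases "d = e") (auto simp: P_def)
    qed
  next
    case (local x)
    then have "x \<in> {a..b}" by simp
    from jump[OF this] obtain e where e: "e > 0"
      and R: "\<And>t. t \<in> {a..b} \<Longrightarrow> \<bar>t - x\<bar> < e \<Longrightarrow> x < t \<Longrightarrow> F t - F x = np x \<and> \<not> crossing l L0 t"
      and L: "\<And>t. t \<in> {a..b} \<Longrightarrow> \<bar>t - x\<bar> < e \<Longrightarrow> t < x \<Longrightarrow> F t - F x = nm x \<and> \<not> crossing l L0 t"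
      by blast
    have "P c d" if cd: "c \<le> x" "x \<le> d" "d - c < e" for c d
      unfolding P_def
    proof (intro impI)
      assume *: "c < d \<and> a \<le> c \<and> d \<le> b"
      have nc: "\<not> crossing l L0 t" if "c \<le> t" "t \<le> d" "t \<noteq> x" for t
        using R[of t] L[of t] that cd * by (cases "x < t") auto
      have Xs: "X c d \<subseteq> {x}"
        unfolding X_def using nc less_imp_le by blast
      have fin: "finite (X c d)"
        using Xs by (rule finite_subset) simp
      consider "c = x" | "d = x" "c < x" | "c < x" "x < d"
        using cd by linarith
      then show "finite (X c d) \<and> F d - F c = np c + (\<Sum>t\<in>X c d. np t - nm t) - nm d"
      proof cases
        case 1
        then have "X c d = {}"
          using Xs by (auto simp: X_def)
        then show ?thesis
          using 1 R[of d] cd * zero(2)[OF nc[of d]] by auto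
      next
        case 2
        then have "X c d = {}"
          using Xs by (auto simp: X_def)
        then show ?thesis
          using 2 L[of c] cd * zero(1)[OF nc[of c]] by auto
      next
        case 3
        have F: "F d - F c = np x - nm x"
          using R[of d] L[of c] 3 cd * by auto
        have "(\<Sum>t\<in>X c d. np t - nm t) = np x - nm x"
        proof (cases "crossing l L0 x")
          case True
          then have "X c d = {x}"
            using Xs 3 by (auto simp: X_def)
          then show ?thesis by simp
        next
          case False
          then have "X c d = {}"
            using Xs 3 by (auto simp: X_def)
          then show ?thesis
            using zero[OF False] by simp
        qed
        then show ?thesis
          using fin F zero(1)[OF nc[of c]] zero(2)[OF nc[of d]] 3 by auto
      qed
    qed
    then show ?case
      using e by blast
  qed
  then have "F b - F a = np a + (\<Sum>t\<in>X a b. np t - nm t) - nm b"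
    using ab by (simp add: P_def)
  then show ?thesis
    by (simp add: crossing_sum_def X_def np_def nm_def signature_def)
qed

end

section \<open>Moving a subspace by a family of linear maps\<close>

lemma linear_inv:
  fixes f :: "'a::real_vector \<Rightarrow> 'a"
  assumes f: "linear f" and bij: "bij f"
  shows "linear (inv f)"
proof (rule linearI)
  have s: "f (inv f x) = x" for x
    using bij by (simp add: bij_is_surj surj_f_inv_f)
  have i: "inv f y = x" if "f x = y" for x y
    using bij that by (simp add: bij_is_inj inv_f_eq)
  show "inv f (x + y) = inv f x + inv f y" for x y
    by (rule i) (simp add: linear_add[OF f] s)
  show "inv f (c *\<^sub>R x) = c *\<^sub>R inv f x" for c x
    by (rule i) (simp add: linear_cmul[OF f] s)
qed

lemma linear_expand:
  fixes f :: "'a::euclidean_space \<Rightarrow> 'b::real_vector"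
  assumes "linear f"
  shows "f x = (\<Sum>b\<in>Basis. (x \<bullet> b) *\<^sub>R f b)"
proof -
  have "f x = f (\<Sum>b\<in>Basis. (x \<bullet> b) *\<^sub>R b)"
    by (simp add: euclidean_representation)
  then show ?thesis
    by (simp only: linear_sum[OF assms] linear_cmul[OF assms])
qed

lemma adjoint_expand:
  fixes f :: "'a::euclidean_space \<Rightarrow> 'a"
  assumes "linear f"
  shows "adjoint f z = (\<Sum>b\<in>Basis. (f b \<bullet> z) *\<^sub>R b)"
proof -
  have "adjoint f z \<bullet> b = f b \<bullet> z" for b
    using adjoint_works[OF assms, of b z] by (simp add: inner_commute)
  then show ?thesis
    using euclidean_representation[of "adjoint f z"] by simp
qed

text \<open>Expanding the moving argument in the basis makes pointwise convergence of the operators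
  sufficient.\<close>

lemma operator_tendsto:
  fixes G :: "'q \<Rightarrow> 'a::euclidean_space \<Rightarrow> 'b::real_normed_vector"
  assumes lin: "\<forall>\<^sub>F q in Fl. linear (G q)" "linear G0"
    and lim: "\<And>x. ((\<lambda>q. G q x) \<longlongrightarrow> G0 x) Fl" and y: "(y \<longlongrightarrow> y0) Fl"
  shows "((\<lambda>q. G q (y q)) \<longlongrightarrow> G0 y0) Fl"
proof -
  have "((\<lambda>q. \<Sum>b\<in>Basis. (y q \<bullet> b) *\<^sub>R G q b) \<longlongrightarrow> (\<Sum>b\<in>Basis. (y0 \<bullet> b) *\<^sub>R G0 b)) Fl"
    by (intro tendsto_intros y lim)
  moreover have "\<forall>\<^sub>F q in Fl. (\<Sum>b\<in>Basis. (y q \<bullet> b) *\<^sub>R G q b) = G q (y q)"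
    using lin(1) by eventually_elim (simp add: linear_expand[symmetric])
  ultimately show ?thesis
    unfolding linear_expand[OF lin(2), of y0] by (rule Lim_transform_eventually)
qed

lemma continuous_on_operator:
  fixes G :: "'q::topological_space \<Rightarrow> 'a::euclidean_space \<Rightarrow> 'b::real_normed_vector"
  assumes "\<And>q. q \<in> S \<Longrightarrow> linear (G q)" "\<And>x. continuous_on S (\<lambda>q. G q x)" "continuous_on S y"
  shows "continuous_on S (\<lambda>q. G q (y q))"
  unfolding continuous_on_def
proof
  fix p assume p: "p \<in> S"
  show "((\<lambda>q. G q (y q)) \<longlongrightarrow> G p (y p)) (at p within S)"
    by (rule operator_tendsto) (use assms p in \<open>auto simp: continuous_on_def eventually_at_filter\<close>)
qed

lemma continuous_on_adjoint:
  fixes G :: "'q::topological_space \<Rightarrow> 'a::euclidean_space \<Rightarrow> 'a"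
  assumes "\<And>q. q \<in> S \<Longrightarrow> linear (G q)" "\<And>x. continuous_on S (\<lambda>q. G q x)"
  shows "continuous_on S (\<lambda>q. adjoint (G q) x)"
proof -
  have "continuous_on S (\<lambda>q. \<Sum>b\<in>Basis. (G q b \<bullet> x) *\<^sub>R b)"
    by (intro continuous_intros assms)
  then show ?thesis
    using assms(1) by (simp add: adjoint_expand cong: continuous_on_cong)
qed

lemma operator_derivative:
  fixes G :: "real \<Rightarrow> 'a::euclidean_space \<Rightarrow> 'a"
  assumes lin: "\<forall>\<^sub>F t in at t0 within S. linear (G t)" "linear (G t0)" "linear G'"
    and der: "\<And>x. ((\<lambda>t. G t x) has_vector_derivative G' x) (at t0 within S)"
    and y: "(y has_vector_derivative y') (at t0 within S)"
  shows "((\<lambda>t. G t (y t)) has_vector_derivative G' (y t0) + G t0 y') (at t0 within S)"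
proof -
  let ?Fl = "at t0 within S"
  have c: "((\<lambda>t. G t x) \<longlongrightarrow> G t0 x) ?Fl" for x
    using has_vector_derivative_continuous[OF der[of x]] by (simp add: continuous_within)
  have 1: "((\<lambda>t. (G t (y t0) - G t0 (y t0)) /\<^sub>R (t - t0)) \<longlongrightarrow> G' (y t0)) ?Fl"
    using der[of "y t0"] unfolding has_vector_derivative_iff_quotient .
  have 2: "((\<lambda>t. G t ((y t - y t0) /\<^sub>R (t - t0))) \<longlongrightarrow> G t0 y') ?Fl"
    by (rule operator_tendsto[OF lin(1,2) c y[unfolded has_vector_derivative_iff_quotient]])
  have "\<forall>\<^sub>F t in ?Fl. (G t (y t0) - G t0 (y t0)) /\<^sub>R (t - t0) + G t ((y t - y t0) /\<^sub>R (t - t0))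
      = (G t (y t) - G t0 (y t0)) /\<^sub>R (t - t0)"
    using lin(1)
  proof eventually_elim
    case (elim t)
    show ?case
      by (simp add: linear_cmul[OF elim] linear_diff[OF elim] algebra_simps)
  qed
  from Lim_transform_eventually[OF tendsto_add[OF 1 2] this] show ?thesis
    unfolding has_vector_derivative_iff_quotient .
qed

text \<open>The adjoint of the inverse of \<open>G\<close> maps the orthogonal complement of
  \<open>M\<close> into that of the image of \<open>M\<close>. Applying \<open>G\<close> and this
  adjoint to the two components of \<open>y\<close> therefore yields the orthogonal decomposition of
  \<open>x\<close>.\<close>

lemma image_projection:
  fixes G :: "'a::euclidean_space \<Rightarrow> 'a"
  assumes G: "linear G" "bij G" and M: "subspace M"
    and y: "G (proj M y) + adjoint (inv G) (y - proj M y) = x"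
  shows "proj (G ` M) x = G (proj M y)"
proof (rule proj_unique)
  show "subspace (G ` M)"
    using G(1) M by (simp add: linear_subspace_image)
  show "G (proj M y) \<in> G ` M"
    using proj_mem_orthogonal(1)[OF M] by simp
  fix z assume "z \<in> G ` M"
  then obtain m where m: "m \<in> M" "z = G m" by blast
  have "(x - G (proj M y)) \<bullet> z = adjoint (inv G) (y - proj M y) \<bullet> G m"
    using y m by auto
  also have "\<dots> = inv G (G m) \<bullet> (y - proj M y)"
    using adjoint_works[OF linear_inv[OF G], of "G m" "y - proj M y"] by (simp add: inner_commute)
  also have "\<dots> = (y - proj M y) \<bullet> m"
    using G(2) by (simp add: bij_is_inj inner_commute)
  also have "\<dots> = 0"
    by (rule proj_mem_orthogonal(2)[OF M m(1)])
  finally show "(x - G (proj M y)) \<bullet> z = 0" .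
qed

text \<open>When \<open>G q\<close> tends to the identity so does \<open>T q\<close>, which puts the
  equation of \<open>image_projection\<close> within reach of the near-identity lemmas.\<close>

lemma image_projection_operator:
  fixes G :: "'q \<Rightarrow> 'a::euclidean_space \<Rightarrow> 'a"
  assumes lin: "\<forall>\<^sub>F q in Fl. linear (G q)" and lim: "\<And>x. ((\<lambda>q. G q x) \<longlongrightarrow> x) Fl" and M: "subspace M"
  defines "T \<equiv> \<lambda>q y. G q (proj M y) + adjoint (inv (G q)) (y - proj M y)"
  shows "\<forall>\<^sub>F q in Fl. bij (G q)" "\<And>x. ((\<lambda>q. inv (G q) x) \<longlongrightarrow> x) Fl"
    "\<forall>\<^sub>F q in Fl. linear (T q)" "\<And>x. ((\<lambda>q. T q x) \<longlongrightarrow> x) Fl"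
proof -
  show bij: "\<forall>\<^sub>F q in Fl. bij (G q)"
    by (rule near_identity_bij[OF lin lim])
  have "\<forall>\<^sub>F q in Fl. G q (inv (G q) x) = x" for x
    using bij by eventually_elim (simp add: bij_is_surj surj_f_inv_f)
  then show inv: "((\<lambda>q. inv (G q) x) \<longlongrightarrow> x) Fl" for x
    by (rule near_identity_solution_tendsto[OF lin lim _ tendsto_const])
  have lin': "\<forall>\<^sub>F q in Fl. linear (inv (G q))"
    using lin bij by eventually_elim (rule linear_inv)
  note lp = linear_proj[OF M]
  show "\<forall>\<^sub>F q in Fl. linear (T q)"
    using lin lin'
  proof eventually_elim
    case (elim q)
    have "linear (adjoint (inv (G q)))"
      by (rule adjoint_linear[OF elim(2)])
    then show ?case
      unfolding T_def using elim(1) lp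
      by (intro linearI) (simp_all add: linear_add linear_diff linear_cmul algebra_simps)
  qed
  have adj: "((\<lambda>q. adjoint (inv (G q)) z) \<longlongrightarrow> z) Fl" for z
  proof -
    have "((\<lambda>q. \<Sum>b\<in>Basis. (inv (G q) b \<bullet> z) *\<^sub>R b) \<longlongrightarrow> (\<Sum>b\<in>Basis. (b \<bullet> z) *\<^sub>R b)) Fl"
      by (intro tendsto_intros inv)
    moreover have "\<forall>\<^sub>F q in Fl. (\<Sum>b\<in>Basis. (inv (G q) b \<bullet> z) *\<^sub>R b) = adjoint (inv (G q)) z"
      using lin' by eventually_elim (simp add: adjoint_expand)
    moreover have "(\<Sum>b\<in>Basis. (b \<bullet> z) *\<^sub>R b) = z"
      using euclidean_representation[of z] by (simp add: inner_commute)
    ultimately show ?thesis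
      using Lim_transform_eventually by fastforce
  qed
  show "((\<lambda>q. T q x) \<longlongrightarrow> x) Fl" for x
    using tendsto_add[OF lim[of "proj M x"] adj[of "x - proj M x"]] unfolding T_def by simp
qed

lemma image_projection_tendsto:
  fixes G :: "'q \<Rightarrow> 'a::euclidean_space \<Rightarrow> 'a"
  assumes lin: "\<forall>\<^sub>F q in Fl. linear (G q)" and lim: "\<And>x. ((\<lambda>q. G q x) \<longlongrightarrow> x) Fl" and M: "subspace M"
  shows "((\<lambda>q. proj (G q ` M) x) \<longlongrightarrow> proj M x) Fl"
proof -
  note op = image_projection_operator[OF lin lim M]
  let ?T = "\<lambda>q y. G q (proj M y) + adjoint (inv (G q)) (y - proj M y)"
  define y where "y q = inv (?T q) x" for q
  have sol: "\<forall>\<^sub>F q in Fl. ?T q (y q) = x"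
    using near_identity_bij[OF op(3,4)]
    by eventually_elim (unfold y_def, erule surj_f_inv_f[OF bij_is_surj])
  have y: "(y \<longlongrightarrow> x) Fl"
    by (rule near_identity_solution_tendsto[OF op(3,4) sol tendsto_const])
  have "((\<lambda>q. proj M (y q)) \<longlongrightarrow> proj M x) Fl"
    using bounded_linear.tendsto[OF linear_proj[OF M, unfolded linear_conv_bounded_linear] y] .
  then have "((\<lambda>q. G q (proj M (y q))) \<longlongrightarrow> proj M x) Fl"
    using operator_tendsto[OF lin, of "\<lambda>x. x"] lim linear_id by (simp add: id_def)
  moreover have "\<forall>\<^sub>F q in Fl. G q (proj M (y q)) = proj (G q ` M) x"
    using lin op(1) sol by eventually_elim (simp add: image_projection[OF _ _ M])
  ultimately show ?thesis
    by (rule Lim_transform_eventually)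
qed

text \<open>The classical derivative \<open>(1 - P) K P + P K^T (1 - P)\<close> of the orthogonal
  projection \<open>P\<close> onto \<open>M\<close> when \<open>M\<close> moves with velocity field
  \<open>K\<close>.\<close>

definition proj_velocity :: "'a::euclidean_space set \<Rightarrow> ('a \<Rightarrow> 'a) \<Rightarrow> 'a \<Rightarrow> 'a" where
  "proj_velocity M K x = K (proj M x) - proj M (K (proj M x)) + proj M (adjoint K (x - proj M x))"

text \<open>The projection is \<open>G t\<close> applied to \<open>proj M (y t)\<close>, where
  \<open>y t\<close> solves the near-identity equation; the formula is the product rule with
  \<open>y' = - K P x + K^T (1 - P) x\<close>.\<close>

lemma image_projection_derivative:
  fixes G :: "real \<Rightarrow> 'a::euclidean_space \<Rightarrow> 'a"
  assumes lin: "\<forall>\<^sub>F t in at t0 within S. linear (G t)" and G0: "\<And>x. G t0 x = x" and K: "linear K"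
    and der: "\<And>x. ((\<lambda>t. G t x) has_vector_derivative K x) (at t0 within S)" and M: "subspace M"
  shows "((\<lambda>t. proj (G t ` M) x) has_vector_derivative proj_velocity M K x) (at t0 within S)"
proof -
  let ?Fl = "at t0 within S"
  have lim: "((\<lambda>t. G t x) \<longlongrightarrow> x) ?Fl" for x
    using has_vector_derivative_continuous[OF der[of x]] by (simp add: continuous_within G0)
  note op = image_projection_operator[OF lin lim M]
  have G0id: "G t0 = id"
    using G0 by auto
  let ?T = "\<lambda>t y. G t (proj M y) + adjoint (inv (G t)) (y - proj M y)"
  have adj_id: "adjoint (id :: 'a \<Rightarrow> 'a) = id"
    by (rule adjoint_unique) simp
  have T0: "?T t0 y = y" for y
    by (simp add: G0id adj_id)
  have inv_sol: "\<forall>\<^sub>F t in ?Fl. G t (inv (G t) x) = x" for x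
    using op(1) by eventually_elim (simp add: bij_is_surj surj_f_inv_f)
  have der_inv: "((\<lambda>t. inv (G t) x) has_vector_derivative - K x) ?Fl" for x
    by (rule near_identity_solution_derivative[OF lin lim G0 der inv_sol]) (simp add: G0id)
  have lin': "\<forall>\<^sub>F t in ?Fl. linear (inv (G t))"
    using lin op(1) by eventually_elim (rule linear_inv)
  have der_adj: "((\<lambda>t. adjoint (inv (G t)) z) has_vector_derivative - adjoint K z) ?Fl" for z
  proof -
    have "((\<lambda>t. \<Sum>b\<in>Basis. (inv (G t) b \<bullet> z) *\<^sub>R b) has_vector_derivative (\<Sum>b\<in>Basis. (- K b \<bullet> z) *\<^sub>R b)) ?Fl"
      by (intro has_vector_derivative_sum
          bounded_linear.has_vector_derivative[OF bounded_linear_scaleR_left]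
          bounded_linear.has_vector_derivative[OF bounded_linear_inner_left] der_inv)
    moreover have "(\<Sum>b\<in>Basis. (- K b \<bullet> z) *\<^sub>R b) = - adjoint K z"
      by (simp add: adjoint_expand[OF K] sum_negf)
    moreover have "\<forall>\<^sub>F t in ?Fl. ((\<Sum>b\<in>Basis. (inv (G t) b \<bullet> z) *\<^sub>R b) - (\<Sum>b\<in>Basis. (inv (G t0) b \<bullet> z) *\<^sub>R b)) /\<^sub>R (t - t0)
        = (adjoint (inv (G t)) z - adjoint (inv (G t0)) z) /\<^sub>R (t - t0)"
      using lin'
    proof eventually_elim
      case (elim t)
      have "linear (inv (G t0))"
        by (simp add: G0id linear_id)
      then show ?case
        by (simp add: adjoint_expand elim)
    qed
    ultimately show ?thesis
      unfolding has_vector_derivative_iff_quotient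
      using Lim_transform_eventually by fastforce
  qed
  have derT: "((\<lambda>t. ?T t x) has_vector_derivative K (proj M x) - adjoint K (x - proj M x)) ?Fl" for x
    using has_vector_derivative_add[OF der der_adj] by simp
  define y where "y t = inv (?T t) x" for t
  have sol: "\<forall>\<^sub>F t in ?Fl. ?T t (y t) = x"
    using near_identity_bij[OF op(3,4)]
    by eventually_elim (unfold y_def, erule surj_f_inv_f[OF bij_is_surj])
  have "?T t0 = id"
    using T0 by auto
  then have y0: "y t0 = x"
    by (simp add: y_def)
  have y: "(y has_vector_derivative - (K (proj M x) - adjoint K (x - proj M x))) ?Fl"
    by (rule near_identity_solution_derivative[OF op(3,4) T0 derT sol y0])
  note lp = linear_proj[OF M]
  have py: "((\<lambda>t. proj M (y t)) has_vector_derivative proj M (- (K (proj M x) - adjoint K (x - proj M x)))) ?Fl"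
    by (rule bounded_linear.has_vector_derivative[OF lp[unfolded linear_conv_bounded_linear] y])
  have "((\<lambda>t. G t (proj M (y t))) has_vector_derivative
      K (proj M (y t0)) + G t0 (proj M (- (K (proj M x) - adjoint K (x - proj M x))))) ?Fl"
    by (rule operator_derivative[OF lin _ K der py]) (simp add: G0id linear_iff)
  moreover have "K (proj M (y t0)) + G t0 (proj M (- (K (proj M x) - adjoint K (x - proj M x)))) = proj_velocity M K x"
    unfolding proj_velocity_def y0 G0 by (simp add: linear_diff[OF lp])
  ultimately have "((\<lambda>t. G t (proj M (y t))) has_vector_derivative proj_velocity M K x) ?Fl"
    by simp
  then have "((\<lambda>t. (G t (proj M (y t)) - proj M x) /\<^sub>R (t - t0)) \<longlongrightarrow> proj_velocity M K x) ?Fl"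
    unfolding has_vector_derivative_iff_quotient by (simp add: y0 G0)
  moreover have "\<forall>\<^sub>F t in ?Fl. (G t (proj M (y t)) - proj M x) /\<^sub>R (t - t0) = (proj (G t ` M) x - proj (G t0 ` M) x) /\<^sub>R (t - t0)"
    using lin op(1) sol by eventually_elim (simp add: image_projection[OF _ _ M] G0id)
  ultimately show ?thesis
    unfolding has_vector_derivative_iff_quotient by (rule Lim_transform_eventually)
qed

text \<open>A tangent vector to the Grassmannian at \<open>M\<close> is a map from \<open>M\<close>
  to the quotient by \<open>M\<close>, so fields that agree on \<open>M\<close> modulo
  \<open>M\<close> move it alike. This is how chart velocities are compared with
  \<open>J\<close>.\<close>

lemma proj_velocity_cong:
  assumes M: "subspace M" and K: "linear K" "linear K'" and eq: "\<And>x. x \<in> M \<Longrightarrow> K x - K' x \<in> M"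
  shows "proj_velocity M K x = proj_velocity M K' x"
proof -
  note lp = linear_proj[OF M] and pm = proj_mem_orthogonal[OF M]
  have "proj M (K (proj M x) - K' (proj M x)) = K (proj M x) - K' (proj M x)"
    by (intro proj_self[OF M] eq pm)
  then have 1: "K (proj M x) - proj M (K (proj M x)) = K' (proj M x) - proj M (K' (proj M x))"
    by (simp add: linear_diff[OF lp] algebra_simps)
  let ?z = "x - proj M x"
  have "proj M (adjoint K ?z - adjoint K' ?z) = 0"
  proof (rule proj_orthogonal_zero[OF M])
    fix y assume y: "y \<in> M"
    have "(adjoint K ?z - adjoint K' ?z) \<bullet> y = ?z \<bullet> (K y - K' y)"
      using adjoint_works[OF K(1), of y ?z] adjoint_works[OF K(2), of y ?z]
      by (simp add: inner_diff_left inner_diff_right inner_commute)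
    also have "\<dots> = 0"
      by (rule pm(2)[OF eq[OF y]])
    finally show "(adjoint K ?z - adjoint K' ?z) \<bullet> y = 0" .
  qed
  then have 2: "proj M (adjoint K ?z) = proj M (adjoint K' ?z)"
    by (simp add: linear_diff[OF lp])
  show ?thesis
    unfolding proj_velocity_def 1 2 ..
qed

context symplectic_space
begin

lemma lagrangian_image:
  assumes M: "lagrangian \<omega> M" and A: "A \<in> Sp \<omega>"
  shows "lagrangian \<omega> (A ` M)"
proof -
  have lin: "linear A" and inj: "inj A" and om': "\<And>u v. \<omega> (A u) (A v) = \<omega> u v"
    using A by (auto simp: Sp_def bij_def)
  have "dim (A ` M) = dim M"
    using inj by (intro dim_image_eq[OF lin]) (auto intro: inj_on_subset)
  then show ?thesis
    using lagrangianD[OF M] om' linear_subspace_image[OF lin]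
    by (auto simp: lagrangian_def)
qed

lemma cont_lag_image:
  fixes G :: "'p::topological_space \<Rightarrow> 'a \<Rightarrow> 'a"
  assumes M: "lagrangian \<omega> M" and G: "\<And>q. q \<in> S \<Longrightarrow> G q \<in> Sp \<omega>"
    and cont: "\<And>x. continuous_on S (\<lambda>q. G q x)"
  shows "cont_lag S (\<lambda>q. G q ` M)"
  unfolding cont_lag_def
proof (intro conjI ballI allI)
  show "lagrangian \<omega> (G q ` M)" if "q \<in> S" for q
    by (rule lagrangian_image[OF M G[OF that]])
  have lin: "linear (G q)" and bij: "bij (G q)" if "q \<in> S" for q
    using G[OF that] by (auto simp: Sp_def)
  show "continuous_on S (\<lambda>q. proj (G q ` M) x)" for x
    unfolding continuous_on_def
  proof
    fix p assume p: "p \<in> S"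
    \<comment> \<open>Relative to the position at \<open>p\<close> the motion starts at the
      identity, as the near-identity lemmas require.\<close>
    let ?H = "\<lambda>q x. G q (inv (G p) x)"
    have "((\<lambda>q. proj (?H q ` (G p ` M)) x) \<longlongrightarrow> proj (G p ` M) x) (at p within S)"
    proof (rule image_projection_tendsto)
      have "linear (?H q)" if "q \<in> S" for q
        using linear_compose[OF linear_inv[OF lin[OF p] bij[OF p]] lin[OF that]] by (simp add: o_def)
      then show "\<forall>\<^sub>F q in at p within S. linear (?H q)"
        by (simp add: eventually_at_filter)
      show "((\<lambda>q. ?H q x) \<longlongrightarrow> x) (at p within S)" for x
        using cont[of "inv (G p) x"] p surj_f_inv_f[OF bij_is_surj[OF bij[OF p]], of x]
        unfolding continuous_on_def by metis
      show "subspace (G p ` M)"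
        using lagrangianD(1)[OF M] lin[OF p] by (simp add: linear_subspace_image)
    qed
    moreover have "?H q ` (G p ` M) = G q ` M" for q
      using bij[OF p] by (simp add: image_image bij_is_inj)
    ultimately show "((\<lambda>q. proj (G q ` M) x) \<longlongrightarrow> proj (G p ` M) x) (at p within S)"
      by simp
  qed
qed

section \<open>Paths in a chart\<close>

definition sym_map :: "'a set \<Rightarrow> 'a set \<Rightarrow> ('a \<Rightarrow> 'a) \<Rightarrow> bool" where
  "sym_map W L0 A \<longleftrightarrow> linear A \<and> (\<forall>v\<in>L0. A v \<in> W) \<and> (\<forall>u\<in>L0. \<forall>v\<in>L0. \<omega> u (A v) = \<omega> v (A u))"

definition graph :: "'a set \<Rightarrow> ('a \<Rightarrow> 'a) \<Rightarrow> 'a set" where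
  "graph L0 A = (\<lambda>v. v + A v) ` L0"

text \<open>\<open>x + gr W L0 x\<close> is the component of \<open>x\<close> in \<open>L0\<close>
  along \<open>W\<close>; the map adds \<open>A\<close> of that component. Shears present graphs
  over \<open>L0\<close> as images of \<open>L0\<close> under symplectic maps.\<close>

definition shear :: "'a set \<Rightarrow> 'a set \<Rightarrow> ('a \<Rightarrow> 'a) \<Rightarrow> 'a \<Rightarrow> 'a" where
  "shear W L0 A x = x + A (x + gr W L0 x)"

lemma sym_mapD:
  assumes "sym_map W L0 A"
  shows "linear A" "\<And>v. v \<in> L0 \<Longrightarrow> A v \<in> W" "\<And>u v. u \<in> L0 \<Longrightarrow> v \<in> L0 \<Longrightarrow> \<omega> u (A v) = \<omega> v (A u)"
  using assms by (auto simp: sym_map_def)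

lemma sym_map_gr:
  assumes T: "transv W L" and L0: "lagrangian \<omega> L0"
  shows "sym_map W L0 (gr W L)"
  unfolding sym_map_def using linear_gr[OF T] gr_mem(1)[OF T] gr_symmetric[OF T L0] by blast

lemma sym_map_add:
  assumes "subspace W" "sym_map W L0 A" "sym_map W L0 B"
  shows "sym_map W L0 (\<lambda>v. A v + B v)"
  using assms unfolding sym_map_def by (simp add: linear_compose_add subspace_add om)

lemma sym_map_scale:
  assumes "subspace W" "sym_map W L0 A"
  shows "sym_map W L0 (\<lambda>v. c *\<^sub>R A v)"
  using assms unfolding sym_map_def by (simp add: linear_compose_scale_right subspace_scale om)

lemma sym_map_diff:
  assumes "subspace W" "sym_map W L0 A" "sym_map W L0 B"
  shows "sym_map W L0 (\<lambda>v. A v - B v)"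
  using assms unfolding sym_map_def by (simp add: linear_compose_sub subspace_diff om)

text \<open>A vector of \<open>W\<close> has no \<open>L0\<close>-component, so the second shear
  acts on the same component as the one before it.\<close>

lemma shear_compose:
  assumes T: "transv W L0" and A: "sym_map W L0 A" and B: "sym_map W L0 B"
  shows "shear W L0 A (shear W L0 B x) = shear W L0 (\<lambda>v. A v + B v) x"
proof -
  let ?v = "x + gr W L0 x"
  have "B ?v \<in> W"
    using gr_mem(2)[OF T] sym_mapD(2)[OF B] by blast
  then have "gr W L0 (B ?v) = - B ?v"
    by (rule gr_on_W[OF T])
  then have "shear W L0 B x + gr W L0 (shear W L0 B x) = ?v"
    by (simp add: shear_def gr_simps[OF T])
  then have "shear W L0 A (shear W L0 B x) = shear W L0 B x + A ?v"
    by (simp add: shear_def[of W L0 A])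
  then show ?thesis
    by (simp add: shear_def)
qed

lemma shear_zero: "shear W L0 (\<lambda>v. 0) x = x"
  by (simp add: shear_def)

lemma linear_shear:
  assumes T: "transv W L0" and A: "linear A"
  shows "linear (shear W L0 A)"
  unfolding shear_def
  by (rule linearI) (simp_all add: gr_simps[OF T] linear_add[OF A] linear_cmul[OF A] algebra_simps)

lemma shear_Sp:
  assumes T: "transv W L0" and A: "sym_map W L0 A"
  shows "shear W L0 A \<in> Sp \<omega>"
proof -
  note g = gr_mem[OF T] and t = transvD[OF T]
  have neg: "sym_map W L0 (\<lambda>v. - 1 *\<^sub>R A v)"
    by (rule sym_map_scale[OF t(4) A])
  have "bij (shear W L0 A)"
  proof (rule o_bij)
    show "shear W L0 (\<lambda>v. - 1 *\<^sub>R A v) \<circ> shear W L0 A = id"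
      using shear_compose[OF T neg A] by (auto simp: shear_zero)
    show "shear W L0 A \<circ> shear W L0 (\<lambda>v. - 1 *\<^sub>R A v) = id"
      using shear_compose[OF T A neg] by (auto simp: shear_zero)
  qed
  moreover have "\<omega> (shear W L0 A x) (shear W L0 A y) = \<omega> x y" for x y
  proof -
    let ?u = "x + gr W L0 x" and ?v = "y + gr W L0 y"
    have w: "A ?u \<in> W" "A ?v \<in> W"
      using sym_mapD(2)[OF A] g(2) by blast+
    have 1: "\<omega> x (A ?v) = \<omega> ?u (A ?v)"
      using lagrangianD(3)[OF t(1) g(1) w(2)] by (simp only: om)
    have 2: "\<omega> y (A ?u) = \<omega> ?v (A ?u)"
      using lagrangianD(3)[OF t(1) g(1) w(1)] by (simp only: om)
    have "\<omega> (A ?u) y = - \<omega> ?u (A ?v)"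
      using 2 sym_mapD(3)[OF A g(2) g(2), of x y] om_skew[of "A ?u" y] by simp
    then show ?thesis
      using 1 lagrangianD(3)[OF t(1) w] unfolding shear_def
      by (simp only: om(1)[of x "A ?u"] om(2)[of _ y "A ?v"])
  qed
  ultimately show ?thesis
    using linear_shear[OF T sym_mapD(1)[OF A]] by (simp add: Sp_def)
qed

lemma shear_image:
  assumes T: "transv W L0" and A: "sym_map W L0 A" and B: "sym_map W L0 B"
  shows "shear W L0 A ` graph L0 B = graph L0 (\<lambda>v. A v + B v)"
proof -
  have "shear W L0 B v = v + B v" if "v \<in> L0" for B v
    using gr_eq_0[OF T that] by (simp add: shear_def)
  then have "graph L0 B = shear W L0 B ` L0" for B
    by (simp add: graph_def)
  then show ?thesis
    using shear_compose[OF T A B] by (simp add: image_image)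
qed

lemma graph_zero: "graph L0 (\<lambda>v. 0) = L0"
  by (simp add: graph_def)

lemma sym_map_zero: "transv W L0 \<Longrightarrow> sym_map W L0 (\<lambda>v. 0)"
  using transvD(4) subspace_0 by (auto simp: sym_map_def om linear_iff)

lemma graph_eq_shear:
  assumes T: "transv W L0" and A: "sym_map W L0 A"
  shows "graph L0 A = shear W L0 A ` L0"
  using shear_image[OF T A sym_map_zero[OF T]] by (simp add: graph_zero)

lemma transv_graph:
  assumes T: "transv W L0" and A: "sym_map W L0 A"
  shows "transv W (graph L0 A)" "v \<in> L0 \<Longrightarrow> gr W (graph L0 A) v = A v"
proof -
  have lag: "lagrangian \<omega> (graph L0 A)"
    unfolding graph_eq_shear[OF T A] by (rule lagrangian_image[OF transvD(2)[OF T] shear_Sp[OF T A]])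
  have "x = 0" if "x \<in> W" "x \<in> graph L0 A" for x
  proof -
    from that(2) obtain v where v: "v \<in> L0" "x = v + A v"
      by (auto simp: graph_def)
    then have "v = x - A v" by simp
    then have "v \<in> W"
      using that(1) sym_mapD(2)[OF A v(1)] transvD(4)[OF T] by (metis subspace_diff)
    then have "v = 0"
      using v(1) transvD(3)[OF T] by blast
    then show "x = 0"
      using v(2) linear_0[OF sym_mapD(1)[OF A]] by simp
  qed
  then show tr: "transv W (graph L0 A)"
    using lag lagrangianD(4)[OF lag] lagrangianD(4)[OF transvD(1)[OF T]] transvD(1)[OF T]
    unfolding transv_def by blast
  show "gr W (graph L0 A) v = A v" if "v \<in> L0"
    using that by (intro gr_unique[OF tr sym_mapD(2)[OF A]]) (auto simp: graph_def)
qed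

lemma graph_gr:
  assumes T: "transv W L0" and T': "transv W L"
  shows "graph L0 (gr W L) = L"
proof (rule subspace_dim_equal)
  have G: "transv W (graph L0 (gr W L))"
    by (rule transv_graph(1)[OF T sym_map_gr[OF T' transvD(2)[OF T]]])
  show "subspace (graph L0 (gr W L))" "subspace L"
    using transvD(5)[OF G] transvD(5)[OF T'] by auto
  show "graph L0 (gr W L) \<subseteq> L"
    using gr_mem(2)[OF T'] by (auto simp: graph_def)
  show "dim L \<le> dim (graph L0 (gr W L))"
    using lagrangianD(2)[OF transvD(2)[OF G]] lagrangianD(2)[OF transvD(2)[OF T']] by simp
qed

lemma cont_lag_graph:
  fixes A :: "'p::topological_space \<Rightarrow> 'a \<Rightarrow> 'a"
  assumes T: "transv W L0" and A: "\<And>q. q \<in> S \<Longrightarrow> sym_map W L0 (A q)"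
    and cont: "\<And>x. continuous_on S (\<lambda>q. A q x)"
  shows "cont_lag S (\<lambda>q. graph L0 (A q))"
proof -
  have c: "cont_lag S (\<lambda>q. shear W L0 (A q) ` L0)"
  proof (rule cont_lag_image[OF transvD(2)[OF T] shear_Sp[OF T A]])
    show "continuous_on S (\<lambda>q. shear W L0 (A q) x)" for x
      unfolding shear_def by (intro continuous_intros cont)
  qed
  have eq: "graph L0 (A q) = shear W L0 (A q) ` L0" if "q \<in> S" for q
    by (rule graph_eq_shear[OF T A[OF that]])
  show ?thesis
    using c unfolding cont_lag_def by (simp add: eq cong: continuous_on_cong)
qed

text \<open>The shear by \<open>A t - A t0\<close> carries the graph at \<open>t0\<close> to the
  graph at \<open>t\<close> and is the identity at \<open>t0\<close>.\<close>

lemma graph_derivative: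
  fixes A :: "real \<Rightarrow> 'a \<Rightarrow> 'a"
  assumes T: "transv W L0" and A: "\<And>t. t \<in> S \<Longrightarrow> sym_map W L0 (A t)" and t0: "t0 \<in> S"
    and A': "linear A'" and der: "\<And>x. ((\<lambda>t. A t x) has_vector_derivative A' x) (at t0 within S)"
  shows "((\<lambda>t. proj (graph L0 (A t)) x) has_vector_derivative
      proj_velocity (graph L0 (A t0)) (\<lambda>x. A' (x + gr W L0 x)) x) (at t0 within S)"
proof -
  define G where "G t = shear W L0 (\<lambda>v. A t v - A t0 v)" for t
  have sm: "sym_map W L0 (\<lambda>v. A t v - A t0 v)" if "t \<in> S" for t
    by (rule sym_map_diff[OF transvD(4)[OF T] A[OF that] A[OF t0]])
  have "((\<lambda>t. proj (G t ` graph L0 (A t0)) x) has_vector_derivative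
      proj_velocity (graph L0 (A t0)) (\<lambda>x. A' (x + gr W L0 x)) x) (at t0 within S)"
  proof (rule image_projection_derivative)
    show "\<forall>\<^sub>F t in at t0 within S. linear (G t)"
      unfolding G_def eventually_at_filter
      using linear_shear[OF T sym_mapD(1)[OF sm]] by simp
    show "G t0 x = x" for x
      by (simp add: G_def shear_zero)
    show "linear (\<lambda>x. A' (x + gr W L0 x))"
      by (rule linearI) (simp_all add: gr_simps[OF T] linear_add[OF A'] linear_cmul[OF A'] algebra_simps)
    show "((\<lambda>t. G t x) has_vector_derivative A' (x + gr W L0 x)) (at t0 within S)" for x
    proof -
      have "((\<lambda>t. x + (A t (x + gr W L0 x) - A t0 (x + gr W L0 x))) has_vector_derivative
          0 + (A' (x + gr W L0 x) - 0)) (at t0 within S)"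
        by (intro has_vector_derivative_add has_vector_derivative_diff has_vector_derivative_const der)
      then show ?thesis
        by (simp add: G_def shear_def)
    qed
    show "subspace (graph L0 (A t0))"
      by (rule transvD(5)[OF transv_graph(1)[OF T A[OF t0]]])
  qed
  moreover have "proj (graph L0 (A t)) x = proj (G t ` graph L0 (A t0)) x" if "t \<in> S" for t
    unfolding G_def shear_image[OF T sm[OF that] A[OF t0]] by simp
  ultimately show ?thesis
    by (rule has_vector_derivative_transform[OF t0, rotated])
qed

section \<open>Existence of regular representatives\<close>

text \<open>The chart derivative is \<open>- gr W (l t0) (D v)\<close>. It differs from
  \<open>D v\<close> by an element of \<open>l t0\<close>, which is symplectically orthogonal to
  \<open>v\<close>.\<close>

lemma crossing_form_velocity:
  fixes l :: "real \<Rightarrow> 'a set"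
  assumes c: "cont_lag {a..b} l" and ab: "a < b" and t0: "t0 \<in> {a..b}"
    and der: "\<And>x. ((\<lambda>t. proj (l t) x) has_vector_derivative D x) (at t0 within {a..b})"
    and v: "v \<in> l t0"
  shows "crossing_form \<omega> l a b t0 v = \<omega> v (D v)"
proof -
  have L: "lagrangian \<omega> (l t0)"
    by (rule cont_lagD(1)[OF c t0])
  obtain W where T: "transv W (l t0)"
    using transv_ex[OF L L] by blast
  have "((\<lambda>t. gr W (l t) v) has_vector_derivative - gr W (l t0) (D (v + gr W (l t0) v))) (at t0 within {a..b})"
    by (rule gr_derivative[OF T cont_lagD(2)[OF c t0] der])
  then have "((\<lambda>t. gr W (l t) v) has_vector_derivative - gr W (l t0) (D v)) (at t0 within {a..b})"
    by (simp add: gr_eq_0[OF T v])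
  then have "crossing_form \<omega> l a b t0 v = \<omega> v (- gr W (l t0) (D v))"
    using der by (intro crossing_form_eq[OF c ab t0 _ T v]) auto
  also have "\<dots> = \<omega> v (D v)"
    using lagrangianD(3)[OF L v gr_mem(2)[OF T, of "D v"]] by (simp add: om)
  finally show ?thesis .
qed

text \<open>The velocity, read in the chart of \<open>W\<close>, of \<open>L\<close> moving along
  the field \<open>J\<close>. Its form is the squared norm of the point of \<open>L\<close> over
  \<open>v\<close>, so one and the same direction is positive in every chart.\<close>

definition unit_map :: "'a set \<Rightarrow> 'a set \<Rightarrow> 'a \<Rightarrow> 'a" where
  "unit_map W L v = - gr W L (J (v + gr W L v))"

text \<open>Isotropy of \<open>W\<close> allows \<open>u\<close> to be replaced by
  \<open>u + gr W L u\<close>, and isotropy of \<open>L\<close> allows \<open>- gr W L\<close> to be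
  dropped in front of \<open>J\<close>; the defining property of \<open>J\<close> remains.\<close>

lemma unit_map:
  assumes T: "transv W L" and T0: "transv W L0"
  shows "sym_map W L0 (unit_map W L)"
    and "u \<in> L0 \<Longrightarrow> v \<in> L0 \<Longrightarrow> \<omega> u (unit_map W L v) = (u + gr W L u) \<bullet> (v + gr W L v)"
    and "v \<in> L0 \<Longrightarrow> v \<noteq> 0 \<Longrightarrow> \<omega> v (unit_map W L v) > 0"
proof -
  have lin: "linear (unit_map W L)"
    unfolding unit_map_def
    by (rule linearI)
      (simp_all add: gr_simps[OF T] linear_add[OF linear_J] linear_cmul[OF linear_J] algebra_simps)
  have mem: "unit_map W L v \<in> W" for v
    unfolding unit_map_def using gr_mem(1)[OF T] transvD(4)[OF T] by (simp add: subspace_neg)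
  have form: "\<omega> u (unit_map W L v) = (u + gr W L u) \<bullet> (v + gr W L v)" for u v
  proof -
    let ?x = "u + gr W L u" and ?y = "v + gr W L v"
    have "\<omega> u (unit_map W L v) = \<omega> ?x (unit_map W L v)"
      using lagrangianD(3)[OF transvD(1)[OF T] gr_mem(1)[OF T] mem] by (simp add: om)
    also have "\<dots> = \<omega> ?x (J ?y) - \<omega> ?x (J ?y + gr W L (J ?y))"
      by (simp add: unit_map_def om)
    also have "\<dots> = \<omega> ?x (J ?y)"
      using lagrangianD(3)[OF transvD(2)[OF T] gr_mem(2)[OF T] gr_mem(2)[OF T]] by simp
    finally show ?thesis
      by (simp add: om_J)
  qed
  show "\<omega> u (unit_map W L v) = (u + gr W L u) \<bullet> (v + gr W L v)"
    by (rule form)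
  show "sym_map W L0 (unit_map W L)"
    unfolding sym_map_def using lin mem form by (simp add: inner_commute)
  show "\<omega> v (unit_map W L v) > 0" if v: "v \<in> L0" "v \<noteq> 0"
  proof -
    have "v + gr W L v \<noteq> 0"
    proof
      assume "v + gr W L v = 0"
      then have "v = - gr W L v"
        by (simp add: eq_neg_iff_add_eq_0)
      then have "v \<in> W"
        using gr_mem(1)[OF T, of v] transvD(4)[OF T] by (metis subspace_neg)
      then show False
        using v transvD(3)[OF T0] by blast
    qed
    then show ?thesis
      by (simp add: form)
  qed
qed

text \<open>The last clause offers an alternative at each time: if the form of \<open>A t\<close>
  has no non-zero null vector there is no crossing, and if that of \<open>A' t\<close> has none, any
  crossing is regular.\<close>

definition interpolant :: "'a set \<Rightarrow> 'a set \<Rightarrow> real \<Rightarrow> real \<Rightarrow> ('a \<Rightarrow> 'a) \<Rightarrow> ('a \<Rightarrow> 'a) \<Rightarrow> ('a \<Rightarrow> 'a) \<Rightarrow> ('a \<Rightarrow> 'a)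
    \<Rightarrow> (real \<Rightarrow> 'a \<Rightarrow> 'a) \<Rightarrow> (real \<Rightarrow> 'a \<Rightarrow> 'a) \<Rightarrow> bool" where
  "interpolant W L0 c d A0 A1 E0 E1 A A' \<longleftrightarrow>
    (\<forall>t. sym_map W L0 (A t)) \<and> (\<forall>t. sym_map W L0 (A' t))
    \<and> A c = A0 \<and> A d = A1 \<and> A' c = E0 \<and> A' d = E1
    \<and> (\<forall>t x S. ((\<lambda>t. A t x) has_vector_derivative A' t x) (at t within S))
    \<and> (\<forall>x. continuous_on {c..d} (\<lambda>t. A' t x))
    \<and> (\<forall>t\<in>{c..d}. (\<forall>v\<in>L0. v \<noteq> 0 \<longrightarrow> \<omega> v (A t v) \<noteq> 0) \<or> (\<forall>v\<in>L0. v \<noteq> 0 \<longrightarrow> \<omega> v (A' t v) \<noteq> 0))"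

text \<open>The perturbation by the large multiple \<open>K P(u)\<close> of a definite form leaves the end data
  unchanged; \<open>P' \<ge> 0\<close> near the end points, where the prescribed velocities are positive, \<open>P' < 0\<close>
  near the middle zero of \<open>P\<close>, and \<open>P\<close> is bounded away from zero elsewhere.\<close>

lemma regular_interpolation:
  fixes c d :: real
  assumes cd: "c < d" and T: "transv W L0"
    and A0: "sym_map W L0 A0" and A1: "sym_map W L0 A1"
    and E0: "sym_map W L0 E0" and E1: "sym_map W L0 E1"
    and pos0: "\<And>v. v \<in> L0 \<Longrightarrow> v \<noteq> 0 \<Longrightarrow> \<omega> v (E0 v) > 0"
    and pos1: "\<And>v. v \<in> L0 \<Longrightarrow> v \<noteq> 0 \<Longrightarrow> \<omega> v (E1 v) > 0"
  shows "\<exists>A A'. interpolant W L0 c d A0 A1 E0 E1 A A'"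
proof -
  define h where "h = d - c"
  have h: "h > 0"
    using cd by (simp add: h_def)
  define B where "B = unit_map W L0"
  have B: "sym_map W L0 B"
    unfolding B_def by (rule unit_map(1)[OF T T])
  have Bform: "\<omega> v (B v) = (norm v)\<^sup>2" if "v \<in> L0" for v
    unfolding B_def using unit_map(2)[OF T T that that] gr_eq_0[OF T that] by (simp add: power2_norm_eq_inner)
  \<comment> \<open>\<open>Q1\<close>, \<open>Q2\<close>, \<open>Q3\<close> are the cubic Hermite
    polynomials for the end value and the two end slopes; \<open>P\<close> has double zeros at 0 and
    1 and a simple zero at 1/2.\<close>
  define Q1 Q2 Q3 P where "Q1 u = u\<^sup>2 * (3 - 2 * u)" and "Q2 u = u * (1 - u)\<^sup>2"
    and "Q3 u = - u\<^sup>2 * (1 - u)" and "P u = (1/2 - u) * (u * (1 - u))\<^sup>2" for u :: real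
  define Q1' Q2' Q3' P' where "Q1' u = 6 * u * (1 - u)" and "Q2' u = (1 - u) * (1 - 3 * u)"
    and "Q3' u = u * (3 * u - 2)" and "P' u = u * (1 - u) * (5 * (u - 1/2)\<^sup>2 - 1/4)" for u :: real
  have dQ: "(Q1 has_real_derivative Q1' u) (at u)" "(Q2 has_real_derivative Q2' u) (at u)"
    "(Q3 has_real_derivative Q3' u) (at u)" "(P has_real_derivative P' u) (at u)" for u
    unfolding Q1_def Q2_def Q3_def P_def Q1'_def Q2'_def Q3'_def P'_def
    by (auto intro!: derivative_eq_intros simp: power2_eq_square field_simps)
  define u where "u t = (t - c) / h" for t
  have du: "(u has_real_derivative 1 / h) (at t within S)" for t S
    unfolding u_def using h by (auto intro!: derivative_eq_intros)
  have chain: "((\<lambda>t. Q (u t)) has_real_derivative q / h) (at t within S)"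
    if "(Q has_real_derivative q) (at (u t))" for Q q t S
    using DERIV_chain2[OF that du] by simp
  note comb = sym_map_add[OF transvD(4)[OF T]] sym_map_diff[OF transvD(4)[OF T]] sym_map_scale[OF transvD(4)[OF T]]
  define H where "H s v = A0 v + Q1 s *\<^sub>R (A1 v - A0 v) + (h * Q2 s) *\<^sub>R E0 v + (h * Q3 s) *\<^sub>R E1 v" for s v
  define H' where "H' s v = (Q1' s / h) *\<^sub>R (A1 v - A0 v) + Q2' s *\<^sub>R E0 v + Q3' s *\<^sub>R E1 v" for s v
  have sH: "sym_map W L0 (H s)" "sym_map W L0 (H' s)" for s
    unfolding H_def H'_def by (intro comb A0 A1 E0 E1)+
  have linA: "linear A0" "linear A1" "linear E0" "linear E1"
    using A0 A1 E0 E1 by (auto dest: sym_mapD)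
  have formbound: "\<exists>M\<ge>0. \<forall>v. \<bar>\<omega> v (A v)\<bar> \<le> M * (norm v)\<^sup>2" if "linear A" for A
  proof -
    have "bilinear (\<lambda>u v. \<omega> u (A v))"
      by (rule bilinearI_real) (simp_all add: om linear_add[OF that] linear_cmul[OF that])
    from bilinear_bound_Basis[OF this] show ?thesis
      by (intro exI[of _ "\<Sum>i\<in>Basis. \<Sum>j\<in>Basis. \<bar>\<omega> i (A j)\<bar>"]) (simp add: sum_nonneg power2_eq_square)
  qed
  obtain M1 M2 M3 M4 where M: "M1 \<ge> 0" "M2 \<ge> 0" "M3 \<ge> 0" "M4 \<ge> 0"
    "\<And>v. \<bar>\<omega> v (A0 v)\<bar> \<le> M1 * (norm v)\<^sup>2" "\<And>v. \<bar>\<omega> v (A1 v - A0 v)\<bar> \<le> M2 * (norm v)\<^sup>2"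
    "\<And>v. \<bar>\<omega> v (E0 v)\<bar> \<le> M3 * (norm v)\<^sup>2" "\<And>v. \<bar>\<omega> v (E1 v)\<bar> \<le> M4 * (norm v)\<^sup>2"
    using formbound[OF linA(1)] formbound[OF linear_compose_sub[OF linA(2,1)]] formbound[OF linA(3)] formbound[OF linA(4)]
    by blast
  have bound: "\<exists>C\<ge>0. \<forall>s\<in>{0..1}. \<bar>f s\<bar> \<le> C" if "continuous_on {0..1} f" for f :: "real \<Rightarrow> real"
  proof -
    have "bounded (f ` {0..1})"
      by (intro compact_imp_bounded compact_continuous_image that compact_Icc)
    then obtain C where "\<forall>s\<in>{0..1}. \<bar>f s\<bar> \<le> C"
      by (auto simp: bounded_iff)
    then show ?thesis
      by (intro exI[of _ "max C 0"]) (auto simp: le_max_iff_disj)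
  qed
  have "\<exists>C\<ge>0. \<forall>s\<in>{0..1}. \<bar>M1 + \<bar>Q1 s\<bar> * M2 + \<bar>h * Q2 s\<bar> * M3 + \<bar>h * Q3 s\<bar> * M4\<bar> \<le> C"
    unfolding Q1_def Q2_def Q3_def by (intro bound continuous_intros)
  then obtain C0 where C0: "C0 \<ge> 0" "\<And>s. s \<in> {0..1} \<Longrightarrow> M1 + \<bar>Q1 s\<bar> * M2 + \<bar>h * Q2 s\<bar> * M3 + \<bar>h * Q3 s\<bar> * M4 \<le> C0"
    by (meson abs_le_D1)
  have "\<exists>C\<ge>0. \<forall>s\<in>{0..1}. \<bar>\<bar>Q1' s / h\<bar> * M2 + \<bar>Q2' s\<bar> * M3 + \<bar>Q3' s\<bar> * M4\<bar> \<le> C"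
    unfolding Q1'_def Q2'_def Q3'_def using h by (intro bound continuous_intros) auto
  then obtain C1 where C1: "C1 \<ge> 0" "\<And>s. s \<in> {0..1} \<Longrightarrow> \<bar>Q1' s / h\<bar> * M2 + \<bar>Q2' s\<bar> * M3 + \<bar>Q3' s\<bar> * M4 \<le> C1"
    by (meson abs_le_D1)
  have bH: "\<bar>\<omega> v (H s v)\<bar> \<le> C0 * (norm v)\<^sup>2" if s: "s \<in> {0..1}" for s v
  proof -
    have "\<bar>\<omega> v (H s v)\<bar> \<le> \<bar>\<omega> v (A0 v)\<bar> + \<bar>Q1 s\<bar> * \<bar>\<omega> v (A1 v - A0 v)\<bar> + \<bar>h * Q2 s\<bar> * \<bar>\<omega> v (E0 v)\<bar> + \<bar>h * Q3 s\<bar> * \<bar>\<omega> v (E1 v)\<bar>"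
      unfolding H_def by (simp only: om(2,6) abs_mult[symmetric]; linarith)
    also have "\<dots> \<le> M1 * (norm v)\<^sup>2 + \<bar>Q1 s\<bar> * (M2 * (norm v)\<^sup>2) + \<bar>h * Q2 s\<bar> * (M3 * (norm v)\<^sup>2) + \<bar>h * Q3 s\<bar> * (M4 * (norm v)\<^sup>2)"
      by (intro add_mono mult_left_mono M) auto
    also have "\<dots> = (M1 + \<bar>Q1 s\<bar> * M2 + \<bar>h * Q2 s\<bar> * M3 + \<bar>h * Q3 s\<bar> * M4) * (norm v)\<^sup>2"
      by (simp only: ring_distribs mult.assoc)
    also have "\<dots> \<le> C0 * (norm v)\<^sup>2"
      by (intro mult_right_mono C0 s) auto
    finally show ?thesis .
  qed
  have bH': "\<bar>\<omega> v (H' s v)\<bar> \<le> C1 * (norm v)\<^sup>2" if s: "s \<in> {0..1}" for s v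
  proof -
    have "\<bar>\<omega> v (H' s v)\<bar> \<le> \<bar>Q1' s / h\<bar> * \<bar>\<omega> v (A1 v - A0 v)\<bar> + \<bar>Q2' s\<bar> * \<bar>\<omega> v (E0 v)\<bar> + \<bar>Q3' s\<bar> * \<bar>\<omega> v (E1 v)\<bar>"
      unfolding H'_def by (simp only: om(2,6) abs_mult[symmetric]; linarith)
    also have "\<dots> \<le> \<bar>Q1' s / h\<bar> * (M2 * (norm v)\<^sup>2) + \<bar>Q2' s\<bar> * (M3 * (norm v)\<^sup>2) + \<bar>Q3' s\<bar> * (M4 * (norm v)\<^sup>2)"
      by (intro add_mono mult_left_mono M) auto
    also have "\<dots> = (\<bar>Q1' s / h\<bar> * M2 + \<bar>Q2' s\<bar> * M3 + \<bar>Q3' s\<bar> * M4) * (norm v)\<^sup>2"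
      by (simp only: ring_distribs mult.assoc)
    also have "\<dots> \<le> C1 * (norm v)\<^sup>2"
      by (intro mult_right_mono C1 s) auto
    finally show ?thesis .
  qed
  have bilH': "bilinear (\<lambda>x y. \<omega> x (H' s y))" for s
    using sym_mapD(1)[OF sH(2)[of s]]
    by (intro bilinearI_real) (simp_all add: om linear_add linear_cmul)
  have near: "\<exists>\<delta>>0. \<forall>s\<in>{0..1}. \<bar>s - s0\<bar> < \<delta> \<longrightarrow> (\<forall>v\<in>L0. v \<noteq> 0 \<longrightarrow> \<omega> v (H' s v) > 0)"
    if s0: "\<And>v. v \<in> L0 \<Longrightarrow> v \<noteq> 0 \<Longrightarrow> \<omega> v (H' s0 v) > 0" for s0
  proof -
    have lim: "((\<lambda>s. \<omega> x (H' s y)) \<longlongrightarrow> \<omega> x (H' s0 y)) (at s0 within {0..1})" for x y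
      unfolding H'_def Q1'_def Q2'_def Q3'_def using h
      by (intro tendsto_om tendsto_intros) auto
    obtain m where m: "m > 0" "\<forall>\<^sub>F s in at s0 within {0..1}. \<forall>v\<in>L0. \<omega> v (H' s v) \<ge> m * (norm v)\<^sup>2"
      using positive_definite_eventually[where B = "\<lambda>s x y. \<omega> x (H' s y)" and Fl = "at s0 within {0..1}",
          OF always_eventually[OF allI[OF bilH']] bilH' lim lagrangianD(1)[OF transvD(2)[OF T]] s0]
      by blast
    then obtain \<delta> where \<delta>: "\<delta> > 0" "\<And>s v. s \<in> {0..1} \<Longrightarrow> s \<noteq> s0 \<Longrightarrow> \<bar>s - s0\<bar> < \<delta> \<Longrightarrow> v \<in> L0 \<Longrightarrow> \<omega> v (H' s v) \<ge> m * (norm v)\<^sup>2"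
      unfolding eventually_at dist_real_def by blast
    have "\<omega> v (H' s v) > 0" if "s \<in> {0..1}" "\<bar>s - s0\<bar> < \<delta>" "v \<in> L0" "v \<noteq> 0" for s v
    proof (cases "s = s0")
      case True
      then show ?thesis using s0 that by simp
    next
      case False
      have "0 < m * (norm v)\<^sup>2"
        using m(1) that by simp
      then show ?thesis
        using \<delta>(2)[OF that(1) False that(2,3)] by linarith
    qed
    then show ?thesis
      using \<delta>(1) by blast
  qed
  have H'0: "H' 0 v = E0 v" "H' 1 v = E1 v" for v
    by (simp_all add: H'_def Q1'_def Q2'_def Q3'_def)
  obtain \<delta>0 where \<delta>0: "\<delta>0 > 0" "\<And>s v. s \<in> {0..1} \<Longrightarrow> \<bar>s - 0\<bar> < \<delta>0 \<Longrightarrow> v \<in> L0 \<Longrightarrow> v \<noteq> 0 \<Longrightarrow> \<omega> v (H' s v) > 0"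
    using near[of 0] pos0 unfolding H'0 by blast
  obtain \<delta>1 where \<delta>1: "\<delta>1 > 0" "\<And>s v. s \<in> {0..1} \<Longrightarrow> \<bar>s - 1\<bar> < \<delta>1 \<Longrightarrow> v \<in> L0 \<Longrightarrow> v \<noteq> 0 \<Longrightarrow> \<omega> v (H' s v) > 0"
    using near[of 1] pos1 unfolding H'0 by blast
  \<comment> \<open>Inside the unit interval \<open>P'\<close> changes sign where the distance from
    1/2 is the square root of 1/20, about 0.224. So it is non-negative within 1/5 of the ends and
    negative within 1/5 of the middle.\<close>
  define \<delta> where "\<delta> = min (1/5) (min \<delta>0 \<delta>1)"
  have \<delta>: "0 < \<delta>" "\<delta> \<le> 1/5" "\<delta> \<le> \<delta>0" "\<delta> \<le> \<delta>1"
    using \<delta>0(1) \<delta>1(1) by (auto simp: \<delta>_def)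
  \<comment> \<open>A lower bound for the modulus of \<open>P\<close> at distance at least \<delta>
    from the ends and 1/5 from the middle.\<close>
  define m where "m = 1/5 * (\<delta> * (1 - \<delta>))\<^sup>2"
  have m: "m > 0"
    using \<delta> by (simp add: m_def)
  \<comment> \<open>Near the middle \<open>P'\<close> is at most -1/100, so the first summand lets
    the perturbation outweigh the velocity bound \<open>C1\<close>; the second lets it outweigh
    \<open>C0\<close> where the modulus of \<open>P\<close> is at least \<open>m\<close>; the 1
    gives strictness.\<close>
  define K where "K = 100 * h * C1 + C0 / m + 1"
  have K: "K > 0" "K > 100 * h * C1" "K * m > C0"
  proof -
    have nn: "0 \<le> 100 * h * C1" "0 \<le> C0 / m"
      using h C1(1) C0(1) m by auto
    then show "K > 0" "K > 100 * h * C1"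
      unfolding K_def by linarith+
    have "K > C0 / m"
      using nn unfolding K_def by linarith
    then show "K * m > C0"
      using m by (simp add: pos_divide_less_eq)
  qed
  define A where "A t v = H (u t) v + (K * P (u t)) *\<^sub>R B v" for t v
  define A' where "A' t v = H' (u t) v + (K * (P' (u t) / h)) *\<^sub>R B v" for t v
  have "interpolant W L0 c d A0 A1 E0 E1 A A'"
    unfolding interpolant_def
  proof (intro conjI allI ballI)
    show "sym_map W L0 (A t)" "sym_map W L0 (A' t)" for t
      unfolding A_def A'_def by (intro comb sH B)+
    have uc: "u c = 0" "u d = 1"
      using h by (simp_all add: u_def h_def)
    show "A c = A0" "A d = A1" "A' c = E0" "A' d = E1"
      unfolding A_def A'_def uc H_def H'_def
      by (auto simp: Q1_def Q2_def Q3_def P_def Q1'_def Q2'_def Q3'_def P'_def)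
    show "((\<lambda>t. A t x) has_vector_derivative A' t x) (at t within S)" for t x S
    proof -
      have r: "((\<lambda>t. f t *\<^sub>R y) has_vector_derivative f' *\<^sub>R y) (at t within S)"
        if "(f has_real_derivative f') (at t within S)" for f f' and y :: 'a
        using that unfolding has_real_derivative_iff_has_vector_derivative
        by (rule bounded_linear.has_vector_derivative[OF bounded_linear_scaleR_left])
      have "((\<lambda>t. A0 x + Q1 (u t) *\<^sub>R (A1 x - A0 x) + (h * Q2 (u t)) *\<^sub>R E0 x + (h * Q3 (u t)) *\<^sub>R E1 x + (K * P (u t)) *\<^sub>R B x)
          has_vector_derivative 0 + (Q1' (u t) / h) *\<^sub>R (A1 x - A0 x) + (h * (Q2' (u t) / h)) *\<^sub>R E0 x + (h * (Q3' (u t) / h)) *\<^sub>R E1 x + (K * (P' (u t) / h)) *\<^sub>R B x)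
          (at t within S)"
        by (intro has_vector_derivative_add has_vector_derivative_const r DERIV_cmult chain dQ)
      then show ?thesis
        using h by (simp add: A_def A'_def H_def H'_def)
    qed
    show "continuous_on {c..d} (\<lambda>t. A' t x)" for x
      unfolding A'_def H'_def Q1'_def Q2'_def Q3'_def P'_def u_def using h
      by (intro continuous_intros) auto
    fix t assume t: "t \<in> {c..d}"
    define s where "s = u t"
    have s: "s \<in> {0..1}"
      using t h by (simp add: s_def u_def h_def field_simps)
    have fA: "\<omega> v (A t v) = \<omega> v (H s v) + K * P s * (norm v)\<^sup>2"
      and fA': "\<omega> v (A' t v) = \<omega> v (H' s v) + K * (P' s / h) * (norm v)\<^sup>2" if "v \<in> L0" for v
      using Bform[OF that] by (simp_all add: A_def A'_def s_def om)
    consider "s < \<delta> \<or> s > 1 - \<delta>" | "\<bar>s - 1/2\<bar> \<le> 1/5" | "\<delta> \<le> s" "s \<le> 1 - \<delta>" "\<bar>s - 1/2\<bar> > 1/5"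
      by linarith
    then show "(\<forall>v\<in>L0. v \<noteq> 0 \<longrightarrow> \<omega> v (A t v) \<noteq> 0) \<or> (\<forall>v\<in>L0. v \<noteq> 0 \<longrightarrow> \<omega> v (A' t v) \<noteq> 0)"
    proof cases
      case 1
      have "3/10 \<le> \<bar>s - 1/2\<bar>"
        using 1 \<delta>(2) by linarith
      then have "(3/10)\<^sup>2 \<le> (s - 1/2)\<^sup>2"
        using power_mono[of "3/10" "\<bar>s - 1/2\<bar>" 2] by simp
      then have "0 \<le> 5 * (s - 1/2)\<^sup>2 - 1/4"
        by (simp add: power2_eq_square)
      then have "0 \<le> P' s"
        unfolding P'_def using s by (intro mult_nonneg_nonneg) auto
      then have "0 \<le> K * (P' s / h) * (norm v)\<^sup>2" for v :: 'a
        using K(1) h by simp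
      moreover have "\<omega> v (H' s v) > 0" if "v \<in> L0" "v \<noteq> 0" for v
        using 1 \<delta>0(2)[OF s _ that] \<delta>1(2)[OF s _ that] \<delta>(3,4) s by fastforce
      ultimately have "\<omega> v (A' t v) > 0" if "v \<in> L0" "v \<noteq> 0" for v
        unfolding fA'[OF that(1)] using that by (simp add: add_pos_nonneg)
      then show ?thesis by fastforce
    next
      case 2
      then have sq: "(s - 1/2)\<^sup>2 \<le> 1/25"
        using power_mono[of "\<bar>s - 1/2\<bar>" "1/5" 2] by (simp add: power2_eq_square)
      have "s * (1 - s) = 1/4 - (s - 1/2)\<^sup>2"
        by (simp add: power2_eq_square algebra_simps)
      then have "s * (1 - s) \<ge> 1/5"
        using sq by simp
      then have "(1/5) * (1/20) \<le> (s * (1 - s)) * (1/4 - 5 * (s - 1/2)\<^sup>2)"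
        using sq by (intro mult_mono) auto
      then have "P' s \<le> - 1/100"
        unfolding P'_def by (simp add: algebra_simps)
      then have "K * (P' s / h) \<le> K * ((- 1/100) / h)"
        using K(1) h by (intro mult_left_mono divide_right_mono) auto
      also have "\<dots> < - C1"
        using K(2) h by (simp add: field_simps)
      finally have neg: "K * (P' s / h) < - C1" .
      have "\<omega> v (A' t v) < 0" if "v \<in> L0" "v \<noteq> 0" for v
      proof -
        have "K * (P' s / h) * (norm v)\<^sup>2 < - C1 * (norm v)\<^sup>2"
          using neg that by (intro mult_strict_right_mono) auto
        then show ?thesis
          unfolding fA'[OF that(1)] using bH'[OF s, of v] by (simp add: abs_le_iff)
      qed
      then show ?thesis by fastforce
    next
      case 3
      have "s * (1 - s) - \<delta> * (1 - \<delta>) = (s - \<delta>) * ((1 - \<delta>) - s)"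
        by (simp add: algebra_simps)
      moreover have "\<dots> \<ge> 0"
        using 3 by simp
      ultimately have "\<delta> * (1 - \<delta>) \<le> s * (1 - s)"
        by linarith
      then have "(\<delta> * (1 - \<delta>))\<^sup>2 \<le> (s * (1 - s))\<^sup>2"
        using \<delta> by (intro power_mono) auto
      moreover have "1/5 \<le> \<bar>1/2 - s\<bar>"
        using 3(3) by linarith
      ultimately have "m \<le> \<bar>1/2 - s\<bar> * (s * (1 - s))\<^sup>2"
        unfolding m_def by (intro mult_mono) auto
      also have "\<dots> = \<bar>P s\<bar>"
        by (simp add: P_def abs_mult)
      finally have "K * m \<le> K * \<bar>P s\<bar>"
        using K(1) by (intro mult_left_mono) auto
      also have "\<dots> = \<bar>K * P s\<bar>"
        using K(1) by (simp add: abs_mult)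
      finally have big: "C0 < \<bar>K * P s\<bar>"
        using K(3) by linarith
      have "\<omega> v (A t v) \<noteq> 0" if "v \<in> L0" "v \<noteq> 0" for v
      proof
        assume "\<omega> v (A t v) = 0"
        then have "\<omega> v (H s v) = - (K * P s * (norm v)\<^sup>2)"
          unfolding fA[OF that(1)] by linarith
        then have "\<bar>\<omega> v (H s v)\<bar> = \<bar>K * P s\<bar> * (norm v)\<^sup>2"
          by (simp add: abs_mult)
        moreover have "C0 * (norm v)\<^sup>2 < \<bar>K * P s\<bar> * (norm v)\<^sup>2"
          using big that by (intro mult_strict_right_mono) auto
        ultimately show False
          using bH[OF s, of v] by linarith
      qed
      then show ?thesis by blast
    qed
  qed
  then show ?thesis by blast
qed

text \<open>Prescribing the velocity at the end points makes concatenations continuously differentiable,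
  and its positivity makes the crossings at the joints regular.\<close>

definition good_path :: "'a set \<Rightarrow> (real \<Rightarrow> 'a set) \<Rightarrow> real \<Rightarrow> real \<Rightarrow> (real \<Rightarrow> 'a \<Rightarrow> 'a) \<Rightarrow> bool" where
  "good_path L0 l c d D \<longleftrightarrow> cont_lag {c..d} l \<and> (\<forall>x. continuous_on {c..d} (\<lambda>t. D t x))
    \<and> (\<forall>t\<in>{c..d}. \<forall>x. ((\<lambda>s. proj (l s) x) has_vector_derivative D t x) (at t within {c..d}))
    \<and> (\<forall>t\<in>{c..d}. \<forall>v\<in>l t \<inter> L0. v \<noteq> 0 \<longrightarrow> \<omega> v (D t v) \<noteq> 0)
    \<and> (\<forall>x. D c x = proj_velocity (l c) J x) \<and> (\<forall>x. D d x = proj_velocity (l d) J x)"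

text \<open>A form without non-zero null vectors is nondegenerate, because the polar form of
  \<open>u\<close> with itself is the value at \<open>u\<close>.\<close>

lemma good_path_regular:
  assumes L0: "lagrangian \<omega> L0" and good: "good_path L0 l a b D" and ab: "a < b"
  shows "regular_path \<omega> L0 l a b"
proof -
  have c: "cont_lag {a..b} l" and contD: "\<And>x. continuous_on {a..b} (\<lambda>t. D t x)"
    and der: "\<And>t x. t \<in> {a..b} \<Longrightarrow> ((\<lambda>s. proj (l s) x) has_vector_derivative D t x) (at t within {a..b})"
    and nz: "\<And>t v. t \<in> {a..b} \<Longrightarrow> v \<in> l t \<inter> L0 \<Longrightarrow> v \<noteq> 0 \<Longrightarrow> \<omega> v (D t v) \<noteq> 0"
    using good by (auto simp: good_path_def)
  have "C1_lag_path \<omega> l a b"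
    unfolding C1_lag_path_def lag_path_cont_lag using c contD der by blast
  moreover have "nondegenerate_on (crossing_form \<omega> l a b t) (l t \<inter> L0)" if t: "t \<in> {a..b}" for t
    unfolding nondegenerate_on_def
  proof (intro ballI impI)
    fix u assume u: "u \<in> l t \<inter> L0" and zero: "\<forall>v\<in>l t \<inter> L0. polar (crossing_form \<omega> l a b t) u v = 0"
    have ex: "\<exists>d. ((\<lambda>s. proj (l s) x) has_vector_derivative d) (at t within {a..b})" for x
      using der[OF t] by blast
    \<comment> \<open>The value at \<open>u + u\<close> is computed with a velocity that is linear
      in the vector, a property that \<open>good_path\<close> does not record for
      \<open>D\<close>.\<close>
    obtain D' where D': "linear D'" "\<And>x. ((\<lambda>s. proj (l s) x) has_vector_derivative D' x) (at t within {a..b})"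
      using proj_derivative_linear[OF t lagrangianD(1)[OF cont_lagD(1)[OF c]] ex] by blast
    have "u + u \<in> l t"
      using u lagrangianD(1)[OF cont_lagD(1)[OF c t]] by (auto intro: subspace_add)
    then have "crossing_form \<omega> l a b t (u + u) = 4 * \<omega> u (D' u)"
      using crossing_form_velocity[OF c ab t D'(2)] by (simp add: linear_add[OF D'(1)] om)
    moreover have cu: "crossing_form \<omega> l a b t u = \<omega> u (D' u)"
      using crossing_form_velocity[OF c ab t D'(2)] u by simp
    moreover have "polar (crossing_form \<omega> l a b t) u u = 0"
      using zero u by blast
    ultimately have "\<omega> u (D' u) = 0"
      by (simp add: polar_def)
    moreover have "crossing_form \<omega> l a b t u = \<omega> u (D t u)"
      using crossing_form_velocity[OF c ab t der[OF t]] u by simp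
    ultimately show "u = 0"
      using cu nz[OF t u] by auto
  qed
  ultimately show ?thesis
    by (simp add: regular_path_def)
qed

text \<open>Symmetric maps form a vector space, so in one chart the path can be exchanged for an
  interpolant with the same ends, and the segment between the two symmetric maps is a homotopy with
  fixed end points.\<close>

lemma good_path_in_chart:
  assumes cd: "c < d" and cont: "cont_lag {c..d} l" and T: "transv W L0"
    and tr: "\<And>t. t \<in> {c..d} \<Longrightarrow> transv W (l t)"
  shows "\<exists>l' D. good_path L0 l' c d D \<and> lag_homotopic \<omega> c d l l'"
proof -
  have L0: "lagrangian \<omega> L0"
    by (rule transvD(2)[OF T])
  have tc: "transv W (l c)" and td: "transv W (l d)"
    using tr cd by auto
  obtain A A' where "interpolant W L0 c d (gr W (l c)) (gr W (l d)) (unit_map W (l c)) (unit_map W (l d)) A A'"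
    using regular_interpolation[OF cd T sym_map_gr[OF tc L0] sym_map_gr[OF td L0]
          unit_map(1)[OF tc T] unit_map(1)[OF td T] unit_map(3)[OF tc T] unit_map(3)[OF td T]]
    by blast
  then have sA: "\<And>t. sym_map W L0 (A t)" and sA': "\<And>t. sym_map W L0 (A' t)"
    and ends: "A c = gr W (l c)" "A d = gr W (l d)" "A' c = unit_map W (l c)" "A' d = unit_map W (l d)"
    and der: "\<And>t x S. ((\<lambda>t. A t x) has_vector_derivative A' t x) (at t within S)"
    and contA': "\<And>x. continuous_on {c..d} (\<lambda>t. A' t x)"
    and reg: "\<And>t. t \<in> {c..d} \<Longrightarrow> (\<forall>v\<in>L0. v \<noteq> 0 \<longrightarrow> \<omega> v (A t v) \<noteq> 0) \<or> (\<forall>v\<in>L0. v \<noteq> 0 \<longrightarrow> \<omega> v (A' t v) \<noteq> 0)"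
    unfolding interpolant_def by blast+
  have contA: "continuous_on S (\<lambda>t. A t x)" for x and S :: "real set"
    unfolding continuous_on_eq_continuous_within
    using has_vector_derivative_continuous[OF der] by blast
  define l' where "l' t = graph L0 (A t)" for t
  define K where "K t x = A' t (x + gr W L0 x)" for t x
  define D where "D t = proj_velocity (l' t) (K t)" for t
  have linK: "linear (K t)" for t
    unfolding K_def using sym_mapD(1)[OF sA'[of t]]
    by (intro linearI) (simp_all add: gr_simps[OF T] linear_add linear_cmul algebra_simps)
  have tr': "transv W (l' t)" for t
    unfolding l'_def by (rule transv_graph(1)[OF T sA])
  have lag': "lagrangian \<omega> (l' t)" and sub': "subspace (l' t)" for t
    using transvD(2,5)[OF tr'] by auto
  have c': "cont_lag {c..d} l'"
    unfolding l'_def by (rule cont_lag_graph[OF T sA contA])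
  have l'_end: "l' c = l c" "l' d = l d"
    unfolding l'_def ends using graph_gr[OF T tc] graph_gr[OF T td] by auto
  have "good_path L0 l' c d D"
    unfolding good_path_def
  proof (intro conjI allI ballI impI)
    show "cont_lag {c..d} l'"
      by (rule c')
    have contP: "continuous_on {c..d} (\<lambda>t. proj (l' t) (y t))" if "continuous_on {c..d} y" for y
      by (rule continuous_on_operator[OF linear_proj[OF sub'] _ that])
        (use c' in \<open>auto simp: cont_lag_def\<close>)
    have contK0: "continuous_on {c..d} (\<lambda>t. K t x)" for x
      unfolding K_def by (rule contA')
    have contK: "continuous_on {c..d} (\<lambda>t. K t (y t))" if "continuous_on {c..d} y" for y
      by (rule continuous_on_operator[OF linK contK0 that])
    have contadj: "continuous_on {c..d} (\<lambda>t. adjoint (K t) (y t))" if "continuous_on {c..d} y" for y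
      by (rule continuous_on_operator[OF adjoint_linear[OF linK] continuous_on_adjoint[OF linK contK0] that])
    show "continuous_on {c..d} (\<lambda>t. D t x)" for x
      unfolding D_def proj_velocity_def
      by (intro continuous_intros contP contK contadj)
    show "((\<lambda>s. proj (l' s) x) has_vector_derivative D t x) (at t within {c..d})" if "t \<in> {c..d}" for t x
      unfolding l'_def D_def K_def
      by (rule graph_derivative[OF T sA that sym_mapD(1)[OF sA'] der])
    show "\<omega> v (D t v) \<noteq> 0" if t: "t \<in> {c..d}" and v: "v \<in> l' t \<inter> L0" "v \<noteq> 0" for t v
    proof -
      \<comment> \<open>A common vector of \<open>l' t\<close> and \<open>L0\<close> has coordinate
        zero. If it is non-zero, the first alternative of the interpolant fails at \<open>t\<close>
        and the second must hold.\<close>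
      have "A t v = 0"
        using gr_eq_0[OF tr', of v t] transv_graph(2)[OF T sA, of v t] v by (simp add: l'_def)
      then have "\<omega> v (A' t v) \<noteq> 0"
        using reg[OF t] v by (metis IntD2 om(10))
      moreover have "adjoint (K t) 0 = 0"
        by (rule linear_0[OF adjoint_linear[OF linK]])
      then have "D t v = K t v - proj (l' t) (K t v)"
        using v proj_self[OF sub', of v t] linear_0[OF linear_proj[OF sub']]
        by (simp add: D_def proj_velocity_def)
      moreover have "\<omega> v (proj (l' t) (K t v)) = 0"
        using v proj_mem_orthogonal(1)[OF sub'] lagrangianD(3)[OF lag'] by blast
      moreover have "K t v = A' t v"
        using gr_eq_0[OF T, of v] v by (simp add: K_def)
      ultimately show ?thesis
        by (simp add: om)
    qed
    \<comment> \<open>The end velocities are prescribed in this chart, but modulo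
      \<open>l' t\<close> they coincide with \<open>J\<close>, which knows no chart. So pieces from
      different charts fit together.\<close>
    have vel: "D t x = proj_velocity (l' t) J x"
      if A: "A t = gr W (l' t)" "A' t = unit_map W (l' t)" for t x
      unfolding D_def
    proof (rule proj_velocity_cong[OF sub' linK linear_J])
      fix x assume x: "x \<in> l' t"
      then obtain v where v: "v \<in> L0" "x = v + A t v"
        by (auto simp: l'_def graph_def)
      note v2 = v(2)[unfolded A(1)]
      have "gr W L0 x = - gr W (l' t) v"
        unfolding v2 using gr_eq_0[OF T v(1)] gr_on_W[OF T gr_mem(1)[OF tr']] by (simp add: gr_simps[OF T])
      then have "K t x = - gr W (l' t) (J x)"
        unfolding K_def A(2) unit_map_def using v2 by simp
      then have "K t x - J x = - (J x + gr W (l' t) (J x))"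
        by simp
      then show "K t x - J x \<in> l' t"
        using gr_mem(2)[OF tr'] sub' by (metis subspace_neg)
    qed
    show "D c x = proj_velocity (l' c) J x" "D d x = proj_velocity (l' d) J x" for x
      by (rule vel; simp add: l'_end ends)+
  qed
  moreover have "lag_homotopic \<omega> c d l l'"
    unfolding lag_homotopic_def
  proof (intro exI conjI)
    define B where "B = (\<lambda>(s::real, t) v. (1 - s) *\<^sub>R gr W (l t) v + s *\<^sub>R A t v)"
    let ?H = "\<lambda>s t. graph L0 (B (s, t))"
    note sub = transvD(4)[OF T]
    have sB: "sym_map W L0 (B q)" if "q \<in> {0..1} \<times> {c..d}" for q
    proof -
      from that obtain s t where q: "q = (s, t)" "t \<in> {c..d}"
        by (cases q) auto
      then show ?thesis
        unfolding B_def using sym_map_gr[OF tr[OF q(2)] L0] sA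
        by (auto intro!: sym_map_add[OF sub] sym_map_scale[OF sub])
    qed
    have "continuous_on {c..d} (\<lambda>t. gr W (l t) x)" for x
      unfolding continuous_on_def
      using gr_tendsto[OF tr cont_lagD(2,3)[OF cont]] by blast
    then have "continuous_on ({0..1} \<times> {c..d}) (\<lambda>q. gr W (l (snd q)) x)" for x
      by (rule continuous_on_compose2[OF _ continuous_on_snd[OF continuous_on_id]]) auto
    moreover have "continuous_on ({0..1::real} \<times> {c..d}) (\<lambda>q. A (snd q) x)" for x
      by (rule continuous_on_compose2[OF contA continuous_on_snd[OF continuous_on_id] order_refl])
    ultimately have "continuous_on ({0..1} \<times> {c..d}) (\<lambda>q. B q x)" for x
      unfolding B_def case_prod_beta by (intro continuous_intros)
    from cont_lag_graph[OF T sB this]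
    have cB: "cont_lag ({0..1} \<times> {c..d}) (\<lambda>q. graph L0 (B q))" .
    show "\<forall>s\<in>{0..1}. \<forall>t\<in>{c..d}. lagrangian \<omega> (?H s t)"
      using cB by (auto simp: cont_lag_def)
    show "\<forall>x. continuous_on ({0..1} \<times> {c..d}) (\<lambda>(s, t). proj (?H s t) x)"
      using cB by (simp add: cont_lag_def case_prod_beta)
    show "\<forall>t\<in>{c..d}. ?H 0 t = l t \<and> ?H 1 t = l' t"
      using graph_gr[OF T tr] by (simp add: B_def l'_def)
    have "B (s, c) = gr W (l c)" "B (s, d) = gr W (l d)" for s
      by (auto simp: B_def ends algebra_simps)
    then show "\<forall>s\<in>{0..1}. ?H s c = l c \<and> ?H s d = l d"
      using graph_gr[OF T tc] graph_gr[OF T td] by simp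
  qed
  ultimately show ?thesis by blast
qed

section \<open>Concatenation and global existence of regular representatives\<close>

definition homotopy_rel :: "real \<Rightarrow> real \<Rightarrow> (real \<Rightarrow> 'a set) \<Rightarrow> (real \<Rightarrow> 'a set) \<Rightarrow> (real \<Rightarrow> real \<Rightarrow> 'a set) \<Rightarrow> bool" where
  "homotopy_rel a b l l' H \<longleftrightarrow> (\<forall>s\<in>{0..1}. \<forall>t\<in>{a..b}. lagrangian \<omega> (H s t))
    \<and> (\<forall>x. continuous_on ({0..1} \<times> {a..b}) (\<lambda>(s,t). proj (H s t) x))
    \<and> (\<forall>t\<in>{a..b}. H 0 t = l t \<and> H 1 t = l' t)
    \<and> (\<forall>s\<in>{0..1}. H s a = l a \<and> H s b = l b)"

lemma lag_homotopic_iff: "lag_homotopic \<omega> a b l l' \<longleftrightarrow> (\<exists>H. homotopy_rel a b l l' H)"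
  by (simp add: lag_homotopic_def homotopy_rel_def)

lemma homotopy_relD:
  assumes "homotopy_rel a b l l' H"
  shows "\<And>s t. s \<in> {0..1} \<Longrightarrow> t \<in> {a..b} \<Longrightarrow> lagrangian \<omega> (H s t)"
    "\<And>x. continuous_on ({0..1} \<times> {a..b}) (\<lambda>(s,t). proj (H s t) x)"
    "\<And>t. t \<in> {a..b} \<Longrightarrow> H 0 t = l t \<and> H 1 t = l' t"
    "\<And>s. s \<in> {0..1} \<Longrightarrow> H s a = l a \<and> H s b = l b"
  using assms unfolding homotopy_rel_def by blast+

lemma has_vector_derivative_Un:
  fixes f :: "real \<Rightarrow> 'b::real_normed_vector"
  assumes "t \<in> S1 \<Longrightarrow> (f has_vector_derivative D) (at t within S1)"
    and "t \<in> S2 \<Longrightarrow> (f has_vector_derivative D) (at t within S2)" and "closed S1" "closed S2"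
  shows "(f has_vector_derivative D) (at t within (S1 \<union> S2))"
proof -
  have "(f has_vector_derivative D) (at t within S)" if "t \<in> S \<Longrightarrow> (f has_vector_derivative D) (at t within S)" "closed S" for S
  proof (cases "t \<in> S")
    case False
    then have "at t within S = bot"
      using that(2) by (meson closed_limpt trivial_limit_within)
    then show ?thesis
      unfolding has_vector_derivative_iff_quotient by simp
  qed (use that in auto)
  then show ?thesis
    using assms unfolding has_vector_derivative_iff_quotient unfolding at_within_union
    by (intro filterlim_sup) blast+
qed

lemma good_path_join:
  assumes ced: "c < e" "e < d"
    and g1: "good_path L0 l1 c e D1" and h1: "lag_homotopic \<omega> c e l l1"
    and g2: "good_path L0 l2 e d D2" and h2: "lag_homotopic \<omega> e d l l2"
  shows "\<exists>l' D. good_path L0 l' c d D \<and> lag_homotopic \<omega> c d l l'"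
proof -
  have U: "{c..d} = {c..e} \<union> {e..d}"
    using ced by auto
  obtain H1 where "homotopy_rel c e l l1 H1"
    using h1 unfolding lag_homotopic_iff by blast
  note H1 = homotopy_relD[OF this]
  obtain H2 where "homotopy_rel e d l l2 H2"
    using h2 unfolding lag_homotopic_iff by blast
  note H2 = homotopy_relD[OF this]
  have le: "l1 e = l e" "l2 e = l e"
    using H1(3)[of e] H1(4)[of 1] H2(3)[of e] H2(4)[of 1] ced by auto
  define l' where "l' t = (if t \<le> e then l1 t else l2 t)" for t
  define D where "D t = (if t \<le> e then D1 t else D2 t)" for t
  have l'1: "l' t = l1 t" if "t \<in> {c..e}" for t
    using that by (simp add: l'_def)
  have l'2: "l' t = l2 t" if "t \<in> {e..d}" for t
    using that le by (auto simp: l'_def)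
  have G1: "cont_lag {c..e} l1" "\<And>x. continuous_on {c..e} (\<lambda>t. D1 t x)"
     "\<And>t x. t \<in> {c..e} \<Longrightarrow> ((\<lambda>s. proj (l1 s) x) has_vector_derivative D1 t x) (at t within {c..e})"
     "\<And>t v. t \<in> {c..e} \<Longrightarrow> v \<in> l1 t \<inter> L0 \<Longrightarrow> v \<noteq> 0 \<Longrightarrow> \<omega> v (D1 t v) \<noteq> 0"
     "\<And>x. D1 c x = proj_velocity (l1 c) J x" "\<And>x. D1 e x = proj_velocity (l1 e) J x"
    using g1 by (auto simp: good_path_def)
  have G2: "cont_lag {e..d} l2" "\<And>x. continuous_on {e..d} (\<lambda>t. D2 t x)"
     "\<And>t x. t \<in> {e..d} \<Longrightarrow> ((\<lambda>s. proj (l2 s) x) has_vector_derivative D2 t x) (at t within {e..d})"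
     "\<And>t v. t \<in> {e..d} \<Longrightarrow> v \<in> l2 t \<inter> L0 \<Longrightarrow> v \<noteq> 0 \<Longrightarrow> \<omega> v (D2 t v) \<noteq> 0"
     "\<And>x. D2 e x = proj_velocity (l2 e) J x" "\<And>x. D2 d x = proj_velocity (l2 d) J x"
    using g2 by (auto simp: good_path_def)
  \<comment> \<open>Both pieces reach the joint with the velocity that \<open>J\<close> induces at
    \<open>l e\<close>.\<close>
  have De: "D1 e = D2 e"
    using G1(6) G2(5) le by auto
  have D1: "D t = D1 t" if "t \<in> {c..e}" for t
    using that by (simp add: D_def)
  have D2: "D t = D2 t" if "t \<in> {e..d}" for t
    using that De by (auto simp: D_def)
  have contU: "continuous_on {c..d} f" if "continuous_on {c..e} f" "continuous_on {e..d} f" for f :: "real \<Rightarrow> 'a"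
    unfolding U by (rule continuous_on_closed_Un[OF _ _ that]) auto
  have "good_path L0 l' c d D"
    unfolding good_path_def
  proof (intro conjI allI ballI impI)
    show "cont_lag {c..d} l'"
      unfolding cont_lag_def
    proof (intro conjI ballI allI)
      show "lagrangian \<omega> (l' t)" if "t \<in> {c..d}" for t
        using that l'1 l'2 cont_lagD(1)[OF G1(1)] cont_lagD(1)[OF G2(1)] unfolding U by auto
      show "continuous_on {c..d} (\<lambda>t. proj (l' t) x)" for x
      proof (rule contU)
        have k: "continuous_on {c..e} (\<lambda>t. proj (l1 t) x)" "continuous_on {e..d} (\<lambda>t. proj (l2 t) x)"
          using G1(1) G2(1) by (simp_all add: cont_lag_def)
        show "continuous_on {c..e} (\<lambda>t. proj (l' t) x)"
          by (rule iffD1[OF continuous_on_cong[OF refl] k(1)]) (simp add: l'1)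
        show "continuous_on {e..d} (\<lambda>t. proj (l' t) x)"
          by (rule iffD1[OF continuous_on_cong[OF refl] k(2)]) (simp add: l'2)
      qed
    qed
    show "continuous_on {c..d} (\<lambda>t. D t x)" for x
    proof (rule contU)
      show "continuous_on {c..e} (\<lambda>t. D t x)"
        by (rule iffD1[OF continuous_on_cong[OF refl] G1(2)[of x]]) (simp add: D1)
      show "continuous_on {e..d} (\<lambda>t. D t x)"
        by (rule iffD1[OF continuous_on_cong[OF refl] G2(2)[of x]]) (simp add: D2)
    qed
    show "((\<lambda>s. proj (l' s) x) has_vector_derivative D t x) (at t within {c..d})" if "t \<in> {c..d}" for t x
      unfolding U
    proof (rule has_vector_derivative_Un)
      assume t: "t \<in> {c..e}"
      show "((\<lambda>s. proj (l' s) x) has_vector_derivative D t x) (at t within {c..e})"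
        unfolding D1[OF t] by (rule has_vector_derivative_transform[OF t _ G1(3)[OF t]]) (simp add: l'1)
    next
      assume t: "t \<in> {e..d}"
      show "((\<lambda>s. proj (l' s) x) has_vector_derivative D t x) (at t within {e..d})"
        unfolding D2[OF t] by (rule has_vector_derivative_transform[OF t _ G2(3)[OF t]]) (simp add: l'2)
    qed auto
    show "\<omega> v (D t v) \<noteq> 0" if "t \<in> {c..d}" "v \<in> l' t \<inter> L0" "v \<noteq> 0" for t v
      using that G1(4) G2(4) l'1 l'2 D1 D2 unfolding U by (metis UnE)
    show "D c x = proj_velocity (l' c) J x" "D d x = proj_velocity (l' d) J x" for x
      using G1(5) G2(6) ced l'1[of c] l'2[of d] D1[of c] D2[of d] by auto
  qed
  moreover have "lag_homotopic \<omega> c d l l'"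
    unfolding lag_homotopic_def
  proof (intro exI conjI allI ballI)
    let ?H = "\<lambda>s t. if t \<le> e then H1 s t else H2 s t"
    have K1: "?H s t = H1 s t" if "t \<in> {c..e}" for s t
      using that by simp
    have K2: "?H s t = H2 s t" if "s \<in> {0..1}" "t \<in> {e..d}" for s t
      using that H1(4)[of s] H2(4)[of s] by auto
    show "lagrangian \<omega> (?H s t)" if "s \<in> {0..1}" "t \<in> {c..d}" for s t
      using that H1(1) H2(1) by auto
    have US: "{0..1::real} \<times> {c..d} = {0..1} \<times> {c..e} \<union> {0..1} \<times> {e..d}"
      unfolding U by blast
    show "continuous_on ({0..1} \<times> {c..d}) (\<lambda>(s, t). proj (?H s t) x)" for x
      unfolding US
    proof (rule continuous_on_closed_Un)
      show "continuous_on ({0..1} \<times> {c..e}) (\<lambda>(s, t). proj (?H s t) x)"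
        by (rule iffD1[OF continuous_on_cong[OF refl] H1(2)[of x]]) auto
      show "continuous_on ({0..1} \<times> {e..d}) (\<lambda>(s, t). proj (?H s t) x)"
        by (rule iffD1[OF continuous_on_cong[OF refl] H2(2)[of x]]) (use K2 in auto)
    qed (intro closed_Times closed_atLeastAtMost)+
    show "?H 0 t = l t" "?H 1 t = l' t" if "t \<in> {c..d}" for t
      using that H1(3)[of t] H2(3)[of t] by (auto simp: l'_def)
    show "?H s c = l c" "?H s d = l d" if "s \<in> {0..1}" for s
      using that H1(4) H2(4) ced by auto
  qed
  ultimately show ?thesis by blast
qed

text \<open>Near each time the path stays in one chart, where a good replacement exists; interval
  induction concatenates the replacements.\<close>

lemma regular_representative:
  assumes L0: "lagrangian \<omega> L0" and c: "cont_lag {a..b} l" and ab: "a < b"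
  shows "\<exists>l'. regular_path \<omega> L0 l' a b \<and> lag_homotopic \<omega> a b l l'"
proof -
  define P where "P c d \<longleftrightarrow> (a \<le> c \<and> c < d \<and> d \<le> b \<longrightarrow>
    (\<exists>l' D. good_path L0 l' c d D \<and> lag_homotopic \<omega> c d l l'))" for c d
  have "P a b"
    using less_imp_le[OF ab]
  proof (induction a b rule: Bolzano)
    case (trans p q r)
    show ?case
    proof (cases "p < q \<and> q < r \<and> a \<le> p \<and> r \<le> b")
      case True
      then obtain l1 D1 l2 D2 where "good_path L0 l1 p q D1" "lag_homotopic \<omega> p q l l1"
          "good_path L0 l2 q r D2" "lag_homotopic \<omega> q r l l2"
        using trans(1,2) unfolding P_def by auto
      then show ?thesis
        unfolding P_def using good_path_join True by blast
    next
      case False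
      then show ?thesis
        using trans by (cases "p = q"; cases "q = r") (auto simp: P_def)
    qed
  next
    case (local x)
    then have x: "x \<in> {a..b}" by simp
    obtain W where W: "transv W L0" "transv W (l x)"
      using transv_ex[OF L0 cont_lagD(1)[OF c x]] by blast
    have "\<forall>\<^sub>F t in at x within {a..b}. transv W (l t)"
      by (rule transv_eventually[OF W(2) cont_lagD(2,3)[OF c x]])
    then obtain e where e: "e > 0" "\<And>t. t \<in> {a..b} \<Longrightarrow> t \<noteq> x \<Longrightarrow> \<bar>t - x\<bar> < e \<Longrightarrow> transv W (l t)"
      unfolding eventually_at dist_real_def by blast
    have "P p q" if pq: "p \<le> x" "x \<le> q" "q - p < e" for p q
      unfolding P_def
    proof (intro impI)
      assume *: "a \<le> p \<and> p < q \<and> q \<le> b"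
      show "\<exists>l' D. good_path L0 l' p q D \<and> lag_homotopic \<omega> p q l l'"
      proof (rule good_path_in_chart[OF _ _ W(1)])
        show "p < q" "cont_lag {p..q} l"
          using * c by (auto intro: cont_lag_subset)
        show "transv W (l t)" if "t \<in> {p..q}" for t
          using e(2)[of t] W(2) that pq * by (cases "t = x") auto
      qed
    qed
    then show ?case
      using e(1) by blast
  qed
  then show ?thesis
    using good_path_regular[OF L0 _ ab] ab unfolding P_def by blast
qed

section \<open>The Maslov index as the increment of an index function\<close>

text \<open>The filter at \<open>g r\<close> leaves out the point itself; injectivity keeps
  \<open>g\<close> away from that value, so the eventual statement can be pulled back.\<close>

lemma index_fun_compose:
  assumes F: "index_fun L0 l S F" and g: "continuous_on R g" "g ` R \<subseteq> S" "inj_on g R"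
  shows "index_fun L0 (\<lambda>r. l (g r)) R (\<lambda>r. F (g r))"
  unfolding index_fun_def
proof (intro ballI allI impI)
  fix r W assume r: "r \<in> R" and W: "transv W L0" "transv W (l (g r))"
  have "filterlim g (at (g r) within S) (at r within R)"
    unfolding filterlim_at
  proof
    show "\<forall>\<^sub>F x in at r within R. g x \<in> S \<and> g x \<noteq> g r"
      unfolding eventually_at_filter using g(2,3) r by (intro always_eventually) (auto simp: inj_on_def)
    show "(g \<longlongrightarrow> g r) (at r within R)"
      using g(1) r by (simp add: continuous_on_def)
  qed
  from eventually_compose_filterlim[OF index_funD[OF F _ W] this]
  show "\<forall>\<^sub>F q in at r within R. F (g q) - int (chart_index L0 W (l (g q))) = F (g r) - int (chart_index L0 W (l (g r)))"
    using g(2) r by blast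
qed

text \<open>Zero is an index function of a constant family, and uniqueness up to a constant does the
  rest.\<close>

lemma index_fun_const:
  assumes L0: "lagrangian \<omega> L0" and L: "lagrangian \<omega> L" and con: "connected S"
    and F: "index_fun L0 (\<lambda>_. L) S F" and pq: "p \<in> S" "q \<in> S"
  shows "F p = F q"
proof -
  have "index_fun L0 (\<lambda>_. L) S (\<lambda>_. 0)"
    by (simp add: index_fun_def)
  moreover have "cont_lag S (\<lambda>_. L)"
    using L by (simp add: cont_lag_def)
  ultimately show ?thesis
    using index_fun_unique[OF L0 _ con F _ pq] by fastforce
qed

lemma index_fun_cong:
  assumes "\<And>p. p \<in> S \<Longrightarrow> l p = l' p"
  shows "index_fun L0 l S F \<longleftrightarrow> index_fun L0 l' S F"
proof -
  have "index_fun L0 l' S F" if "index_fun L0 l S F" "\<And>p. p \<in> S \<Longrightarrow> l p = l' p" for l l'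
    unfolding index_fun_def
  proof (intro ballI allI impI)
    fix p W assume p: "p \<in> S" and W: "transv W L0" "transv W (l' p)"
    have "\<forall>\<^sub>F q in at p within S. q \<in> S"
      by (simp add: eventually_at_filter)
    with index_funD[OF that(1) p W(1)] W(2) that(2)[OF p]
    have "\<forall>\<^sub>F q in at p within S. q \<in> S \<and> F q - int (chart_index L0 W (l q)) = F p - int (chart_index L0 W (l p))"
      by (simp add: eventually_conj)
    then show "\<forall>\<^sub>F q in at p within S. F q - int (chart_index L0 W (l' q)) = F p - int (chart_index L0 W (l' p))"
      by eventually_elim (use that(2) p in auto)
  qed
  then show ?thesis
    using assms by metis
qed

text \<open>Take an index function of the whole homotopy. On the two edges where the Lagrangian is
  fixed it is constant, so the other two edges have equal increments.\<close>

lemma index_fun_homotopy: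
  assumes L0: "lagrangian \<omega> L0" and ab: "a < b" and hom: "lag_homotopic \<omega> a b l l'"
    and c: "cont_lag {a..b} l" and F: "index_fun L0 l {a..b} F"
  shows "\<exists>F'. index_fun L0 l' {a..b} F' \<and> F' b - F' a = F b - F a"
proof -
  obtain H where "homotopy_rel a b l l' H"
    using hom unfolding lag_homotopic_iff by blast
  note H = homotopy_relD[OF this]
  let ?h = "\<lambda>q. H (fst q) (snd q)"
  have ch: "cont_lag ({0..1} \<times> {a..b}) ?h"
    unfolding cont_lag_def using H(1,2) by (auto simp: case_prod_beta)
  obtain G where G: "index_fun L0 ?h ({0..1} \<times> {a..b}) G"
    using index_fun_rectangle[OF L0 ch] ab by auto
  have row: "index_fun L0 (\<lambda>t. H s t) {a..b} (\<lambda>t. G (s, t))" if "s \<in> {0..1}" for s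
  proof -
    have "index_fun L0 (\<lambda>t. ?h (s, t)) {a..b} (\<lambda>t. G (s, t))"
      by (rule index_fun_compose[OF G])
        (use that in \<open>auto simp: inj_on_def intro!: continuous_on_Pair continuous_on_const continuous_on_id\<close>)
    then show ?thesis by simp
  qed
  have col: "G (0, t) = G (1, t)" if t: "t \<in> {a..b}" and cst: "\<And>s. s \<in> {0..1} \<Longrightarrow> H s t = L" for t L
  proof -
    have "index_fun L0 (\<lambda>s. ?h (s, t)) {0..1} (\<lambda>s. G (s, t))"
      by (rule index_fun_compose[OF G])
        (use t in \<open>auto simp: inj_on_def intro!: continuous_on_Pair continuous_on_const continuous_on_id\<close>)
    then have "index_fun L0 (\<lambda>s. H s t) {0..1} (\<lambda>s. G (s, t))"
      by simp
    then have "index_fun L0 (\<lambda>_. L) {0..1} (\<lambda>s. G (s, t))"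
      by (rule iffD1[OF index_fun_cong, rotated]) (rule cst)
    from index_fun_const[OF L0 _ connected_Icc this, of 0 1] show ?thesis
      using cst[of 0] H(1)[of 0 t] t by auto
  qed
  have "index_fun L0 l {a..b} (\<lambda>t. G (0, t))"
    by (rule iffD1[OF index_fun_cong row[of 0]]) (use H(3) in auto)
  from index_fun_unique[OF L0 c connected_Icc F this, of b a]
  have "F b - F a = G (0, b) - G (0, a)"
    using ab by fastforce
  moreover have "G (0, a) = G (1, a)" "G (0, b) = G (1, b)"
    using col[of a "l a"] col[of b "l b"] H(4) ab by auto
  moreover have "index_fun L0 l' {a..b} (\<lambda>t. G (1, t))"
    by (rule iffD1[OF index_fun_cong row[of 1]]) (use H(3) in auto)
  ultimately show ?thesis
    by (intro exI[of _ "\<lambda>t. G (1, t)"]) auto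
qed

text \<open>Every regular representative has the crossing sum \<open>F b - F a\<close>, and one
  exists; this settles the definite description in \<open>iota_CLM\<close>.\<close>

theorem iota_CLM_eq_index_difference:
  assumes L0: "lagrangian \<omega> L0" and ab: "a < b" and c: "cont_lag {a..b} l"
    and F: "index_fun L0 l {a..b} F"
  shows "iota_CLM \<omega> L0 l a b = F b - F a"
proof -
  have val: "crossing_sum \<omega> L0 l' a b = F b - F a"
    if "regular_path \<omega> L0 l' a b" "lag_homotopic \<omega> a b l l'" for l'
    using index_fun_homotopy[OF L0 ab that(2) c F] crossing_sum_eq_index_difference[OF L0 that(1) ab]
    by fastforce
  show ?thesis
    unfolding iota_CLM_def
  proof (rule the_equality)
    show "\<exists>l'. regular_path \<omega> L0 l' a b \<and> lag_homotopic \<omega> a b l l' \<and> F b - F a = crossing_sum \<omega> L0 l' a b"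
      using regular_representative[OF L0 c ab] val by fastforce
  qed (use val in auto)
qed

section \<open>Monotone paths\<close>

text \<open>In the chart of any common transversal \<open>U\<close> the form of \<open>L2\<close>
  over \<open>L1\<close> is \<open>\<omega> v (A v)\<close>. Tilting \<open>U\<close> to the graph
  of \<open>B\<close>, whose form on \<open>U\<close> is \<open>c\<close> times the squared norm,
  adds \<open>c\<close> times the squared norm of \<open>A v\<close>. This wins for large
  \<open>c\<close>, as \<open>A\<close> vanishes on \<open>L1\<close> exactly along
  \<open>L1 \<inter> L2\<close> and is bounded below on an orthogonal complement of it.\<close>

lemma nonneg_transversal_ex:
  assumes L1: "lagrangian \<omega> L1" and L2: "lagrangian \<omega> L2"
  obtains W where "transv W L1" "transv W L2" "\<And>x. x \<in> L1 \<Longrightarrow> \<omega> x (gr W L2 x) \<ge> 0"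
proof -
  obtain U where U1: "transv U L1" and U2: "transv U L2"
    using transv_ex[OF L1 L2] by blast
  define A where "A = gr U L2"
  define K where "K = L2 \<inter> L1"
  define N where "N = {y\<in>L1. \<forall>x\<in>K. orthogonal x y}"
  have sub1: "subspace L1" and subK: "subspace K"
    using lagrangianD(1)[OF L1] lagrangianD(1)[OF L2] by (auto simp: K_def subspace_inter)
  have subN: "subspace N"
    using sub1 by (auto simp: N_def subspace_def orthogonal_def inner_add_right)
  note linA = linear_gr[OF U2, folded A_def]
  have A0: "A v = 0 \<longleftrightarrow> v \<in> L2" for v
    unfolding A_def by (rule gr_eq_0_iff[OF U2])
  have bilA: "bilinear (\<lambda>u v. A u \<bullet> A v)"
    by (rule bilinearI_real) (simp_all add: linear_add[OF linA] linear_cmul[OF linA] inner_add_left inner_add_right)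
  have posA: "A v \<bullet> A v > 0" if "v \<in> N" "v \<noteq> 0" for v
  proof -
    have "v \<notin> L2"
    proof
      assume "v \<in> L2"
      then have "orthogonal v v"
        using that(1) by (auto simp: N_def K_def)
      then show False
        using that(2) by (simp add: orthogonal_def)
    qed
    then show ?thesis
      using A0 by simp
  qed
  obtain m where m: "m > 0" "\<And>v. v \<in> N \<Longrightarrow> A v \<bullet> A v \<ge> m * (norm v)\<^sup>2"
    using positive_definite_lower_bound[OF bilA subN posA] by blast
  obtain M where M: "\<And>v. \<bar>\<omega> v (A v)\<bar> \<le> M * (norm v)\<^sup>2" "M \<ge> 0"
  proof
    show "\<bar>\<omega> v (A v)\<bar> \<le> (\<Sum>i\<in>Basis. \<Sum>j\<in>Basis. \<bar>\<omega> i (A j)\<bar>) * (norm v)\<^sup>2" for v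
      unfolding power2_eq_square A_def by (rule bilinear_bound_Basis[OF bilinear_gr[OF U2]])
  qed (simp add: sum_nonneg)
  \<comment> \<open>\<open>M / m\<close> absorbs the original form; the extra 1 leaves the squared
    norm of \<open>A v\<close>, which makes \<open>W\<close> transversal to
    \<open>L2\<close>.\<close>
  define c where "c = M / m + 1"
  have key: "\<omega> v (A v) + c * (A v \<bullet> A v) \<ge> A v \<bullet> A v" if v: "v \<in> L1" for v
  proof -
    define k where "k = proj K v"
    define y where "y = v - k"
    have k: "k \<in> K" and orth: "\<And>z. z \<in> K \<Longrightarrow> y \<bullet> z = 0"
      using proj_mem_orthogonal[OF subK] by (auto simp: k_def y_def)
    have y: "y \<in> N"
      using v k orth sub1 by (auto simp: N_def y_def K_def orthogonal_def inner_commute subspace_diff)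
    have "A k = 0"
      using k A0 by (simp add: K_def)
    then have Av: "A v = A y"
      by (simp add: y_def linear_diff[OF linA])
    have "\<omega> k (A y) = \<omega> y (A k)"
      unfolding A_def using k y by (intro gr_symmetric[OF U2 L1]) (auto simp: K_def N_def)
    then have "\<omega> v (A v) = \<omega> y (A y)"
      unfolding Av using \<open>A k = 0\<close> by (simp add: y_def om)
    moreover have "\<bar>\<omega> y (A y)\<bar> \<le> (M / m) * (A y \<bullet> A y)"
    proof -
      have "\<bar>\<omega> y (A y)\<bar> \<le> (M / m) * (m * (norm y)\<^sup>2)"
        using M(1)[of y] m(1) by simp
      also have "\<dots> \<le> (M / m) * (A y \<bullet> A y)"
        using m M(2) y by (intro mult_left_mono) auto
      finally show ?thesis .
    qed
    ultimately show ?thesis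
      unfolding Av c_def by (simp add: ring_distribs)
  qed
  define B where "B u = c *\<^sub>R (J u + gr U L1 (J u))" for u
  have BL: "B u \<in> L1" for u
    unfolding B_def using gr_mem(2)[OF U1] sub1 by (simp add: subspace_scale)
  have Bform: "\<omega> u (B u') = c * (u \<bullet> u')" if "u \<in> U" for u u'
    using lagrangianD(3)[OF transvD(1)[OF U1] that gr_mem(1)[OF U1]] by (simp add: B_def om om_J)
  have linB: "linear B"
    unfolding B_def
    by (rule linearI) (simp_all add: linear_add[OF linear_J] linear_cmul[OF linear_J] gr_simps[OF U1] algebra_simps)
  have sB: "sym_map L1 U B"
    unfolding sym_map_def using linB BL Bform by (simp add: inner_commute)
  define W where "W = graph U B"
  have W1: "transv W L1"
    unfolding W_def by (rule transv_sym[OF transv_graph(1)[OF transv_sym[OF U1] sB]])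
  have Au: "A v = u" if "u \<in> U" "v + u \<in> L2" for u v
    unfolding A_def by (rule gr_unique[OF U2 that])
  have "x = 0" if x: "x \<in> W" "x \<in> L2" for x
  proof -
    from x(1) obtain u where u: "u \<in> U" "x = u + B u"
      by (auto simp: W_def graph_def)
    have "A (B u) = u"
      using u x(2) by (intro Au) (simp_all add: add.commute)
    then have "\<omega> (B u) u + c * (u \<bullet> u) \<ge> u \<bullet> u"
      using key[OF BL, of u] by simp
    moreover have "\<omega> (B u) u = - c * (u \<bullet> u)"
      using Bform[OF u(1), of u] om_skew[of "B u" u] by simp
    ultimately have "u \<bullet> u \<le> 0" by simp
    then have "u = 0"
      using inner_ge_zero[of u] by simp
    then show "x = 0"
      using u(2) linear_0[OF linB] by simp
  qed
  then have W2: "transv W L2"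
    using transvD(1)[OF W1] L2 lagrangianD(4) unfolding transv_def by blast
  have "\<omega> x (gr W L2 x) \<ge> 0" if x: "x \<in> L1" for x
  proof -
    obtain u where u: "u \<in> U" "gr W L2 x = u + B u"
      using gr_mem(1)[OF W2, of x] by (auto simp: W_def graph_def)
    let ?v = "x + B u"
    have "?v + u \<in> L2"
      using gr_mem(2)[OF W2, of x] u(2) by (simp add: algebra_simps)
    then have Av: "A ?v = u"
      by (rule Au[OF u(1)])
    have "?v \<in> L1"
      using x BL sub1 by (simp add: subspace_add)
    from key[OF this] have "\<omega> ?v u + c * (u \<bullet> u) \<ge> u \<bullet> u"
      unfolding Av .
    moreover have "\<omega> (B u) u = - c * (u \<bullet> u)"
      using Bform[OF u(1), of u] om_skew[of "B u" u] by simp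
    moreover have "\<omega> x (B u) = 0"
      using lagrangianD(3)[OF L1 x BL] .
    ultimately have "\<omega> x (u + B u) \<ge> u \<bullet> u"
      by (simp add: om)
    then show ?thesis
      unfolding u(2) using inner_ge_zero[of u] by (rule order_trans[rotated])
  qed
  with W1 W2 show thesis
    using that by blast
qed

section \<open>The ray of a positive semidefinite form\<close>

context
  fixes W M D
  assumes T: "transv W M" and D: "sym_map W M D" and nonneg: "\<And>x. x \<in> M \<Longrightarrow> \<omega> x (D x) \<ge> 0"
begin

definition ray :: "real \<Rightarrow> 'a set" where
  "ray s = graph M (\<lambda>x. s *\<^sub>R D x)"

definition null :: "'a set" where
  "null = {x\<in>M. D x = 0}"

lemma sym_map_ray: "sym_map W M (\<lambda>x. s *\<^sub>R D x)"
  by (rule sym_map_scale[OF transvD(4)[OF T] D])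

lemma transv_ray: "transv W (ray s)"
  unfolding ray_def by (rule transv_graph(1)[OF T sym_map_ray])

lemma linD: "linear D"
  by (rule sym_mapD(1)[OF D])

lemma cont_lag_ray: "cont_lag {0..1} ray"
proof -
  have "cont_lag {0..1} (\<lambda>s. graph M (\<lambda>x. s *\<^sub>R D x))"
    by (rule cont_lag_graph[OF T sym_map_ray]) (intro continuous_intros)
  then show ?thesis
    by (simp add: ray_def[abs_def])
qed

text \<open>An isotropic vector of a semidefinite form lies in its radical, so \<open>D z\<close> is
  orthogonal to \<open>M\<close> and belongs to both \<open>M\<close> and \<open>W\<close>.\<close>

lemma null_vector:
  assumes "z \<in> M" "\<omega> z (D z) = 0"
  shows "z \<in> null"
proof -
  have bil: "bilinear (\<lambda>u v. \<omega> u (D v))"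
    by (rule bilinearI_real) (simp_all add: om linear_add[OF linD] linear_cmul[OF linD])
  have "\<omega> (D z) y = 0" if y: "y \<in> M" for y
  proof -
    have "\<omega> y (D z) = 0"
    proof (rule semidefinite_null_vector[OF bil _ _ assms(2)])
      show "\<omega> y (D z) = \<omega> z (D y)"
        by (rule sym_mapD(3)[OF D y assms(1)])
      show "0 \<le> \<omega> (y + t *\<^sub>R z) (D (y + t *\<^sub>R z))" for t
        using y assms(1) transvD(5)[OF T] by (intro nonneg) (simp add: subspace_add subspace_scale)
    qed
    then show ?thesis
      using om_skew[of "D z" y] by simp
  qed
  then have "D z \<in> M"
    by (rule lagrangian_memI[OF transvD(2)[OF T]])
  then have "D z = 0"
    using sym_mapD(2)[OF D assms(1)] transvD(3)[OF T] by blast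
  then show ?thesis
    using assms(1) by (simp add: null_def)
qed

lemma subspace_null: "subspace null"
  using transvD(5)[OF T]
  by (auto simp: null_def subspace_def linear_0[OF linD] linear_add[OF linD] linear_cmul[OF linD])

lemma null_subset_ray: "null \<subseteq> ray s"
  unfolding null_def ray_def graph_def by force

lemma Int_ray_1: "M \<inter> ray 1 = null"
proof
  show "M \<inter> ray 1 \<subseteq> null"
  proof
    fix x assume x: "x \<in> M \<inter> ray 1"
    then obtain y where y: "y \<in> M" "x = y + D y"
      by (auto simp: ray_def graph_def)
    then have "D y = x - y" by simp
    then have "D y \<in> M"
      using x y(1) transvD(5)[OF T] by (metis IntD1 subspace_diff)
    then have "D y = 0"
      using sym_mapD(2)[OF D y(1)] transvD(3)[OF T] by blast
    then show "x \<in> null"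
      using y by (simp add: null_def)
  qed
  show "null \<subseteq> M \<inter> ray 1"
    using null_subset_ray by (auto simp: null_def)
qed

text \<open>Serves twice: for \<open>r\<close> tending to \<open>s\<close> it gives the derivative
  of the chart form, and for distinct parameters it makes the intersections with a Lagrangian
  orthogonal for the form of \<open>D\<close>.\<close>

lemma ray_pairing:
  assumes "y \<in> M" "z \<in> M"
  shows "\<omega> (y + s *\<^sub>R D y) (z + r *\<^sub>R D z) = (r - s) * \<omega> y (D z)"
proof -
  have "\<omega> y z = 0" "\<omega> (D y) (D z) = 0"
    using lagrangianD(3)[OF transvD(2)[OF T]] lagrangianD(3)[OF transvD(1)[OF T]] sym_mapD(2)[OF D] assms
    by auto
  moreover have "\<omega> (D y) z = - \<omega> y (D z)"
    using sym_mapD(3)[OF D assms] om_skew[of "D y" z] by simp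
  ultimately show ?thesis
    by (simp add: om algebra_simps)
qed

text \<open>With \<open>y s\<close> the \<open>M\<close>-coordinate of the point of
  \<open>ray s\<close> over \<open>v\<close>, the increment from \<open>s\<close> to
  \<open>r\<close> is exactly \<open>(r - s) * \<omega> (y s) (D (y r))\<close>. So in any chart the
  derivative is the semidefinite form at \<open>y s\<close>.\<close>

lemma chart_form_mono:
  assumes W': "transv W' L0" and pq: "p \<le> q" "{p..q} \<subseteq> {0..1}"
    and tr: "\<And>s. s \<in> {p..q} \<Longrightarrow> transv W' (ray s)" and v: "v \<in> L0"
  shows "\<omega> v (gr W' (ray p) v) \<le> \<omega> v (gr W' (ray q) v)"
proof -
  let ?\<alpha> = "\<lambda>s. \<omega> v (gr W' (ray s) v)"
  define y where "y s = (v + gr W' (ray s) v) + gr W M (v + gr W' (ray s) v)" for s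
  have yM: "y s \<in> M" for s
    unfolding y_def by (rule gr_mem(2)[OF T])
  have xy: "v + gr W' (ray s) v = y s + s *\<^sub>R D (y s)" if s: "s \<in> {p..q}" for s
  proof -
    have "v + gr W' (ray s) v \<in> ray s"
      by (rule gr_mem(2)[OF tr[OF s]])
    then obtain z where z: "z \<in> M" "v + gr W' (ray s) v = z + s *\<^sub>R D z"
      by (auto simp: ray_def graph_def)
    have "gr W M (s *\<^sub>R D z) = - (s *\<^sub>R D z)"
      by (rule gr_on_W[OF T sym_mapD(2)[OF sym_map_ray z(1)]])
    then have "y s = z"
      unfolding y_def z(2) gr_simps(1)[OF T] using gr_eq_0[OF T z(1)] by simp
    then show ?thesis
      using z(2) by simp
  qed
  have diff: "?\<alpha> r - ?\<alpha> s = (r - s) * \<omega> (y s) (D (y r))" if "s \<in> {p..q}" "r \<in> {p..q}" for s r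
  proof -
    have "\<omega> (gr W' (ray s) v) (gr W' (ray r) v) = 0"
      using lagrangianD(3)[OF transvD(1)[OF W']] gr_mem(1)[OF tr] that by blast
    then have "\<omega> (v + gr W' (ray s) v) (v + gr W' (ray r) v) = ?\<alpha> r - ?\<alpha> s"
      using om_skew[of "gr W' (ray s) v" v] by (simp add: om)
    then show ?thesis
      unfolding xy[OF that(1)] xy[OF that(2)] ray_pairing[OF yM yM] by simp
  qed
  have c: "cont_lag {p..q} ray"
    by (rule cont_lag_subset[OF cont_lag_ray pq(2)])
  have gl: "((\<lambda>r. gr W' (ray r) v) \<longlongrightarrow> gr W' (ray s) v) (at s within {p..q})" if "s \<in> {p..q}" for s
    by (rule gr_tendsto[OF tr[OF that] cont_lagD(2,3)[OF c that]])
  have yl: "(y \<longlongrightarrow> y s) (at s within {p..q})" if "s \<in> {p..q}" for s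
    unfolding y_def by (intro tendsto_add tendsto_const gl that linear_tendsto[OF linear_gr[OF T]])
  show ?thesis
  proof (rule DERIV_nonneg_imp_increasing_open[OF pq(1)])
    show "continuous_on {p..q} ?\<alpha>"
      unfolding continuous_on_def by (intro ballI tendsto_om tendsto_const gl)
    fix s assume s: "p < s" "s < q"
    then have s': "s \<in> {p..q}" by simp
    have "((\<lambda>r. \<omega> (y s) (D (y r))) \<longlongrightarrow> \<omega> (y s) (D (y s))) (at s within {p..q})"
      by (intro tendsto_om tendsto_const linear_tendsto[OF linD] yl s')
    moreover have "\<forall>\<^sub>F r in at s within {p..q}. \<omega> (y s) (D (y r)) = (?\<alpha> r - ?\<alpha> s) / (r - s)"
      unfolding eventually_at_filter
      by (rule always_eventually) (use diff s' in auto)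
    ultimately have "((\<lambda>r. (?\<alpha> r - ?\<alpha> s) / (r - s)) \<longlongrightarrow> \<omega> (y s) (D (y s))) (at s within {p..q})"
      by (rule Lim_transform_eventually)
    then have "(?\<alpha> has_real_derivative \<omega> (y s) (D (y s))) (at s within {p..q})"
      by (simp add: has_field_derivative_iff)
    then have "(?\<alpha> has_real_derivative \<omega> (y s) (D (y s))) (at s)"
      using s by (simp add: at_within_Icc_at)
    then show "\<exists>y. DERIV ?\<alpha> s :> y \<and> 0 \<le> y"
      using nonneg[OF yM] by blast
  qed
qed

text \<open>Before \<open>x\<close>, monotonicity bounds the index above by its value at
  \<open>x\<close> and semicontinuity bounds it below, so there is no jump. After \<open>x\<close>
  neither inertia index is below its value at \<open>x\<close>, so the gain is at most the loss of
  nullity; and the nullity is never less than the dimension of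
  \<open>null \<inter> L0\<close>.\<close>

lemma ray_jump:
  assumes L0: "lagrangian \<omega> L0" and F: "index_fun L0 ray {0..1} F" and x: "x \<in> {0..1}"
  shows "\<exists>e>0. \<forall>s\<in>{0..1}. \<bar>s - x\<bar> < e \<longrightarrow> (s < x \<longrightarrow> F s = F x) \<and>
    (x < s \<longrightarrow> F x \<le> F s \<and> F s + int (dim (null \<inter> L0)) \<le> F x + int (dim (ray x \<inter> L0)))"
proof -
  obtain W' where W0: "transv W' L0" and Wx: "transv W' (ray x)"
    using transv_ex[OF L0 cont_lagD(1)[OF cont_lag_ray x]] by blast
  let ?Fl = "at x within {0..1::real}"
  note c = cont_lagD(2,3)[OF cont_lag_ray x]
  have tr: "\<forall>\<^sub>F s in ?Fl. transv W' (ray s)"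
    by (rule transv_eventually[OF Wx c])
  have bil: "\<forall>\<^sub>F s in ?Fl. bilinear (\<lambda>u v. \<omega> u (gr W' (ray s) v))"
    using tr by eventually_elim (rule bilinear_gr)
  have bil': "\<forall>\<^sub>F s in ?Fl. bilinear (\<lambda>u v. - \<omega> u (gr W' (ray s) v))"
    using bil
  proof eventually_elim
    case (elim s)
    show ?case
      by (rule bilinearI_real) (simp_all add: bilinear_forms[OF elim])
  qed
  have lim: "((\<lambda>s. \<omega> u (gr W' (ray s) v)) \<longlongrightarrow> \<omega> u (gr W' (ray x) v)) ?Fl" for u v
    by (intro tendsto_om tendsto_const gr_tendsto[OF Wx c])
  have bx': "bilinear (\<lambda>u v. - \<omega> u (gr W' (ray x) v))"
    by (rule bilinearI_real) (simp_all add: bilinear_forms[OF bilinear_gr[OF Wx]])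
  have sub0: "subspace L0"
    by (rule lagrangianD(1)[OF L0])
  have "\<forall>\<^sub>F s in ?Fl. transv W' (ray s) \<and> chart_index L0 W' (ray x) \<le> chart_index L0 W' (ray s)
      \<and> n_plus (\<lambda>v. - \<omega> v (gr W' (ray x) v)) L0 \<le> n_plus (\<lambda>v. - \<omega> v (gr W' (ray s) v)) L0
      \<and> F s - int (chart_index L0 W' (ray s)) = F x - int (chart_index L0 W' (ray x))"
    unfolding chart_index_def
    by (intro eventually_conj tr index_funD[OF F x W0 Wx, unfolded chart_index_def]
        n_plus_lower_semicontinuous[OF bil bilinear_gr[OF Wx] lim sub0]
        n_plus_lower_semicontinuous[OF bil' bx' tendsto_minus[OF lim] sub0])
  then obtain e where e: "e > 0" and near: "\<And>s. s \<in> {0..1} \<Longrightarrow> s \<noteq> x \<Longrightarrow> \<bar>s - x\<bar> < e \<Longrightarrow>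
      transv W' (ray s) \<and> chart_index L0 W' (ray x) \<le> chart_index L0 W' (ray s)
      \<and> n_plus (\<lambda>v. - \<omega> v (gr W' (ray x) v)) L0 \<le> n_plus (\<lambda>v. - \<omega> v (gr W' (ray s) v)) L0
      \<and> F s - int (chart_index L0 W' (ray s)) = F x - int (chart_index L0 W' (ray x))"
    unfolding eventually_at dist_real_def by blast
  have trn: "transv W' (ray s)" if "s \<in> {0..1}" "\<bar>s - x\<bar> < e" for s
    using near[OF that(1) _ that(2)] Wx by (cases "s = x") auto
  have "F s = F x" if s: "s \<in> {0..1}" "\<bar>s - x\<bar> < e" "s < x" for s
  proof -
    have "chart_index L0 W' (ray s) \<le> chart_index L0 W' (ray x)"
      unfolding chart_index_def
      by (rule n_plus_mono[OF subspace_0[OF sub0]], rule chart_form_mono[OF W0])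
        (use s x trn in auto)
    then show ?thesis
      using near[OF s(1) _ s(2)] s(3) by simp
  qed
  moreover have "F x \<le> F s \<and> F s + int (dim (null \<inter> L0)) \<le> F x + int (dim (ray x \<inter> L0))"
    if s: "s \<in> {0..1}" "\<bar>s - x\<bar> < e" "x < s" for s
  proof -
    note n = near[OF s(1) _ s(2)]
    have "dim (null \<inter> L0) \<le> dim (ray s \<inter> L0)"
      using null_subset_ray by (intro dim_subset) auto
    then show ?thesis
      using n s(3) chart_sylvester[OF Wx W0] chart_sylvester[OF trn[OF s(1,2)] W0] by simp
  qed
  ultimately show ?thesis
    using e by blast
qed

text \<open>For distinct parameters the intersections with \<open>L0\<close>, read off in \<open>M\<close>, are orthogonal for
  the semidefinite form of \<open>D\<close>, hence independent modulo its null space.\<close>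

lemma ray_intersections:
  assumes L0: "lagrangian \<omega> L0" and S: "finite S"
  shows "(\<Sum>s\<in>S. int (dim (ray s \<inter> L0)) - int (dim (null \<inter> L0))) \<le> int (dim M) - int (dim null)"
proof -
  \<comment> \<open>\<open>ray s \<inter> L0\<close> transported to \<open>M\<close>, where the
    intersections for different \<open>s\<close> can be compared.\<close>
  define X where "X s = {y\<in>M. y + s *\<^sub>R D y \<in> L0}" for s
  have subM: "subspace M" and sub0: "subspace L0"
    using transvD(5)[OF T] lagrangianD(1)[OF L0] by auto
  have subX: "subspace (X s)" for s
    unfolding subspace_def
  proof (intro conjI allI ballI)
    show "0 \<in> X s"
      using subM sub0 by (simp add: X_def subspace_0 linear_0[OF linD])
    fix x y assume x: "x \<in> X s" and y: "y \<in> X s"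
    have "(x + s *\<^sub>R D x) + (y + s *\<^sub>R D y) \<in> L0"
      using x y by (intro subspace_add[OF sub0, of "x + s *\<^sub>R D x"]) (auto simp: X_def)
    then show "x + y \<in> X s"
      using x y subM by (simp add: X_def subspace_add linear_add[OF linD] algebra_simps)
  next
    fix x c assume x: "x \<in> X s"
    have "c *\<^sub>R (x + s *\<^sub>R D x) \<in> L0"
      using x by (intro subspace_scale[OF sub0, of "x + s *\<^sub>R D x"]) (auto simp: X_def)
    then show "c *\<^sub>R x \<in> X s"
      using x subM by (simp add: X_def subspace_scale linear_cmul[OF linD] algebra_simps)
  qed
  have dimX: "dim (ray s \<inter> L0) = dim (X s)" for s
  proof -
    let ?f = "\<lambda>y. y + s *\<^sub>R D y"
    have lin: "linear ?f"
      by (rule linearI) (simp_all add: linear_add[OF linD] linear_cmul[OF linD] algebra_simps)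
    have "inj_on ?f (X s)"
    proof (rule inj_onI)
      fix y z assume yz: "y \<in> X s" "z \<in> X s" "?f y = ?f z"
      have "y + gr W M y = y" "z + gr W M z = z"
        using yz gr_eq_0[OF T] by (auto simp: X_def)
      moreover have "?f v + gr W M (?f v) = v" if "v \<in> M" for v
        using gr_eq_0[OF T that] gr_on_W[OF T sym_mapD(2)[OF D that]] by (simp add: gr_simps[OF T])
      ultimately show "y = z"
        using yz by (metis (mono_tags, lifting) X_def mem_Collect_eq)
    qed
    then have "dim (?f ` X s) = dim (X s)"
      using subX[of s] by (intro dim_image_eq[OF lin]) (simp add: span_eq_iff[THEN iffD2])
    moreover have "?f ` X s = ray s \<inter> L0"
      by (auto simp: X_def ray_def graph_def)
    ultimately show ?thesis by simp
  qed
  have orthX: "\<omega> x (D z) = 0" if "x \<in> X s" "z \<in> X r" "s \<noteq> r" for x z s r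
  proof -
    have "\<omega> (x + s *\<^sub>R D x) (z + r *\<^sub>R D z) = 0"
      using that lagrangianD(3)[OF L0] by (auto simp: X_def)
    then show ?thesis
      using ray_pairing[of x z s r] that by (simp add: X_def)
  qed
  \<comment> \<open>The invariant keeps \<open>Y\<close> orthogonal, for the form of
    \<open>D\<close>, to every intersection not yet added. A common vector of \<open>Y\<close> and
    the next \<open>X s\<close> is then isotropic and lies in \<open>null \<inter> L0\<close>, which
    bounds the loss of dimension in the sum.\<close>
  have "\<exists>Y. subspace Y \<and> null \<subseteq> Y \<and> Y \<subseteq> M \<and>
      int (dim null) + (\<Sum>s\<in>S. int (dim (X s)) - int (dim (null \<inter> L0))) \<le> int (dim Y) \<and>
      (\<forall>r. r \<notin> S \<longrightarrow> (\<forall>y\<in>Y. \<forall>z\<in>X r. \<omega> y (D z) = 0))"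
    using S
  proof (induction S rule: finite_induct)
    case empty
    have "\<omega> y (D z) = 0" if "y \<in> null" "z \<in> X r" for y z r
      using that sym_mapD(3)[OF D, of y z] by (auto simp: null_def X_def om)
    then show ?case
      using subspace_null by (intro exI[of _ null]) (auto simp: null_def)
  next
    case (insert s S)
    then obtain Y where Y: "subspace Y" "null \<subseteq> Y" "Y \<subseteq> M"
      "int (dim null) + (\<Sum>s\<in>S. int (dim (X s)) - int (dim (null \<inter> L0))) \<le> int (dim Y)"
      "\<And>r y z. r \<notin> S \<Longrightarrow> y \<in> Y \<Longrightarrow> z \<in> X r \<Longrightarrow> \<omega> y (D z) = 0"
      by blast
    have XM: "X s \<subseteq> M"
      by (auto simp: X_def)
    have "Y \<inter> X s \<subseteq> null \<inter> L0"
    proof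
      fix z assume z: "z \<in> Y \<inter> X s"
      then have "\<omega> z (D z) = 0"
        using Y(5)[OF insert.hyps(2)] by blast
      then have "z \<in> null"
        using z XM by (intro null_vector) auto
      then show "z \<in> null \<inter> L0"
        using z by (simp add: X_def null_def)
    qed
    then have "dim (Y \<inter> X s) \<le> dim (null \<inter> L0)"
      by (rule dim_subset)
    moreover have "dim (subspace_sum Y (X s)) + dim (Y \<inter> X s) = dim Y + dim (X s)"
      by (rule dim_subspace_sum_Int[OF Y(1) subX])
    ultimately have "int (dim null) + (\<Sum>s\<in>insert s S. int (dim (X s)) - int (dim (null \<inter> L0)))
        \<le> int (dim (subspace_sum Y (X s)))"
      using Y(4) insert.hyps by simp
    moreover have "subspace (subspace_sum Y (X s))"
      by (rule subspace_subspace_sum[OF Y(1) subX])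
    moreover have "subspace_sum Y (X s) \<subseteq> M"
      by (rule subspace_sum_subset[OF subM Y(3) XM])
    moreover have "null \<subseteq> subspace_sum Y (X s)"
      unfolding subspace_sum_def using Y(2) subspace_0[OF subX[of s]] by force
    moreover have "\<omega> y (D z) = 0" if "r \<notin> insert s S" "y \<in> subspace_sum Y (X s)" "z \<in> X r" for r y z
      using that Y(5)[of r _ z] orthX[of _ s z r] by (auto simp: subspace_sum_def om)
    ultimately show ?case
      by (intro exI[of _ "subspace_sum Y (X s)"]) blast
  qed
  then obtain Y where "Y \<subseteq> M" "int (dim null) + (\<Sum>s\<in>S. int (dim (X s)) - int (dim (null \<inter> L0))) \<le> int (dim Y)"
    by blast
  then show ?thesis
    using dim_subset[of Y M] by (simp add: dimX)
qed

text \<open>Each jump is at most the excess \<open>d s\<close> at its parameter, and jumps occur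
  only to the right of a parameter, so 1 is never among them. The intersection bound is applied with
  1 added, and the dimension formula turns \<open>dim null + d 1\<close> into the dimension of the
  sum of \<open>null\<close> and \<open>ray 1 \<inter> L0\<close>.\<close>

lemma ray_index_bounds:
  assumes L0: "lagrangian \<omega> L0" and F: "index_fun L0 ray {0..1} F"
  shows "F 0 \<le> F 1"
    and "F 1 - F 0 \<le> int (dim M) - int (dim (subspace_sum (M \<inter> ray 1) (ray 1 \<inter> L0)))"
proof -
  define d where "d s = int (dim (ray s \<inter> L0)) - int (dim (null \<inter> L0))" for s
  have dnn: "0 \<le> d s" for s
    unfolding d_def using dim_subset[of "null \<inter> L0" "ray s \<inter> L0"] null_subset_ray[of s] by auto
  \<comment> \<open>The half-open interval makes the parameter sets of adjacent intervals disjoint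
    and excludes 1 at the end.\<close>
  define P where "P p q \<longleftrightarrow> (0 \<le> p \<and> p < q \<and> q \<le> 1 \<longrightarrow> F p \<le> F q \<and>
      (\<exists>S. finite S \<and> S \<subseteq> {p..<q} \<and> F q - F p \<le> (\<Sum>s\<in>S. d s)))" for p q
  \<comment> \<open>Names in place of the numerals, so that the interval induction can vary the end
    points without touching the numerals inside \<open>P\<close>.\<close>
  define a b :: real where "a = 0" and "b = 1"
  have "a \<le> b"
    by (simp add: a_def b_def)
  then have "P a b"
  proof (induction a b rule: Bolzano)
    case (trans p q r)
    show ?case
    proof (cases "p < q \<and> q < r \<and> 0 \<le> p \<and> r \<le> 1")
      case True
      then obtain S1 S2 where S: "finite S1" "S1 \<subseteq> {p..<q}" "F q - F p \<le> (\<Sum>s\<in>S1. d s)"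
          "finite S2" "S2 \<subseteq> {q..<r}" "F r - F q \<le> (\<Sum>s\<in>S2. d s)" and le: "F p \<le> F q" "F q \<le> F r"
        using trans(1,2) unfolding P_def by auto
      have "S1 \<inter> S2 = {}"
        using S(2,5) by fastforce
      then have "F r - F p \<le> (\<Sum>s\<in>S1 \<union> S2. d s)"
        using S by (simp add: sum.union_disjoint)
      moreover have "S1 \<union> S2 \<subseteq> {p..<r}"
        using S(2,5) True by fastforce
      ultimately show ?thesis
        unfolding P_def using S(1,4) le by (intro impI conjI exI[of _ "S1 \<union> S2"]) auto
    next
      case False
      then show ?thesis
        using trans by (cases "p = q"; cases "q = r") (auto simp: P_def)
    qed
  next
    case (local x)
    then have "x \<in> {0..1}"
      by (simp add: a_def b_def)
    from ray_jump[OF L0 F this] obtain e where e: "e > 0"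
      and left: "\<And>s. s \<in> {0..1} \<Longrightarrow> \<bar>s - x\<bar> < e \<Longrightarrow> s < x \<Longrightarrow> F s = F x"
      and right: "\<And>s. s \<in> {0..1} \<Longrightarrow> \<bar>s - x\<bar> < e \<Longrightarrow> x < s \<Longrightarrow> F x \<le> F s \<and> F s - F x \<le> d x"
      unfolding d_def by (auto simp: algebra_simps)
    have "P p q" if pq: "p \<le> x" "x \<le> q" "q - p < e" for p q
      unfolding P_def
    proof (intro impI)
      assume *: "0 \<le> p \<and> p < q \<and> q \<le> 1"
      have Fp: "F p = F x"
        using left[of p] pq * by (cases "p = x") auto
      show "F p \<le> F q \<and> (\<exists>S. finite S \<and> S \<subseteq> {p..<q} \<and> F q - F p \<le> (\<Sum>s\<in>S. d s))"
      proof (cases "x < q")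
        case True
        then have "F x \<le> F q \<and> F q - F x \<le> d x"
          using pq * by (intro right) auto
        then show ?thesis
          using Fp True pq by (intro conjI exI[of _ "{x}"]) auto
      next
        case False
        then have "q = x"
          using pq by simp
        then show ?thesis
          using Fp by (intro conjI exI[of _ "{}"]) auto
      qed
    qed
    then show ?case
      using e by blast
  qed
  then obtain S where S: "finite S" "S \<subseteq> {0..<1}" "F 1 - F 0 \<le> (\<Sum>s\<in>S. d s)" and le: "F 0 \<le> F 1"
    unfolding P_def a_def b_def by auto
  show "F 0 \<le> F 1"
    by (rule le)
  have "1 \<notin> S"
    using S(2) by auto
  then have "(\<Sum>s\<in>S. d s) + d 1 = (\<Sum>s\<in>insert 1 S. d s)"
    using S(1) by simp
  also have "\<dots> \<le> int (dim M) - int (dim null)"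
    unfolding d_def by (rule ray_intersections[OF L0]) (simp add: S(1))
  finally have "F 1 - F 0 + d 1 \<le> int (dim M) - int (dim null)"
    using S(3) by linarith
  moreover have "subspace (ray 1 \<inter> L0)"
    using transvD(5)[OF transv_ray] lagrangianD(1)[OF L0] by (rule subspace_inter)
  then have "dim (subspace_sum null (ray 1 \<inter> L0)) + dim (null \<inter> (ray 1 \<inter> L0)) = dim null + dim (ray 1 \<inter> L0)"
    by (rule dim_subspace_sum_Int[OF subspace_null])
  moreover have "null \<inter> (ray 1 \<inter> L0) = null \<inter> L0"
    using null_subset_ray by blast
  ultimately show "F 1 - F 0 \<le> int (dim M) - int (dim (subspace_sum (M \<inter> ray 1) (ray 1 \<inter> L0)))"
    unfolding Int_ray_1 d_def by simp
qed

end

section \<open>Transport of rays and dimensions by symplectic maps\<close>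

lemma Sp_compose: "A \<in> Sp \<omega> \<Longrightarrow> B \<in> Sp \<omega> \<Longrightarrow> (\<lambda>x. A (B x)) \<in> Sp \<omega>"
  using linear_compose[of B A] bij_comp[of B A] by (simp add: Sp_def o_def)

text \<open>Conjugating \<open>D\<close> by \<open>A\<close> shows that the moved ray is again the
  ray of a semidefinite form, so the bounds for monotone paths hold at every time and not only at
  time 0.\<close>

lemma Sp_image_ray:
  assumes T: "transv W M" and D: "sym_map W M D" and nonneg: "\<And>x. x \<in> M \<Longrightarrow> \<omega> x (D x) \<ge> 0"
    and A: "A \<in> Sp \<omega>"
  defines "D' \<equiv> \<lambda>x. A (D (inv A x))"
  shows "transv (A ` W) (A ` M)" "sym_map (A ` W) (A ` M) D'" "\<And>x. x \<in> A ` M \<Longrightarrow> \<omega> x (D' x) \<ge> 0"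
    "graph (A ` M) (\<lambda>x. s *\<^sub>R D' x) = A ` graph M (\<lambda>x. s *\<^sub>R D x)"
proof -
  have lin: "linear A" and bij: "bij A" and om': "\<And>u v. \<omega> (A u) (A v) = \<omega> u v"
    using A by (auto simp: Sp_def)
  have inj: "inj A"
    using bij by (rule bij_is_inj)
  have D'A: "D' (A x) = A (D x)" for x
    by (simp add: D'_def inj)
  have "A ` W \<inter> A ` M = A ` (W \<inter> M)"
    using inj by (simp add: image_Int)
  then show "transv (A ` W) (A ` M)"
    using T lagrangian_image[OF _ A] linear_0[OF lin] by (simp add: transv_def)
  have "linear D'"
    unfolding D'_def using linear_compose[OF linear_compose[OF linear_inv[OF lin bij] sym_mapD(1)[OF D]] lin]
    by (simp add: o_def)
  then show "sym_map (A ` W) (A ` M) D'"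
    unfolding sym_map_def using sym_mapD(2,3)[OF D] by (auto simp: D'A om')
  show "\<omega> x (D' x) \<ge> 0" if "x \<in> A ` M" for x
    using that nonneg by (auto simp: D'A om')
  show "graph (A ` M) (\<lambda>x. s *\<^sub>R D' x) = A ` graph M (\<lambda>x. s *\<^sub>R D x)"
    unfolding graph_def by (simp add: image_image D'A linear_add[OF lin] linear_cmul[OF lin])
qed

text \<open>Brings the bound for the moved Lagrangians back to \<open>L1\<close>, \<open>L2\<close>
  and the preimage of \<open>L0\<close>, the terms in which \<open>epsb\<close> is stated.\<close>

lemma dim_subspace_sum_image:
  assumes A: "A \<in> Sp \<omega>"
  shows "dim (subspace_sum (A ` L1 \<inter> A ` L2) (A ` L2 \<inter> L0)) = dim (subspace_sum (L1 \<inter> L2) (L2 \<inter> A -` L0))"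
proof -
  have lin: "linear A" and inj: "inj A"
    using A by (auto simp: Sp_def bij_is_inj)
  have "A ` L1 \<inter> A ` L2 = A ` (L1 \<inter> L2)" "A ` L2 \<inter> L0 = A ` (L2 \<inter> A -` L0)"
    using inj by (auto simp: image_Int)
  moreover have "subspace_sum (A ` X) (A ` Y) = A ` subspace_sum X Y" for X Y
  proof
    show "subspace_sum (A ` X) (A ` Y) \<subseteq> A ` subspace_sum X Y"
      unfolding subspace_sum_def by (auto simp flip: linear_add[OF lin] intro!: imageI) blast
    show "A ` subspace_sum X Y \<subseteq> subspace_sum (A ` X) (A ` Y)"
      unfolding subspace_sum_def by (auto simp: linear_add[OF lin]) blast
  qed
  ultimately show ?thesis
    using inj by (simp add: dim_image_eq[OF lin] inj_on_subset)
qed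

end

theorem theorem2p9:
  fixes \<omega> :: "'a::euclidean_space \<Rightarrow> 'a \<Rightarrow> real"
    and n :: nat and T :: real
    and L0 L1 L2 :: "'a set"
    and \<psi> :: "real \<Rightarrow> 'a \<Rightarrow> 'a"
  assumes "symplectic_form \<omega>"
    and "DIM('a) = 2 * n"
    and "lagrangian \<omega> L0" and "lagrangian \<omega> L1" and "lagrangian \<omega> L2"
    and "0 < T"
    and "\<forall>t\<in>{0..T}. \<psi> t \<in> Sp \<omega>"
    and "\<forall>x. continuous_on {0..T} (\<lambda>t. \<psi> t x)"
    and "\<psi> 0 = id"
  shows "let l1 = (\<lambda>t. \<psi> t ` L1); l2 = (\<lambda>t. \<psi> t ` L2);
             mu0 = (\<lambda>t. \<psi> t -` L0);
             epsa = subspace_sum (L1 \<inter> L2) (L2 \<inter> L0);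
             epsb = subspace_sum (L1 \<inter> L2) (L2 \<inter> mu0 T);
             k = min (dim epsa) (dim epsb)
         in \<bar>iota_CLM \<omega> L0 l1 0 T - iota_CLM \<omega> L0 l2 0 T\<bar> \<le> int n - int k"
proof -
  interpret symplectic_space \<omega>
    by (rule symplectic_space.intro) fact
  note L0 = assms(3) and L1 = assms(4) and L2 = assms(5)
  have Sp: "\<psi> t \<in> Sp \<omega>" if "t \<in> {0..T}" for t
    using assms(7) that by blast
  obtain W where W1: "transv W L1" and W2: "transv W L2" and nonneg: "\<And>x. x \<in> L1 \<Longrightarrow> \<omega> x (gr W L2 x) \<ge> 0"
    using nonneg_transversal_ex[OF L1 L2] by blast
  define D where "D = gr W L2"
  note D = sym_map_gr[OF W2 L1, folded D_def] and nonneg = nonneg[folded D_def]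
  define \<mu> where "\<mu> s = graph L1 (\<lambda>x. s *\<^sub>R D x)" for s :: real
  have \<mu>0: "\<mu> 0 = L1"
    by (simp add: \<mu>_def graph_zero)
  have \<mu>1: "\<mu> 1 = L2"
    using graph_gr[OF W1 W2] by (simp add: \<mu>_def D_def)
  have sm: "sym_map W L1 (\<lambda>x. s *\<^sub>R D x)" for s
    by (rule sym_map_scale[OF transvD(4)[OF W1] D])
  let ?R = "{0..1::real} \<times> {0..T}"
  let ?h = "\<lambda>q. \<psi> (snd q) ` \<mu> (fst q)"
  \<comment> \<open>Absorbing the ray into a shear presents the rectangle as a symplectic family
    applied to the fixed \<open>L1\<close>, whose continuity is
    \<open>cont_lag_image\<close>.\<close>
  define G where "G = (\<lambda>q x. \<psi> (snd q) (shear W L1 (\<lambda>x. fst q *\<^sub>R D x) x))"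
  have "cont_lag ?R (\<lambda>q. G q ` L1)"
  proof (rule cont_lag_image[OF L1])
    show "G q \<in> Sp \<omega>" if "q \<in> ?R" for q
      unfolding G_def by (rule Sp_compose[OF Sp shear_Sp[OF W1 sm]]) (use that in auto)
    show "continuous_on ?R (\<lambda>q. G q x)" for x
      unfolding G_def
    proof (rule continuous_on_operator[where G = "\<lambda>q. \<psi> (snd q)"])
      show "linear (\<psi> (snd q))" if "q \<in> ?R" for q
        using Sp[of "snd q"] that by (auto simp: Sp_def)
      show "continuous_on ?R (\<lambda>q. \<psi> (snd q) x)" for x
        using assms(8) by (intro continuous_on_compose2[OF _ continuous_on_snd[OF continuous_on_id]]) auto
      show "continuous_on ?R (\<lambda>q. shear W L1 (\<lambda>x. fst q *\<^sub>R D x) x)"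
        unfolding shear_def by (intro continuous_intros)
    qed
  qed
  moreover have "(\<lambda>q. G q ` L1) = ?h"
    unfolding G_def \<mu>_def graph_eq_shear[OF W1 sm] image_image ..
  ultimately have c: "cont_lag ?R ?h"
    by simp
  obtain F where F: "index_fun L0 ?h ?R F"
    using index_fun_rectangle[OF L0 c] assms(6) by auto
  have row: "iota_CLM \<omega> L0 (\<lambda>t. \<psi> t ` \<mu> s) 0 T = F (s, T) - F (s, 0)" if s: "s \<in> {0..1}" for s
  proof (rule iota_CLM_eq_index_difference[OF L0 assms(6)])
    have "index_fun L0 (\<lambda>t. ?h (s, t)) {0..T} (\<lambda>t. F (s, t))"
      by (rule index_fun_compose[OF F])
        (use s in \<open>auto simp: inj_on_def intro!: continuous_on_Pair continuous_on_const continuous_on_id\<close>)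
    then show "index_fun L0 (\<lambda>t. \<psi> t ` \<mu> s) {0..T} (\<lambda>t. F (s, t))"
      by simp
    have "lagrangian \<omega> (\<mu> s)"
      unfolding \<mu>_def by (rule transvD(2)[OF transv_graph(1)[OF W1 sm]])
    then show "cont_lag {0..T} (\<lambda>t. \<psi> t ` \<mu> s)"
      using Sp assms(8) by (intro cont_lag_image) auto
  qed
  have dimL: "dim L = n" if "lagrangian \<omega> L" for L
    using lagrangianD(2)[OF that] assms(2) by simp
  \<comment> \<open>At each fixed time the family in \<open>s\<close> is the ray of the conjugated
    form, so its index bounds apply; only the times 0 and \<open>T\<close> are used below.\<close>
  have col: "F (0, t) \<le> F (1, t) \<and>
      F (1, t) - F (0, t) \<le> int n - int (dim (subspace_sum (L1 \<inter> L2) (L2 \<inter> \<psi> t -` L0)))"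
    if t: "t \<in> {0..T}" for t
  proof -
    have "index_fun L0 (\<lambda>s. ?h (s, t)) {0..1} (\<lambda>s. F (s, t))"
      by (rule index_fun_compose[OF F])
        (use t in \<open>auto simp: inj_on_def intro!: continuous_on_Pair continuous_on_const continuous_on_id\<close>)
    then have ix: "index_fun L0 (\<lambda>s. \<psi> t ` \<mu> s) {0..1} (\<lambda>s. F (s, t))"
      by simp
    note img = Sp_image_ray[OF W1 D nonneg Sp[OF t]]
    let ?D = "\<lambda>x. \<psi> t (D (inv (\<psi> t) x))"
    have ray: "ray (\<psi> t ` L1) ?D s = \<psi> t ` \<mu> s" for s
      using img(4) by (simp add: ray_def[OF img(1-3)] \<mu>_def)
    have ix': "index_fun L0 (ray (\<psi> t ` L1) ?D) {0..1} (\<lambda>s. F (s, t))"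
      using ix unfolding ray[symmetric] .
    have "dim (\<psi> t ` L1) = n"
      by (rule dimL[OF lagrangian_image[OF L1 Sp[OF t]]])
    then show ?thesis
      using ray_index_bounds[OF img(1-3) L0 ix'] dim_subspace_sum_image[OF Sp[OF t], of L1 L2 L0]
      by (simp add: ray \<mu>1)
  qed
  have "iota_CLM \<omega> L0 (\<lambda>t. \<psi> t ` L1) 0 T = F (0, T) - F (0, 0)"
    "iota_CLM \<omega> L0 (\<lambda>t. \<psi> t ` L2) 0 T = F (1, T) - F (1, 0)"
    using row[of 0] row[of 1] by (simp_all add: \<mu>0 \<mu>1)
  moreover have "F (0, 0) \<le> F (1, 0) \<and> F (1, 0) - F (0, 0) \<le> int n - int (dim (subspace_sum (L1 \<inter> L2) (L2 \<inter> L0)))"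
    using col[of 0] assms(6,9) by simp
  moreover have "F (0, T) \<le> F (1, T) \<and> F (1, T) - F (0, T) \<le> int n - int (dim (subspace_sum (L1 \<inter> L2) (L2 \<inter> \<psi> T -` L0)))"
    using col[of T] assms(6) by simp
  \<comment> \<open>Regrouped by columns, the difference of the two indices is
    \<open>(F (1, 0) - F (0, 0)) - (F (1, T) - F (0, T))\<close>. Both brackets are non-negative,
    and their upper bounds contain \<open>epsa\<close> and \<open>epsb\<close>, so the larger bound
    is \<open>n - k\<close>.\<close>
  ultimately show ?thesis
    unfolding Let_def by linarith
qed

end
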